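(* Let $\Gamma$ be a discrete, co-finite subgroup of $\mathrm{SL}_2(\mathbb{R})$ with a cusp at $\infty$ of width $1$, and let $f\in\mathcal{S}_k(\Gamma)$ be a cusp form of even weight $k$. Then the map $s(\Gamma)\setminus\{\infty\}\to\mathbb{C}$ defined by $$r\mapsto L(f\otimes e(r),k/2)$$ is a quantum modular form of weight zero for $\Gamma$. More precisely, for $\gamma\in\Gamma$ and $r\in s(\Gamma)\setminus\{\infty\}$ with $\gamma r\neq\infty$ and $\gamma\infty\neq\infty$, we have \begin{align*} &L(f\otimes e(\gamma r),k/2)-L(f\otimes e(r),k/2)\\ &=L(f\otimes e(\gamma\infty),k/2)+\sum_{j=1}^{k/2-1}\frac{\binom{k/2-1}{j}}{(c^{-1}j(\gamma,r))^j}\frac{(-2\pi i)^{-j}\Gamma(k/2+j)}{\Gamma(k/2)}L(f\otimes e(r),k/2+j)\\ &\qquad+\sum_{j=1}^{k/2-1}\frac{\binom{k/2-1}{j}}{(c\,j(\gamma,r))^j}\frac{(-2\pi i)^{j}\Gamma(k/2-j)}{\Gamma(k/2)}L(f\otimes e(\gamma\infty),k/2-j), \end{align*} where $c$ is the lower-left entry of $\gamma$.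
   Context: $s(\Gamma)\subset\mathbb{R}\cup\{\infty\}$ denotes the set of cusps of $\Gamma$ (fixed points of parabolic elements of $\Gamma$), on which $\Gamma$ acts by M\"obius transformations. For $\gamma=\begin{pmatrix}a&b\\c&d\end{pmatrix}$, $j(\gamma,z)=cz+d$ (in the formula, $j$ without arguments is the summation index). Write $e(x)=e^{2\pi i x}$ and let $f(z)=\sum_{n\ge1}a_f(n)e^{2\pi i nz}$ be the Fourier expansion of $f$ at $\infty$. Additive twists: for $r\in\mathbb{R}$, $L(f\otimes e(r),s):=\sum_{n\ge1}a_f(n)e(nr)n^{-s}$ for $\operatorname{Re}s>(k+1)/2$. If $r\in s(\Gamma)\setminus\{\infty\}$, this admits analytic continuation to all $s\in\mathbb{C}$, given by $L(f\otimes e(r),s)=\frac{(2\pi)^s}{\Gamma(s)}\int_0^\infty f(r+iy)y^{s-1}\,dy$; the values in the claim are those of this continuation. Quantum modular form: let $S$ be a finite set and $h:s(\Gamma)\setminus S\to\mathbb{C}$ a map. Then $h$ is a quantum modular form of weight $\kappa$ for $\Gamma$ if for all $\gamma\in\Gamma$ the function $g_\gamma:s(\Gamma)\setminus(S\cup\gamma^{-1}S)\to\mathbb{C}$, $g_\gamma(r):=h(\gamma r)-j(\gamma,r)^{\kappa}h(r)$, extends to a continuous function $\mathbb{P}^1(\mathbb{R})\setminus(S\cup\gamma^{-1}S)\to\mathbb{C}$. In the claim, $S=\{\infty\}$ and $\kappa=0$. *)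

theory Defs
  imports "HOL-Complex_Analysis.Complex_Analysis" "HOL-Algebra.Group"
begin

section \<open>Groups of real matrices acting on the upper half-plane and its boundary\<close>

definition SL2R :: "(real^2^2) monoid" where
  "SL2R = \<lparr>carrier = {M. det M = 1}, mult = (**), one = mat 1\<rparr>"

abbreviation entry :: "real^2^2 \<Rightarrow> 2 \<Rightarrow> 2 \<Rightarrow> real" where
  "entry \<gamma> i j \<equiv> vec_nth (vec_nth \<gamma> i) j"

definition upper_half_plane :: "complex set" where
  "upper_half_plane = {z. Im z > 0}"

text \<open>The automorphy factor \<open>j(\<gamma>, z) = cz + d\<close>.\<close>

definition aut_j :: "real^2^2 \<Rightarrow> complex \<Rightarrow> complex" where
  "aut_j \<gamma> z = of_real (entry \<gamma> 2 1) * z + of_real (entry \<gamma> 2 2)"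

definition moebius :: "real^2^2 \<Rightarrow> complex \<Rightarrow> complex" where
  "moebius \<gamma> z = (of_real (entry \<gamma> 1 1) * z + of_real (entry \<gamma> 1 2)) / aut_j \<gamma> z"

text \<open>
  \<open>\<P>\<^sup>1(\<real>)\<close> is \<^typ>\<open>real option\<close>, with \<^const>\<open>None\<close> for the point at infinity. Its topology is
  that of the one-point compactification of the real line.
\<close>

definition P1_real :: "real option topology" where
  "P1_real = Alexandroff_compactification euclideanreal"

definition moebius_P1 :: "real^2^2 \<Rightarrow> real option \<Rightarrow> real option" where
  "moebius_P1 \<gamma> x =
     (case x of
        None \<Rightarrow> if entry \<gamma> 2 1 = 0 then None else Some (entry \<gamma> 1 1 / entry \<gamma> 2 1)
      | Some r \<Rightarrow> if entry \<gamma> 2 1 * r + entry \<gamma> 2 2 = 0 then None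
                  else Some ((entry \<gamma> 1 1 * r + entry \<gamma> 1 2) / (entry \<gamma> 2 1 * r + entry \<gamma> 2 2)))"

definition parabolic :: "real^2^2 \<Rightarrow> bool" where
  "parabolic \<gamma> \<longleftrightarrow> det \<gamma> = 1 \<and> \<bar>trace \<gamma>\<bar> = 2 \<and> \<gamma> \<noteq> mat 1 \<and> \<gamma> \<noteq> - mat 1"

definition cusps :: "(real^2^2) set \<Rightarrow> real option set" where
  "cusps \<Gamma> = {x. \<exists>\<gamma>\<in>\<Gamma>. parabolic \<gamma> \<and> moebius_P1 \<gamma> x = x}"

definition hyperbolic_measure :: "complex measure" where
  "hyperbolic_measure =
     density lborel (\<lambda>z. indicator upper_half_plane z * ennreal (1 / (Im z)\<^sup>2))"

text \<open>
  Finite covolume: some Borel set of representatives for the orbits of \<open>\<Gamma>\<close> on the upper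
  half-plane has finite hyperbolic area. (For discrete \<open>\<Gamma>\<close> such Borel sets exist and all have
  the same area.)
\<close>

definition finite_covolume :: "(real^2^2) set \<Rightarrow> bool" where
  "finite_covolume \<Gamma> \<longleftrightarrow>
     (\<exists>F. F \<in> sets borel \<and> F \<subseteq> upper_half_plane \<and>
        (\<forall>z\<in>upper_half_plane. \<exists>!w. w \<in> F \<and> (\<exists>\<gamma>\<in>\<Gamma>. w = moebius \<gamma> z)) \<and>
        emeasure hyperbolic_measure F < \<infinity>)"

text \<open>
  The cusp at infinity has width \<open>w\<close>: modulo \<open>\<plusminus>1\<close>, the stabiliser of infinity in \<open>\<Gamma>\<close> is
  generated by \<open>z \<mapsto> z + w\<close>. No assumption is made on whether \<open>-1 \<in> \<Gamma>\<close>.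
\<close>

definition cusp_at_infinity_of_width :: "(real^2^2) set \<Rightarrow> real \<Rightarrow> bool" where
  "cusp_at_infinity_of_width \<Gamma> w \<longleftrightarrow> w > 0 \<and>
     (\<forall>\<gamma>. (\<gamma> \<in> \<Gamma> \<or> - \<gamma> \<in> \<Gamma>) \<and> moebius_P1 \<gamma> None = None \<longleftrightarrow>
        (\<exists>n::int. let T = vector [vector [1, of_int n * w], vector [0, 1]]
                  in \<gamma> = T \<or> \<gamma> = - T))"


section \<open>Cusp forms and their additive twists\<close>

text \<open>
  Vanishing at the cusp \<open>\<sigma>\<infinity>\<close>: the function \<open>f|\<^sub>k\<sigma>\<close> tends to 0 as \<open>Im z \<rightarrow> \<infinity>\<close>, uniformly
  in \<open>Re z\<close>.
\<close>

definition cusp_form :: "(real^2^2) set \<Rightarrow> nat \<Rightarrow> (complex \<Rightarrow> complex) \<Rightarrow> bool" where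
  "cusp_form \<Gamma> k f \<longleftrightarrow>
     f holomorphic_on upper_half_plane \<and>
     (\<forall>\<gamma>\<in>\<Gamma>. \<forall>z\<in>upper_half_plane. f (moebius \<gamma> z) = aut_j \<gamma> z ^ k * f z) \<and>
     (\<forall>\<sigma>. det \<sigma> = 1 \<and> moebius_P1 \<sigma> None \<in> cusps \<Gamma> \<longrightarrow>
        ((\<lambda>z. f (moebius \<sigma> z) / aut_j \<sigma> z ^ k) \<longlongrightarrow> 0) (filtercomap Im at_top))"

definition e2pi :: "complex \<Rightarrow> complex" where
  "e2pi z = exp (2 * of_real pi * \<i> * z)"

text \<open>
  The coefficients of the expansion \<open>f(z) = \<Sum>\<^sub>n\<^sub>\<ge>\<^sub>1 a\<^sub>f(n) e(nz)\<close>, with \<open>a\<^sub>f(0) = 0\<close>.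
\<close>

definition fourier_coeff :: "(complex \<Rightarrow> complex) \<Rightarrow> nat \<Rightarrow> complex" where
  "fourier_coeff f =
     (THE a. a 0 = 0 \<and> (\<forall>z\<in>upper_half_plane. (\<lambda>n. a n * e2pi (of_nat n * z)) sums f z))"

text \<open>
  \<open>L(f \<otimes> e(r), s)\<close>: the entire function extending the Dirichlet series
  \<open>\<Sum>\<^sub>n\<^sub>\<ge>\<^sub>1 a\<^sub>f(n) e(nr) n\<^sup>-\<^sup>s\<close> from the half-plane \<open>Re s > (k + 1)/2\<close>. The term with \<open>n = 0\<close>
  is zero. Without such an extension (the general case when \<open>r\<close> is not a cusp) the value is
  unspecified.
\<close>

definition additive_twist_L ::
    "(complex \<Rightarrow> complex) \<Rightarrow> nat \<Rightarrow> real \<Rightarrow> complex \<Rightarrow> complex" where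
  "additive_twist_L f k r =
     (THE L. L holomorphic_on UNIV \<and>
        (\<forall>s. Re s > (real k + 1) / 2 \<longrightarrow>
           (\<lambda>n. fourier_coeff f n * e2pi (of_nat n * of_real r) * of_nat n powr (- s)) sums L s))"


section \<open>Quantum modular forms\<close>

text \<open>
  The form is a map on \<open>cusps \<Gamma> - S\<close>; the values of \<open>h\<close> elsewhere are irrelevant. The factor
  \<open>j(\<gamma>, r)\<close> has no meaning at \<open>r = \<infinity>\<close>, so the value of the extension is prescribed at finite
  cusps only; when \<open>\<infinity> \<in> S\<close> these are all the cusps in question.
\<close>

definition quantum_modular_form ::
    "(real^2^2) set \<Rightarrow> int \<Rightarrow> real option set \<Rightarrow> (real option \<Rightarrow> complex) \<Rightarrow> bool" where
  "quantum_modular_form \<Gamma> \<kappa> S h \<longleftrightarrow> finite S \<and>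
     (\<forall>\<gamma>\<in>\<Gamma>. \<exists>g. continuous_map (subtopology P1_real (- (S \<union> moebius_P1 \<gamma> -` S))) euclidean g \<and>
        (\<forall>r. Some r \<in> cusps \<Gamma> - (S \<union> moebius_P1 \<gamma> -` S) \<longrightarrow>
           g (Some r) = h (moebius_P1 \<gamma> (Some r))
                        - aut_j \<gamma> (of_real r) powi \<kappa> * h (Some r)))"

end

(*
  The function |f(z)|^2 Im(z)^k is invariant under Gamma and bounded. For the boundedness one
  needs Siegel's theorem that a fundamental domain is compact up to cusps: points moved
  noticeably by every non-central element of Gamma fill a compact set modulo Gamma, because each
  of them carries a fixed amount of area; every other point lies in a tube around an axis, an
  elliptic point or a cusp of one of finitely many elements of Gamma, and on such a tube the
  invariant function is bounded, near a cusp because f vanishes there.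

  Boundedness gives the mean square bound for the Fourier coefficients, hence the half-plane of
  absolute convergence of the twisted Dirichlet series. At a cusp r the function f(r + iy) decays
  exponentially for y -> 0 and for y -> infinity, so its Mellin transform is entire and continues
  the Dirichlet series.

  The formula is Cauchy's theorem for f(z) (z - gamma r)^(k/2 - 1) dz on the ideal triangle with
  vertices gamma r, gamma infinity and infinity, with the two remaining sides expanded by the
  binomial theorem. All the values on the right-hand side that depend on r lie in the half-plane
  of absolute convergence, where the Dirichlet series is continuous in r.
*)
theory Submission
  imports Defs "HOL-Real_Asymp.Real_Asymp"
begin


section \<open>Real two-by-two matrices and the action on the upper half-plane\<close>

text \<open>Finite covolume is given only as a Borel set of representatives of finite area: there is
  no fundamental polygon and no finite list of cusp classes to start from, and the detour through
  small elements replaces both. Smallness is measured by \<open>eta2\<close>, the squared distance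
  from 1 or -1 after conjugation, and not by displacement, because commutators contract only near 1
  and -1. The threshold 1/100 is the square of the radius 1/10 at which the commutator estimate
  gains a factor 1/2. Signs are carried along throughout, since -1 may or may not lie in the group;
  the even weight makes them invisible to \<open>f\<close>.

  The bound on \<open>f\<close> is used a second time in the contour argument. The image under
  \<open>\<gamma>\<close> of the vertical line above \<open>r\<close> is a circular arc ending at
  \<open>\<gamma>r\<close>, and comparing it near that vertex with the vertical line above
  \<open>\<gamma>r\<close> needs the growth bound for \<open>f\<close>, since exponential decay is
  known only along the vertical line itself.\<close>

lemma mat2_eq_iff: "(A::real^2^2) = B \<longleftrightarrow> entry A 1 1 = entry B 1 1 \<and> entry A 1 2 = entry B 1 2 \<and>
    entry A 2 1 = entry B 2 1 \<and> entry A 2 2 = entry B 2 2"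
  by (auto simp: vec_eq_iff forall_2)

lemma entry_mult:
  fixes A B :: "real^2^2"
  shows "entry (A ** B) i j = entry A i 1 * entry B 1 j + entry A i 2 * entry B 2 j"
  by (simp add: matrix_matrix_mult_def sum_2)

lemma entry_mat [simp]: "entry (mat s) i j = (if i = j then s else 0)"
  by (simp add: mat_def)

definition sl2 :: "real \<Rightarrow> real \<Rightarrow> real \<Rightarrow> real \<Rightarrow> real^2^2" where
  "sl2 a b c d = vector [vector [a, b], vector [c, d]]"

lemma entry_sl2 [simp]:
  "entry (sl2 a b c d) 1 1 = a" "entry (sl2 a b c d) 1 2 = b"
  "entry (sl2 a b c d) 2 1 = c" "entry (sl2 a b c d) 2 2 = d"
  by (simp_all add: sl2_def)

lemma norm_mat2_sq:
  "(norm (A::real^2^2))\<^sup>2 = (entry A 1 1)\<^sup>2 + (entry A 1 2)\<^sup>2 + (entry A 2 1)\<^sup>2 + (entry A 2 2)\<^sup>2"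
  by (simp add: norm_vec_def L2_set_def sum_2)

lemma trace_mat2: "trace (A::real^2^2) = entry A 1 1 + entry A 2 2"
  by (simp add: trace_def sum_2)

lemma norm_mult_mat2_le:
  fixes A B :: "real^2^2"
  shows "norm (A ** B) \<le> norm A * norm B"
proof -
  have cs: "(p * q + r * s)\<^sup>2 \<le> (p\<^sup>2 + r\<^sup>2) * (q\<^sup>2 + s\<^sup>2)" for p q r s :: real
  proof -
    have "(p\<^sup>2 + r\<^sup>2) * (q\<^sup>2 + s\<^sup>2) - (p * q + r * s)\<^sup>2 = (p * s - r * q)\<^sup>2"
      by (simp add: power2_eq_square algebra_simps)
    then show ?thesis by (smt (verit) zero_le_power2)
  qed
  have "(norm (A ** B))\<^sup>2 \<le> (norm A)\<^sup>2 * (norm B)\<^sup>2"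
    unfolding norm_mat2_sq entry_mult
    using cs[of "entry A 1 1" "entry B 1 1" "entry A 1 2" "entry B 2 1"]
      cs[of "entry A 1 1" "entry B 1 2" "entry A 1 2" "entry B 2 2"]
      cs[of "entry A 2 1" "entry B 1 1" "entry A 2 2" "entry B 2 1"]
      cs[of "entry A 2 1" "entry B 1 2" "entry A 2 2" "entry B 2 2"]
    by (simp add: algebra_simps)
  then show ?thesis
    by (metis norm_ge_zero power2_le_imp_le power_mult_distrib mult_nonneg_nonneg)
qed

text \<open>The adjugate, used as the inverse in \<open>SL2R\<close>: it is linear in the entries
  and preserves the norm, which keeps the estimates free of division.\<close>

definition adj2 :: "real^2^2 \<Rightarrow> real^2^2" where
  "adj2 A = sl2 (entry A 2 2) (- entry A 1 2) (- entry A 2 1) (entry A 1 1)"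

lemma entry_adj2 [simp]:
  "entry (adj2 A) 1 1 = entry A 2 2" "entry (adj2 A) 1 2 = - entry A 1 2"
  "entry (adj2 A) 2 1 = - entry A 2 1" "entry (adj2 A) 2 2 = entry A 1 1"
  by (simp_all add: adj2_def)

lemma norm_adj2 [simp]: "norm (adj2 A) = norm A"
proof -
  have "(norm (adj2 A))\<^sup>2 = (norm A)\<^sup>2"
    unfolding norm_mat2_sq by simp
  then show ?thesis by simp
qed

lemma adj2_mult:
  assumes "det A = 1"
  shows "A ** adj2 A = mat 1" "adj2 A ** A = mat 1"
  using assms by (auto simp: mat2_eq_iff entry_mult det_2 algebra_simps)

lemma det_adj2 [simp]: "det (adj2 A) = det A"
  by (simp add: det_2)

lemma mat_minus1: "- mat 1 = (mat (-1) :: real^2^2)"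
  by (simp add: mat2_eq_iff)

section \<open>The automorphy factor and Moebius maps\<close>

lemma cmod_aut_j_sq:
  "(cmod (aut_j g z))\<^sup>2 = (entry g 2 1 * Re z + entry g 2 2)\<^sup>2 + (entry g 2 1 * Im z)\<^sup>2"
  by (simp add: cmod_power2 aut_j_def)

lemma aut_j_nonzero:
  assumes "det g = 1" "Im z > 0"
  shows "aut_j g z \<noteq> 0"
proof
  assume "aut_j g z = 0"
  then have "entry g 2 1 * Re z + entry g 2 2 = 0" "entry g 2 1 * Im z = 0"
    by (auto simp: aut_j_def complex_eq_iff)
  with assms show False by (auto simp: det_2)
qed

lemma Im_moebius:
  assumes "det g = 1"
  shows "Im (moebius g z) = Im z / (cmod (aut_j g z))\<^sup>2"
proof -
  have "entry g 1 1 * entry g 2 2 - entry g 1 2 * entry g 2 1 = 1"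
    using assms by (simp add: det_2)
  then have "entry g 1 1 * Im z * (entry g 2 1 * Re z + entry g 2 2)
      - (entry g 1 1 * Re z + entry g 1 2) * (entry g 2 1 * Im z) = Im z"
    by algebra
  then show ?thesis
    by (simp add: moebius_def Im_divide cmod_aut_j_sq) (simp add: aut_j_def)
qed

lemma Im_moebius_pos:
  assumes "det g = 1" "Im z > 0"
  shows "Im (moebius g z) > 0"
  using assms aut_j_nonzero[OF assms] by (simp add: Im_moebius)

lemma aut_j_mult:
  assumes "aut_j B z \<noteq> 0"
  shows "aut_j (A ** B) z = aut_j A (moebius B z) * aut_j B z"
  using assms by (simp add: aut_j_def moebius_def entry_mult field_simps)

lemma moebius_mult:
  assumes "aut_j B z \<noteq> 0"
  shows "moebius (A ** B) z = moebius A (moebius B z)"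
proof -
  have "of_real (entry (A ** B) 1 1) * z + of_real (entry (A ** B) 1 2) =
     (of_real (entry A 1 1) * moebius B z + of_real (entry A 1 2)) * aut_j B z"
    using assms by (simp add: moebius_def entry_mult field_simps) (simp add: aut_j_def algebra_simps)
  then show ?thesis
    using assms by (simp add: moebius_def[of "A ** B"] moebius_def[of A] aut_j_mult)
qed

lemma moebius_mat_1 [simp]: "moebius (mat 1) z = z"
  by (simp add: moebius_def aut_j_def)

lemma moebius_adj2:
  assumes "det g = 1" "Im z > 0"
  shows "moebius (adj2 g) (moebius g z) = z" "moebius g (moebius (adj2 g) z) = z"
  using assms by (simp_all flip: moebius_mult add: aut_j_nonzero adj2_mult)

lemma moebius_diff:
  assumes "det g = 1" "aut_j g z \<noteq> 0" "aut_j g w \<noteq> 0"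
  shows "moebius g z - moebius g w = (z - w) / (aut_j g z * aut_j g w)"
proof -
  have "of_real (entry g 1 1) * of_real (entry g 2 2) - of_real (entry g 1 2) * of_real (entry g 2 1) = (1::complex)"
    using assms(1) by (simp add: det_2 flip: of_real_mult of_real_diff)
  then have "(of_real (entry g 1 1) * z + of_real (entry g 1 2)) * aut_j g w
      - (of_real (entry g 1 1) * w + of_real (entry g 1 2)) * aut_j g z = z - w"
    unfolding aut_j_def by algebra
  then show ?thesis
    using assms(2,3) by (simp add: moebius_def diff_frac_eq mult.commute)
qed

section \<open>Hyperbolic distance, displacement and conjugation to the base point\<close>

text \<open>For points at hyperbolic distance \<open>\<rho>\<close> this is
  \<open>4 sinh(\<rho>/2)^2\<close>, an algebraic substitute for the distance.\<close>

definition ptinv :: "complex \<Rightarrow> complex \<Rightarrow> real" where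
  "ptinv z w = (cmod (z - w))\<^sup>2 / (Im z * Im w)"

lemma ptinv_commute: "ptinv z w = ptinv w z"
  by (simp add: ptinv_def norm_minus_commute mult.commute)

lemma ptinv_moebius:
  assumes "det g = 1" "Im z > 0" "Im w > 0"
  shows "ptinv (moebius g z) (moebius g w) = ptinv z w"
  using assms aut_j_nonzero[OF assms(1)]
  by (simp add: ptinv_def moebius_diff Im_moebius norm_divide norm_mult power_divide power_mult_distrib field_simps)

text \<open>\<open>conj_at z g\<close> is \<open>\<sigma>\<^sup>-\<^sup>1 g \<sigma>\<close> for the upper triangular \<open>\<sigma>\<close> with \<open>\<sigma> \<i> = z\<close>.\<close>

definition conj_at :: "complex \<Rightarrow> real^2^2 \<Rightarrow> real^2^2" where
  "conj_at z g = (let a = entry g 1 1; b = entry g 1 2; c = entry g 2 1; d = entry g 2 2;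
      x = Re z; y = Im z in sl2 (a - c * x) ((a * x + b - x * (c * x + d)) / y) (c * y) (c * x + d))"

lemma conj_at_mult:
  assumes "Im z > 0"
  shows "conj_at z (g ** h) = conj_at z g ** conj_at z h"
  using assms by (simp add: conj_at_def mat2_eq_iff entry_mult Let_def field_simps)

lemma conj_at_mat [simp]: "conj_at z (mat s) = mat s"
  by (simp add: conj_at_def mat2_eq_iff Let_def)

lemma conj_at_adj2: 
  assumes "Im z > 0" shows "conj_at z (adj2 g) = adj2 (conj_at z g)"
  using assms by (simp add: conj_at_def mat2_eq_iff Let_def field_simps)

lemma det_conj_at: 
  assumes "Im z > 0" shows "det (conj_at z g) = det g"
  using assms by (simp add: conj_at_def det_2 Let_def field_simps)

lemma trace_conj_at: "trace (conj_at z g) = trace g"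
  by (simp add: conj_at_def trace_mat2 Let_def)

text \<open>\<open>displ g z\<close> is \<open>2 sinh (\<rho> / 2)\<close> for the hyperbolic distance \<open>\<rho>\<close> between \<open>z\<close> and \<open>g z\<close>.\<close>

definition displ :: "real^2^2 \<Rightarrow> complex \<Rightarrow> real" where
  "displ g z = cmod (of_real (entry g 2 1) * z\<^sup>2 + of_real (entry g 2 2 - entry g 1 1) * z
     - of_real (entry g 1 2)) / Im z"

lemma displ_nonneg: "Im z > 0 \<Longrightarrow> displ g z \<ge> 0"
  by (simp add: displ_def)

lemma displ_sq:
  assumes "det g = 1" "Im z > 0"
  shows "(displ g z)\<^sup>2 = ptinv z (moebius g z)"
proof -
  have j: "aut_j g z \<noteq> 0" using assms aut_j_nonzero by blast
  have "z - moebius g z = (of_real (entry g 2 1) * z\<^sup>2 + of_real (entry g 2 2 - entry g 1 1) * z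
     - of_real (entry g 1 2)) / aut_j g z"
    using j by (simp add: moebius_def field_simps power2_eq_square) (simp add: aut_j_def algebra_simps)
  then show ?thesis
    unfolding ptinv_def displ_def Im_moebius[OF assms(1)]
    using assms j by (simp add: norm_divide power_divide power2_eq_square del: of_real_diff)
qed

text \<open>For a matrix \<open>M\<close> of determinant 1 the squares of the entries add up to
  \<open>2 cosh \<rho>\<close>, where \<open>\<rho>\<close> is the distance from \<open>i\<close> to
  \<open>M i\<close>, while \<open>displ\<close> squared is \<open>2 cosh \<rho> - 2\<close>. The
  proof is the underlying polynomial identity after clearing \<open>Im z\<close>.\<close>

lemma norm_conj_at_sq:
  assumes "det g = 1" "Im z > 0"
  shows "(norm (conj_at z g))\<^sup>2 = (displ g z)\<^sup>2 + 2"
proof -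
  define a b c d x y where "a = entry g 1 1" and "b = entry g 1 2" and "c = entry g 2 1"
    and "d = entry g 2 2" and "x = Re z" and "y = Im z"
  note defs = a_def b_def c_def d_def x_def y_def
  have y: "y > 0" and det: "a * d - b * c = 1"
    using assms by (auto simp: defs det_2)
  have z: "z = Complex x y" by (simp add: defs)
  have "(displ g z)\<^sup>2 * y\<^sup>2 = (c * (x\<^sup>2 - y\<^sup>2) + (d - a) * x - b)\<^sup>2 + (2 * c * x * y + (d - a) * y)\<^sup>2"
    using y unfolding displ_def power_divide cmod_power2 
    by (simp flip: defs) (simp add: z power2_eq_square algebra_simps)
  moreover have "(norm (conj_at z g))\<^sup>2 * y\<^sup>2 =
      (a - c * x)\<^sup>2 * y\<^sup>2 + (a * x + b - x * (c * x + d))\<^sup>2 + (c * y)\<^sup>2 * y\<^sup>2 + (c * x + d)\<^sup>2 * y\<^sup>2"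
    using y unfolding norm_mat2_sq conj_at_def Let_def
    by (simp flip: defs add: power_divide) (simp add: field_simps)
  moreover have "(a - c * x)\<^sup>2 * y\<^sup>2 + (a * x + b - x * (c * x + d))\<^sup>2 + (c * y)\<^sup>2 * y\<^sup>2 + (c * x + d)\<^sup>2 * y\<^sup>2
     - ((c * (x\<^sup>2 - y\<^sup>2) + (d - a) * x - b)\<^sup>2 + (2 * c * x * y + (d - a) * y)\<^sup>2) = 2 * y\<^sup>2 * (a * d - b * c)"
    by (simp add: power2_eq_square algebra_simps)
  ultimately have "(norm (conj_at z g))\<^sup>2 * y\<^sup>2 = ((displ g z)\<^sup>2 + 2) * y\<^sup>2"
    using det by (simp add: algebra_simps)
  then show ?thesis using y by simp
qed

lemma norm_diff_mat_sq:
  fixes A :: "real^2^2"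
  shows "(norm (A - mat s))\<^sup>2 = (norm A)\<^sup>2 - 2 * s * trace A + 2 * s\<^sup>2"
  unfolding norm_mat2_sq[of A] norm_mat2_sq[of "A - mat s"] trace_mat2 by (simp add: power2_eq_square algebra_simps)

text \<open>\<open>eta2 g z\<close> is the squared distance from \<open>conj_at z g\<close> to \<open>\<plusminus>1\<close>. Unlike \<^const>\<open>displ\<close> it
  is not small at a fixed point of an elliptic element of large angle.\<close>

definition eta2 :: "real^2^2 \<Rightarrow> complex \<Rightarrow> real" where
  "eta2 g z = (displ g z)\<^sup>2 + 4 - 2 * \<bar>trace g\<bar>"

lemma eta2_le:
  assumes "det g = 1" "Im z > 0" "s = 1 \<or> s = -1"
  shows "eta2 g z \<le> (norm (conj_at z g - mat s))\<^sup>2"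
  using assms by (auto simp: norm_diff_mat_sq norm_conj_at_sq trace_conj_at eta2_def)

text \<open>Expanding the square gives \<open>displ^2 + 4 - 2 * s * trace g\<close>, so the sign of
  the trace selects the nearer of 1 and -1.\<close>

lemma eta2_eq:
  assumes "det g = 1" "Im z > 0"
  obtains s where "s = 1 \<or> s = -1" "eta2 g z = (norm (conj_at z g - mat s))\<^sup>2"
proof (cases "trace g \<ge> 0")
  case True
  then show ?thesis using that[of 1] assms
    by (auto simp: norm_diff_mat_sq norm_conj_at_sq trace_conj_at eta2_def)
next
  case False
  then show ?thesis using that[of "-1"] assms
    by (auto simp: norm_diff_mat_sq norm_conj_at_sq trace_conj_at eta2_def)
qed

lemma eta2_moebius:
  assumes "det g = 1" "det h = 1" "Im z > 0"
  shows "eta2 (h ** g ** adj2 h) (moebius h z) = eta2 g z"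
proof -
  have tr: "trace (h ** g ** adj2 h) = trace g"
  proof -
    have "trace (h ** g ** adj2 h) = det h * trace g"
      by (simp add: trace_mat2 entry_mult det_2 algebra_simps)
    then show ?thesis using assms by simp
  qed
  have d: "det (h ** g ** adj2 h) = 1" using assms by (simp add: det_mul)
  have "moebius (h ** g ** adj2 h) (moebius h z) = moebius h (moebius g z)"
    using assms by (simp add: moebius_mult moebius_adj2 aut_j_nonzero Im_moebius_pos)
  then show ?thesis
    using assms d by (simp add: eta2_def tr displ_sq Im_moebius_pos ptinv_moebius)
qed

section \<open>Commuting elements and their fixed-point polynomials\<close>

definition central :: "real^2^2 \<Rightarrow> bool" where
  "central g \<longleftrightarrow> g = mat 1 \<or> g = mat (-1)"

text \<open>The three conditions say that the fixed-point polynomial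
  \<open>c z^2 + (d - a) z - b\<close> vanishes identically.\<close>

lemma central_iff:
  assumes "det g = 1"
  shows "central g \<longleftrightarrow> entry g 2 1 = 0 \<and> entry g 1 2 = 0 \<and> entry g 1 1 = entry g 2 2"
proof -
  have "entry g 2 2 = 1 \<or> entry g 2 2 = -1" if "entry g 2 2 * entry g 2 2 = 1"
    using that by (metis power2_eq_1_iff power2_eq_square)
  then show ?thesis
    using assms by (auto simp: central_def mat2_eq_iff det_2)
qed

text \<open>The fixed points of \<open>g\<close> are the zeros of \<open>cz\<^sup>2 + (d - a)z - b\<close>; these polynomials are
  proportional exactly for commuting elements.\<close>

definition fix_prop :: "real \<Rightarrow> real^2^2 \<Rightarrow> real^2^2 \<Rightarrow> bool" where
  "fix_prop l g h \<longleftrightarrow> entry g 2 1 = l * entry h 2 1 \<and> entry g 1 2 = l * entry h 1 2 \<and>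
     entry g 2 2 - entry g 1 1 = l * (entry h 2 2 - entry h 1 1)"

lemma proportional_triples:
  fixes a b c a' b' c' :: real
  assumes eq: "a * b' = a' * b" "a * c' = a' * c" "b * c' = b' * c"
    and nz: "a \<noteq> 0 \<or> b \<noteq> 0 \<or> c \<noteq> 0" "a' \<noteq> 0 \<or> b' \<noteq> 0 \<or> c' \<noteq> 0"
  shows "\<exists>l. l \<noteq> 0 \<and> a = l * a' \<and> b = l * b' \<and> c = l * c'"
proof -
  have *: "\<exists>l. a = l * a' \<and> b = l * b' \<and> c = l * c'"
    using nz(2)
  proof (elim disjE)
    assume "a' \<noteq> 0"
    then show ?thesis using eq by (intro exI[of _ "a / a'"]) (simp add: nonzero_eq_divide_eq nonzero_divide_eq_eq)
  next
    assume "b' \<noteq> 0"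
    then show ?thesis using eq by (intro exI[of _ "b / b'"]) (simp add: nonzero_eq_divide_eq nonzero_divide_eq_eq mult.commute)
  next
    assume "c' \<noteq> 0"
    then show ?thesis using eq by (intro exI[of _ "c / c'"]) (simp add: nonzero_eq_divide_eq nonzero_divide_eq_eq mult.commute)
  qed
  then obtain l where l: "a = l * a'" "b = l * b'" "c = l * c'" by blast
  with nz(1) have "l \<noteq> 0" by auto
  with l show ?thesis by blast
qed

text \<open>Up to sign, the entries of \<open>g ** h - h ** g\<close> are the 2 by 2 minors of the
  two coefficient triples; non-centrality makes both triples nonzero.\<close>

lemma commute_imp_fix_prop:
  assumes comm: "g ** h = h ** g" and "det g = 1" "det h = 1" "\<not> central g" "\<not> central h"
  obtains l where "l \<noteq> 0" "fix_prop l g h"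
proof -
  have e: "entry (g ** h) i j = entry (h ** g) i j" for i j
    using comm by simp
  have "\<exists>l. l \<noteq> 0 \<and> entry g 2 1 = l * entry h 2 1 \<and>
      entry g 2 2 - entry g 1 1 = l * (entry h 2 2 - entry h 1 1) \<and> entry g 1 2 = l * entry h 1 2"
  proof (rule proportional_triples)
    show "entry g 2 1 * (entry h 2 2 - entry h 1 1) = entry h 2 1 * (entry g 2 2 - entry g 1 1)"
      using e[of 2 1] unfolding entry_mult by argo
    show "entry g 2 1 * entry h 1 2 = entry h 2 1 * entry g 1 2"
      using e[of 1 1] unfolding entry_mult by argo
    show "(entry g 2 2 - entry g 1 1) * entry h 1 2 = (entry h 2 2 - entry h 1 1) * entry g 1 2"
      using e[of 1 2] unfolding entry_mult by argo
    show "entry g 2 1 \<noteq> 0 \<or> entry g 2 2 - entry g 1 1 \<noteq> 0 \<or> entry g 1 2 \<noteq> 0"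
      using assms by (auto simp: central_iff)
    show "entry h 2 1 \<noteq> 0 \<or> entry h 2 2 - entry h 1 1 \<noteq> 0 \<or> entry h 1 2 \<noteq> 0"
      using assms by (auto simp: central_iff)
  qed
  then show ?thesis using that by (auto simp: fix_prop_def)
qed

lemma fix_prop_trans: 
  assumes "fix_prop l g h" "fix_prop l' g' h" "l \<noteq> 0"
  shows "fix_prop (l' / l) g' g"
  using assms by (simp add: fix_prop_def)

text \<open>Displacement depends only on the modulus of the fixed-point polynomial. Hence the
  displacements of commuting elements are constant multiples of one function, and moving a point
  changes them all in step.\<close>

lemma displ_fix_prop:
  assumes "fix_prop l g h"
  shows "displ g z = \<bar>l\<bar> * displ h z"
proof -
  have "of_real (entry g 2 1) * z\<^sup>2 + of_real (entry g 2 2 - entry g 1 1) * z - of_real (entry g 1 2)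
     = of_real l * (of_real (entry h 2 1) * z\<^sup>2 + of_real (entry h 2 2 - entry h 1 1) * z - of_real (entry h 1 2))"
    using assms unfolding fix_prop_def by (simp only: of_real_mult) (simp add: algebra_simps)
  then show ?thesis unfolding displ_def by (simp add: norm_mult del: of_real_diff)
qed

text \<open>The Zassenhaus estimate. Subtracting the scalars \<open>mat s\<close> and
  \<open>mat t\<close> does not change \<open>M ** N - N ** M\<close>, which is therefore of second
  order, and the commutator minus 1 is this difference times \<open>adj2 M ** adj2 N\<close>.
  Numerically \<open>2 * (1/10) * 1.52^2 < 1/2\<close>, with 1.42 slightly above the norm
  \<open>sqrt 2\<close> of \<open>mat s\<close>.\<close>

lemma norm_commutator_le:
  assumes "det M = 1" "det N = 1" and st: "s = 1 \<or> s = -1" "t = 1 \<or> t = -1"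
    and M: "norm (M - mat s) \<le> 1/10" and N: "norm (N - mat t) \<le> 1/10"
  shows "norm (M ** N ** adj2 M ** adj2 N - mat 1) \<le> norm (N - mat t) / 2"
proof -
  have n1: "norm (mat s :: real^2^2) \<le> 142/100" if "s = 1 \<or> s = -1" for s
  proof -
    have "(norm (mat s :: real^2^2))\<^sup>2 = 2" unfolding norm_mat2_sq using that by auto
    also have "\<dots> \<le> (142/100)\<^sup>2" by (simp add: power2_eq_square)
    finally show ?thesis by (rule power2_le_imp_le) simp
  qed
  have nM: "norm M \<le> 152/100" using norm_triangle_sub[of M "mat s"] M n1[OF st(1)] by simp
  have nN: "norm N \<le> 152/100" using norm_triangle_sub[of N "mat t"] N n1[OF st(2)] by simp
  let ?X = "M - mat s" and ?Y = "N - mat t"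
  let ?Z = "?X ** ?Y - ?Y ** ?X"
  have Z: "?Z = M ** N - N ** M"
    by (simp add: mat2_eq_iff entry_mult algebra_simps)
  have "N ** M ** adj2 M ** adj2 N = N ** (M ** adj2 M) ** adj2 N"
    by (simp add: matrix_mul_assoc)
  then have one: "N ** M ** adj2 M ** adj2 N = mat 1"
    using assms by (simp add: adj2_mult)
  have "M ** N ** adj2 M ** adj2 N - mat 1 = ?Z ** (adj2 M ** adj2 N)"
    unfolding Z one[symmetric] by (simp add: mat2_eq_iff entry_mult algebra_simps)
  also have "norm \<dots> \<le> norm ?Z * norm (adj2 M ** adj2 N)"
    by (rule norm_mult_mat2_le)
  also have "\<dots> \<le> (2 * norm ?X * norm ?Y) * (norm M * norm N)"
  proof (intro mult_mono)
    show "norm ?Z \<le> 2 * norm ?X * norm ?Y"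
      using norm_triangle_ineq4[of "?X ** ?Y" "?Y ** ?X"] norm_mult_mat2_le[of ?X ?Y] norm_mult_mat2_le[of ?Y ?X]
      by (simp add: mult_ac)
    show "norm (adj2 M ** adj2 N) \<le> norm M * norm N"
      using norm_mult_mat2_le[of "adj2 M" "adj2 N"] by simp
  qed auto
  also have "\<dots> \<le> (2 * (1/10) * norm ?Y) * ((152/100) * (152/100))"
    using M nM nN by (intro mult_mono) auto
  also have "\<dots> \<le> norm ?Y / 2" by (simp add: field_simps)
  finally show ?thesis .
qed

section \<open>Discrete groups: elements of small displacement commute\<close>

text \<open>An upper triangular matrix taking \<open>i\<close> to \<open>z\<close>. Its determinant
  is \<open>Im z\<close> rather than 1, since the normalising scalar cancels under conjugation and
  the square root is avoided.\<close>

definition sl2_frame :: "complex \<Rightarrow> real^2^2" where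
  "sl2_frame z = sl2 (Im z) (Re z) 0 1"

definition sl2_frame_inv :: "complex \<Rightarrow> real^2^2" where
  "sl2_frame_inv z = sl2 (1 / Im z) (- Re z / Im z) 0 1"

lemma conj_at_frame:
  assumes "Im z > 0"
  shows "g = sl2_frame z ** conj_at z g ** sl2_frame_inv z"
  using assms
  by (simp add: mat2_eq_iff entry_mult sl2_frame_def sl2_frame_inv_def conj_at_def Let_def field_simps)

lemma norm_frame_sq: "(norm (sl2_frame z))\<^sup>2 = (Im z)\<^sup>2 + (Re z)\<^sup>2 + 1"
  by (simp add: norm_mat2_sq sl2_frame_def)

lemma norm_frame_inv_sq: "(norm (sl2_frame_inv z))\<^sup>2 = (1 / Im z)\<^sup>2 + (Re z / Im z)\<^sup>2 + 1"
  by (simp add: norm_mat2_sq sl2_frame_inv_def)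

lemma eta2_pos:
  assumes "det g = 1" "Im z > 0" "\<not> central g"
  shows "eta2 g z > 0"
proof (rule ccontr)
  assume *: "\<not> eta2 g z > 0"
  obtain s where s: "s = 1 \<or> s = -1" "eta2 g z = (norm (conj_at z g - mat s))\<^sup>2"
    using eta2_eq assms by blast
  with * have "norm (conj_at z g - mat s) = 0" by simp
  then have "conj_at z g = mat s" by simp
  then have "central g"
    using assms(2) unfolding central_iff[OF assms(1)]
    by (auto simp: conj_at_def mat2_eq_iff Let_def)
  with assms show False by simp
qed

lemma norm_conj_at_le:
  assumes "det g = 1" "Im z > 0" "eta2 g z \<le> B" "B \<ge> 0"
  shows "norm (conj_at z g) \<le> sqrt B + 2"
proof -
  obtain s where s: "s = 1 \<or> s = -1" "eta2 g z = (norm (conj_at z g - mat s))\<^sup>2"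
    using eta2_eq assms by blast
  have "norm (conj_at z g - mat s) \<le> sqrt B"
    using s assms real_le_rsqrt by metis
  moreover have "norm (mat s :: real^2^2) \<le> 2"
  proof -
    have "(norm (mat s :: real^2^2))\<^sup>2 \<le> 2\<^sup>2" unfolding norm_mat2_sq using s by auto
    then show ?thesis by (rule power2_le_imp_le) simp
  qed
  ultimately show ?thesis using norm_triangle_sub[of "conj_at z g" "mat s"] by simp
qed

text \<open>\<open>displ g\<close> tends to infinity at every real point not fixed by
  \<open>g\<close>, and the half-plane is connected, so every value above a given one is
  taken.\<close>

lemma displ_surj:
  assumes "det g = 1" "\<not> central g" "Im z > 0" "displ g z \<le> T"
  obtains w where "Im w > 0" "displ g w = T"
proof -
  define a b c where "a = entry g 2 1" and "b = entry g 2 2 - entry g 1 1" and "c = entry g 1 2"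
  have dd: "displ g w = cmod (of_real a * w\<^sup>2 + of_real b * w - of_real c) / Im w" for w
    by (simp add: displ_def a_def b_def c_def)
  have "a \<noteq> 0 \<or> b \<noteq> 0 \<or> c \<noteq> 0"
    using assms by (auto simp: central_iff a_def b_def c_def)
  \<comment> \<open>A nonzero polynomial of degree at most 2 cannot vanish at all of 0, 1 and
    -1.\<close>
  then have "c \<noteq> 0 \<or> a + b - c \<noteq> 0 \<or> a - b - c \<noteq> 0" by linarith
  then have "\<exists>x. a * x\<^sup>2 + b * x - c \<noteq> 0"
  proof (elim disjE)
    assume "c \<noteq> 0" then show ?thesis by (intro exI[of _ 0]) simp
  next
    assume "a + b - c \<noteq> 0" then show ?thesis by (intro exI[of _ 1]) simp
  next
    assume "a - b - c \<noteq> 0" then show ?thesis by (intro exI[of _ "-1"]) simp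
  qed
  then obtain x where x: "a * x\<^sup>2 + b * x - c \<noteq> 0" by blast
  define q where "q = \<bar>a * x\<^sup>2 + b * x - c\<bar>"
  have q: "q > 0" using x by (simp add: q_def)
  have T: "T \<ge> 0" using assms displ_nonneg[of z g] by linarith
  \<comment> \<open>Small enough that \<open>T * y\<close> and the error
    \<open>\<bar>a\<bar> * y^2\<close> together stay below \<open>q\<close>.\<close>
  define y where "y = min 1 (q / (T + \<bar>a\<bar> + 1))"
  have y: "y > 0" "y \<le> 1" using q T by (auto simp: y_def)
  have "y \<le> q / (T + \<bar>a\<bar> + 1)" by (simp add: y_def)
  then have yq: "y * (T + \<bar>a\<bar> + 1) \<le> q" using T by (simp add: pos_le_divide_eq)
  have "displ g (Complex x y) \<ge> T"
  proof -
    have "\<bar>(a * x\<^sup>2 + b * x - c) - a * y\<^sup>2\<bar> = \<bar>Re (of_real a * (Complex x y)\<^sup>2 + of_real b * Complex x y - of_real c)\<bar>"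
      by (simp add: power2_eq_square algebra_simps)
    also have "\<dots> \<le> cmod (of_real a * (Complex x y)\<^sup>2 + of_real b * Complex x y - of_real c)"
      by (rule abs_Re_le_cmod)
    finally have "q - \<bar>a\<bar> * y\<^sup>2 \<le> cmod (of_real a * (Complex x y)\<^sup>2 + of_real b * Complex x y - of_real c)"
      using abs_triangle_ineq2[of "a * x\<^sup>2 + b * x - c" "a * y\<^sup>2"] by (simp add: q_def abs_mult)
    moreover have "T * y \<le> q - \<bar>a\<bar> * y\<^sup>2"
    proof -
      have "\<bar>a\<bar> * y\<^sup>2 \<le> \<bar>a\<bar> * y"
        using y by (intro mult_left_mono) (auto simp: power2_eq_square mult_le_one)
      then show ?thesis using yq y by (simp add: algebra_simps)
    qed
    ultimately show ?thesis
      unfolding dd using y by (simp add: pos_le_divide_eq)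
  qed
  moreover have "connected (displ g ` {w. Im w > 0})"
  proof (rule connected_continuous_image)
    show "continuous_on {w. Im w > 0} (displ g)"
      unfolding displ_def by (intro continuous_intros) auto
    show "connected {w. Im w > 0}"
      by (intro convex_connected convex_halfspace_Im_gt)
  qed
  moreover have "displ g z \<in> displ g ` {w. Im w > 0}" "displ g (Complex x y) \<in> displ g ` {w. Im w > 0}"
    using assms y by auto
  ultimately have "T \<in> displ g ` {w. Im w > 0}"
    using assms(4) connected_contains_Icc by (metis (no_types, lifting) atLeastAtMost_iff subsetD)
  then show ?thesis using that by auto
qed

lemma group_SL2R: "group SL2R"
proof (rule groupI)
  show "\<And>x. x \<in> carrier SL2R \<Longrightarrow> \<exists>y\<in>carrier SL2R. y \<otimes>\<^bsub>SL2R\<^esub> x = \<one>\<^bsub>SL2R\<^esub>"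
    by (rule_tac x="adj2 x" in bexI) (auto simp: SL2R_def adj2_mult)
qed (auto simp: SL2R_def det_mul matrix_mul_assoc)

lemma inv_SL2R:
  assumes "det g = 1" shows "inv\<^bsub>SL2R\<^esub> g = adj2 g"
  using group.inv_equality[OF group_SL2R, of "adj2 g" g] assms by (simp add: SL2R_def adj2_mult)

locale fuchsian =
  fixes \<Gamma> :: "(real^2^2) set"
  assumes sub: "subgroup \<Gamma> SL2R" and disc: "discrete \<Gamma>"
begin

lemma det_1: "g \<in> \<Gamma> \<Longrightarrow> det g = 1"
  using subgroup.mem_carrier[OF sub] by (simp add: SL2R_def)

lemma one_mem: "mat 1 \<in> \<Gamma>"
  using subgroup.one_closed[OF sub] by (simp add: SL2R_def)

lemma mult_mem: "g \<in> \<Gamma> \<Longrightarrow> h \<in> \<Gamma> \<Longrightarrow> g ** h \<in> \<Gamma>"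
  using subgroup.m_closed[OF sub] by (simp add: SL2R_def)

lemma adj2_mem: "g \<in> \<Gamma> \<Longrightarrow> adj2 g \<in> \<Gamma>"
  using subgroup.m_inv_closed[OF sub] inv_SL2R det_1 by metis

lemma separated_from_1: "\<exists>e>0. \<forall>g\<in>\<Gamma>. norm (g - mat 1) < e \<longrightarrow> g = mat 1"
proof -
  have "mat 1 isolated_in \<Gamma>" using disc one_mem by (simp add: discrete_def)
  then obtain e where "e > 0" "\<And>g. g \<in> \<Gamma> \<Longrightarrow> dist (mat 1) g < e \<Longrightarrow> g = mat 1"
    using isolated_inE_dist by metis
  then show ?thesis by (intro exI[of _ e]) (auto simp: dist_norm norm_minus_commute)
qed

text \<open>Left multiplication transports the isolation of 1: if \<open>g\<close> and
  \<open>h\<close> are close and of bounded norm, then \<open>adj2 g ** h\<close> is close to 1. A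
  bounded part of the group is thus uniformly discrete, hence finite.\<close>

lemma finite_bounded: "finite {g \<in> \<Gamma>. norm g \<le> B}"
proof -
  obtain e where e: "e > 0" "\<forall>g\<in>\<Gamma>. norm (g - mat 1) < e \<longrightarrow> g = mat 1"
    using separated_from_1 by blast
  define S where "S = {g \<in> \<Gamma>. norm g \<le> B}"
  have "uniform_discrete S"
    unfolding uniform_discrete_def
  proof (intro exI conjI ballI impI)
    show "e / (\<bar>B\<bar> + 1) > 0" using e by simp
    fix g h assume gh: "g \<in> S" "h \<in> S" "dist g h < e / (\<bar>B\<bar> + 1)"
    then have mem: "adj2 g ** h \<in> \<Gamma>" by (auto simp: S_def intro: mult_mem adj2_mem)
    have d: "det g = 1" using gh det_1 by (auto simp: S_def)
    have "adj2 g ** h - mat 1 = adj2 g ** (h - g)"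
      using adj2_mult(2)[OF d] by (simp add: mat2_eq_iff entry_mult algebra_simps)
    also have "norm \<dots> \<le> norm g * norm (h - g)"
      using norm_mult_mat2_le[of "adj2 g" "h - g"] by simp
    also have "\<dots> \<le> (\<bar>B\<bar> + 1) * norm (h - g)"
      using gh by (intro mult_right_mono) (auto simp: S_def)
    also have "\<dots> < e" using gh(3) by (simp add: dist_norm norm_minus_commute field_simps)
    finally have "adj2 g ** h = mat 1" using e(2) mem by blast
    then have "g ** adj2 g ** h = g" by (simp flip: matrix_mul_assoc)
    then show "g = h" using adj2_mult(1)[OF d] by simp
  qed
  moreover have "bounded S" by (auto simp: S_def bounded_iff)
  ultimately have "finite S"
    using uniform_discrete_finite_iff by blast
  then show ?thesis by (simp add: S_def)
qed

text \<open>Proper discontinuity. \<open>g\<close> is recovered from \<open>conj_at z g\<close> by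
  the frames at \<open>z\<close>, whose norms are bounded on \<open>K\<close>, so a bound on
  \<open>eta2\<close> becomes a bound on \<open>norm g\<close>.\<close>

lemma finite_eta2_le:
  assumes "compact K" "K \<subseteq> upper_half_plane"
  shows "finite {g \<in> \<Gamma>. \<exists>z\<in>K. eta2 g z \<le> B}"
proof -
  have pos: "Im z > 0" if "z \<in> K" for z using that assms by (auto simp: upper_half_plane_def)
  define n where "n z = sqrt ((Im z)\<^sup>2 + (Re z)\<^sup>2 + 1) * sqrt ((1 / Im z)\<^sup>2 + (Re z / Im z)\<^sup>2 + 1)" for z
  have "compact (n ` K)"
    unfolding n_def using pos
    by (intro compact_continuous_image assms continuous_intros) fastforce+
  then obtain C where C: "\<And>z. z \<in> K \<Longrightarrow> n z \<le> C"
    using compact_imp_bounded bounded_iff by (metis image_eqI real_norm_def abs_le_D1)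
  have "{g \<in> \<Gamma>. \<exists>z\<in>K. eta2 g z \<le> B} \<subseteq> {g \<in> \<Gamma>. norm g \<le> C * (sqrt \<bar>B\<bar> + 2)}"
  proof safe
    fix g z assume g: "g \<in> \<Gamma>" "z \<in> K" "eta2 g z \<le> B"
    have "norm g \<le> norm (sl2_frame z) * norm (conj_at z g) * norm (sl2_frame_inv z)"
      using conj_at_frame[OF pos[OF g(2)], of g] norm_mult_mat2_le[of "sl2_frame z ** conj_at z g" "sl2_frame_inv z"]
        norm_mult_mat2_le[of "sl2_frame z" "conj_at z g"]
      by (metis (no_types, lifting) mult_right_mono norm_ge_zero order_trans)
    also have "\<dots> = n z * norm (conj_at z g)"
      by (simp add: n_def mult_ac flip: norm_frame_sq norm_frame_inv_sq)
    also have "\<dots> \<le> C * (sqrt \<bar>B\<bar> + 2)"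
    proof (rule mult_mono)
      show "n z \<le> C" using C g by blast
      then show "0 \<le> C" by (rule order_trans[rotated]) (auto simp: n_def)
      show "norm (conj_at z g) \<le> sqrt \<bar>B\<bar> + 2"
        by (rule norm_conj_at_le) (use g pos det_1 in auto)
    qed auto
    finally show "norm g \<le> C * (sqrt \<bar>B\<bar> + 2)" .
  qed
  then show ?thesis using finite_bounded finite_subset by blast
qed

text \<open>The Margulis lemma in dimension two. Among the finitely many small non-central elements
  take \<open>b\<close> nearest to 1 or -1. Its commutator with any small \<open>a\<close> is at
  least four times nearer in the sense of \<open>eta2\<close>, hence central by minimality, hence
  trivial. So every small element commutes with \<open>b\<close>, and all fixed-point polynomials
  are proportional to that of \<open>b\<close>.\<close>

lemma small_elements_fix_prop:
  assumes z: "Im z > 0"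
    and g: "g \<in> \<Gamma>" "\<not> central g" "eta2 g z \<le> 1/100"
    and h: "h \<in> \<Gamma>" "\<not> central h" "eta2 h z \<le> 1/100"
  obtains l where "l \<noteq> 0" "fix_prop l g h"
proof -
  define G where "G = {g \<in> \<Gamma>. \<not> central g \<and> eta2 g z \<le> 1/100}"
  have "finite {g \<in> \<Gamma>. \<exists>w\<in>{z}. eta2 g w \<le> 1/100}"
    by (rule finite_eta2_le) (use z in \<open>auto simp: upper_half_plane_def\<close>)
  then have "finite G" by (rule finite_subset[rotated]) (auto simp: G_def)
  moreover have "G \<noteq> {}" using g by (auto simp: G_def)
  ultimately obtain b where b: "b \<in> G" and b_min: "\<And>g. g \<in> G \<Longrightarrow> eta2 b z \<le> eta2 g z"
    using ex_is_arg_min_if_finite[of G "\<lambda>g. eta2 g z"] by (auto simp: is_arg_min_linorder)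
  have b': "b \<in> \<Gamma>" "\<not> central b" "eta2 b z \<le> 1/100" "det b = 1"
    using b det_1 by (auto simp: G_def)
  have comm: "a ** b = b ** a" if a: "a \<in> G" for a
  proof -
    have a': "a \<in> \<Gamma>" "eta2 a z \<le> 1/100" "det a = 1" using a det_1 by (auto simp: G_def)
    define k where "k = a ** b ** adj2 a ** adj2 b"
    have k: "k \<in> \<Gamma>" using a' b' by (auto simp: k_def intro!: mult_mem adj2_mem)
    obtain s where s: "s = 1 \<or> s = -1" "eta2 a z = (norm (conj_at z a - mat s))\<^sup>2"
      using eta2_eq z a' by blast
    obtain t where t: "t = 1 \<or> t = -1" "eta2 b z = (norm (conj_at z b - mat t))\<^sup>2"
      using eta2_eq z b' by blast
    have le: "x \<le> 1/10" if "x\<^sup>2 \<le> 1/100" for x :: real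
      by (rule power2_le_imp_le) (use that in \<open>auto simp: power2_eq_square\<close>)
    have small: "norm (conj_at z a - mat s) \<le> 1/10" "norm (conj_at z b - mat t) \<le> 1/10"
      using le s(2) t(2) a'(2) b'(3) by metis+
    have "norm (conj_at z k - mat 1) \<le> norm (conj_at z b - mat t) / 2"
      using norm_commutator_le[OF _ _ s(1) t(1) small] z a' b'
      by (simp add: k_def conj_at_mult conj_at_adj2 det_conj_at)
    then have nk: "(norm (conj_at z k - mat 1))\<^sup>2 \<le> (norm (conj_at z b - mat t) / 2)\<^sup>2"
      by (intro power_mono) auto
    then have k2: "(norm (conj_at z k - mat 1))\<^sup>2 \<le> eta2 b z / 4"
      by (simp add: t power_divide)
    have "eta2 k z \<le> (norm (conj_at z k - mat 1))\<^sup>2"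
      by (rule eta2_le) (use k det_1 z in auto)
    then have "eta2 k z < eta2 b z" "eta2 k z \<le> 1/100"
      using k2 eta2_pos[OF b'(4) z b'(2)] b' by auto
    then have "central k" using b_min[of k] k by (auto simp: G_def)
    then consider "k = mat 1" | "k = mat (-1)" by (auto simp: central_def)
    \<comment> \<open>The commutator is close to 1, whereas -1 lies at squared distance 8 from
      1.\<close>
    then have k1: "k = mat 1"
    proof cases
      case 2
      then have "(norm (conj_at z k - mat 1))\<^sup>2 = 8"
        by (simp add: norm_mat2_sq)
      then show ?thesis using k2 b' by simp
    qed
    have "k ** b ** a = a ** b ** (adj2 a ** (adj2 b ** b) ** a)"
      by (simp add: k_def matrix_mul_assoc)
    then show ?thesis using adj2_mult a' b' k1 by simp
  qed
  have gG: "g \<in> G" "h \<in> G" using g h by (auto simp: G_def)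
  obtain l1 where l1: "l1 \<noteq> 0" "fix_prop l1 g b"
    using commute_imp_fix_prop[OF comm[OF gG(1)]] g b' det_1 by metis
  obtain l2 where l2: "l2 \<noteq> 0" "fix_prop l2 h b"
    using commute_imp_fix_prop[OF comm[OF gG(2)]] h b' det_1 by metis
  show ?thesis
    by (rule that[of "l1 / l2"]) (use l1 l2 fix_prop_trans in auto)
qed

text \<open>The bound is the square of the radius in \<open>norm_commutator_le\<close>, so that
  elements violating it or attaining it at a common point commute.\<close>

definition thick :: "complex set" where
  "thick = {z. Im z > 0 \<and> (\<forall>g\<in>\<Gamma>. \<not> central g \<longrightarrow> eta2 g z \<ge> 1/100)}"

text \<open>Move \<open>z\<close> away from the fixed points of the small elements (which all commute) until the
  last of them stops being small. Any element that is small at the end point commutes with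
  that one, hence was already small at \<open>z\<close>.\<close>

lemma thin_to_thick:
  assumes z: "Im z > 0" "z \<notin> thick"
  obtains g w where "g \<in> \<Gamma>" "\<not> central g" "eta2 g z \<le> 1/100" "w \<in> thick" "eta2 g w \<le> 1/100"
proof -
  define G where "G = {g \<in> \<Gamma>. \<not> central g \<and> eta2 g z < 1/100}"
  have "finite {g \<in> \<Gamma>. \<exists>w\<in>{z}. eta2 g w \<le> 1/100}"
    by (rule finite_eta2_le) (use z in \<open>auto simp: upper_half_plane_def\<close>)
  then have fin: "finite G" by (rule finite_subset[rotated]) (auto simp: G_def)
  have "G \<noteq> {}" using z by (auto simp: G_def thick_def not_le)
  then obtain g0 where g0: "g0 \<in> G" by blast
  then have g0': "g0 \<in> \<Gamma>" "\<not> central g0" "eta2 g0 z \<le> 1/100" "det g0 = 1"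
    using det_1 by (auto simp: G_def)
  have "\<exists>l. l \<noteq> 0 \<and> fix_prop l g g0" if "g \<in> G" for g
    using small_elements_fix_prop[OF z(1), of g g0] that g0' by (auto simp: G_def)
  then obtain l where l: "\<And>g. g \<in> G \<Longrightarrow> l g \<noteq> 0 \<and> fix_prop (l g) g g0" by metis
  have et: "eta2 g w = (l g)\<^sup>2 * (displ g0 w)\<^sup>2 + 4 - 2 * \<bar>trace g\<bar>" if "g \<in> G" for g w
    using displ_fix_prop[of "l g" g g0 w] l[OF that] by (simp add: eta2_def power_mult_distrib)
  \<comment> \<open>The value of \<open>displ g0\<close> at which \<open>eta2 g\<close> reaches
    exactly 1/100.\<close>
  define T where "T g = sqrt (1/100 - 4 + 2 * \<bar>trace g\<bar>) / \<bar>l g\<bar>" for g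
  have rad: "1/100 - 4 + 2 * \<bar>trace g\<bar> > (l g)\<^sup>2 * (displ g0 z)\<^sup>2" if "g \<in> G" for g
    using et[OF that, of z] that by (simp add: G_def)
  have rad0: "1/100 - 4 + 2 * \<bar>trace g\<bar> \<ge> 0" if "g \<in> G" for g
    using rad[OF that] by (smt (verit) mult_nonneg_nonneg zero_le_power2)
  have Tsq: "(l g)\<^sup>2 * (T g)\<^sup>2 = 1/100 - 4 + 2 * \<bar>trace g\<bar>" if "g \<in> G" for g
    using rad0[OF that] l[OF that] by (simp add: T_def power_divide)
  have T0: "T g \<ge> 0" if "g \<in> G" for g using rad0[OF that] by (simp add: T_def)
  have Tz: "displ g0 z \<le> T g" if "g \<in> G" for g
  proof -
    have "(l g)\<^sup>2 * (displ g0 z)\<^sup>2 < (l g)\<^sup>2 * (T g)\<^sup>2" using rad[OF that] Tsq[OF that] by simp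
    then have "(displ g0 z)\<^sup>2 \<le> (T g)\<^sup>2" using l[OF that] by (simp add: mult_less_cancel_left)
    then show ?thesis by (rule power2_le_imp_le) (rule T0[OF that])
  qed
  obtain m where m: "m \<in> G" "\<And>g. g \<in> G \<Longrightarrow> T g \<le> T m"
    using ex_is_arg_min_if_finite[OF fin \<open>G \<noteq> {}\<close>, of "\<lambda>g. - T g"] by (auto simp: is_arg_min_linorder)
  obtain w where w: "Im w > 0" "displ g0 w = T m"
    using displ_surj[OF g0'(4) g0'(2) z(1) Tz[OF m(1)]] by blast
  have m': "m \<in> \<Gamma>" "\<not> central m" "eta2 m z \<le> 1/100" using m by (auto simp: G_def)
  \<comment> \<open>At \<open>w\<close> the element \<open>m\<close> sits exactly on the threshold,
    which is why the commutation lemma is stated with non-strict bounds.\<close>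
  have mw: "eta2 m w = 1/100" using et[OF m(1), of w] Tsq[OF m(1)] w by simp
  have "w \<in> thick"
    unfolding thick_def
  proof (safe, fact w(1), rule ccontr)
    fix h assume h: "h \<in> \<Gamma>" "\<not> central h" "\<not> 1/100 \<le> eta2 h w"
    then obtain k where k: "k \<noteq> 0" "fix_prop k h m"
      using small_elements_fix_prop[OF w(1), of h m] m' mw by auto
    \<comment> \<open>\<open>displ h\<close> is a multiple of \<open>displ g0\<close>, which is at
      most \<open>T m\<close> at \<open>z\<close> and equal to \<open>T m\<close> at
      \<open>w\<close>. So \<open>h\<close> was already small at \<open>z\<close>, and its own
      threshold \<open>T h\<close> cannot exceed \<open>T m\<close>.\<close>
    have "displ h v = \<bar>k\<bar> * (\<bar>l m\<bar> * displ g0 v)" for v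
      using displ_fix_prop k(2) l[OF m(1)] by simp
    then have "displ h z \<le> displ h w"
      using Tz[OF m(1)] w(2) by (simp add: mult_left_mono)
    then have "(displ h z)\<^sup>2 \<le> (displ h w)\<^sup>2"
      using displ_nonneg z by (intro power_mono) auto
    then have "eta2 h z \<le> eta2 h w" by (simp add: eta2_def)
    then have hG: "h \<in> G" using h by (auto simp: G_def)
    have "(T h)\<^sup>2 \<le> (T m)\<^sup>2" using m(2)[OF hG] T0[OF hG] by (intro power_mono) auto
    then have "(l h)\<^sup>2 * (T h)\<^sup>2 \<le> (l h)\<^sup>2 * (T m)\<^sup>2" by (intro mult_left_mono) auto
    then have "eta2 h w \<ge> 1/100" using et[OF hG, of w] Tsq[OF hG] w by simp
    with h show False by simp
  qed
  then show ?thesis using that m' mw by simp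
qed

end

section \<open>Invariance of the hyperbolic measure\<close>

text \<open>The change of variables formula speaks about \<open>real^'n\<close>, so areas in the
  half-plane are transported to \<open>real^2\<close>.\<close>

definition vec_of_complex :: "complex \<Rightarrow> real^2" where
  "vec_of_complex z = vector [Re z, Im z]"

definition complex_of_vec :: "real^2 \<Rightarrow> complex" where
  "complex_of_vec v = Complex (v $ 1) (v $ 2)"

lemma vec_of_complex_nth [simp]: "vec_of_complex z $ 1 = Re z" "vec_of_complex z $ 2 = Im z"
  by (simp_all add: vec_of_complex_def)

lemma Re_Im_complex_of_vec [simp]: "Re (complex_of_vec v) = v $ 1" "Im (complex_of_vec v) = v $ 2"
  by (simp_all add: complex_of_vec_def)

lemma complex_vec_inverse [simp]:
  "complex_of_vec (vec_of_complex z) = z" "vec_of_complex (complex_of_vec v) = v"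
  by (simp_all add: complex_eq_iff vec_eq_iff forall_2)

lemma bounded_linear_vec_of_complex: "bounded_linear vec_of_complex"
  by (intro linear_conv_bounded_linear[THEN iffD1] linearI) (auto simp: vec_eq_iff forall_2)

lemma bounded_linear_complex_of_vec: "bounded_linear complex_of_vec"
  by (intro linear_conv_bounded_linear[THEN iffD1] linearI) (auto simp: complex_eq_iff)

lemma complex_of_vec_measurable [measurable]: "complex_of_vec \<in> borel_measurable borel"
  by (intro borel_measurable_continuous_onI linear_continuous_on bounded_linear_complex_of_vec)

lemma lborel_complex_eq_distr: "(lborel :: complex measure) = distr lborel borel complex_of_vec"
proof (rule lborel_eqI)
  fix l u :: complex
  assume lu: "\<And>b. b \<in> Basis \<Longrightarrow> l \<bullet> b \<le> u \<bullet> b"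
  have "complex_of_vec -` box l u = box (vec_of_complex l) (vec_of_complex u)"
    by (auto simp: box_def Basis_complex_def Basis_vec_def inner_axis forall_2)
  then have "emeasure (distr lborel borel complex_of_vec) (box l u)
      = emeasure lborel (box (vec_of_complex l) (vec_of_complex u))"
    by (simp add: emeasure_distr)
  also have "\<dots> = (\<Prod>b\<in>Basis. (vec_of_complex u - vec_of_complex l) \<bullet> b)"
  proof (intro emeasure_lborel_box)
    have "\<forall>i. vec_of_complex l $ i \<le> vec_of_complex u $ i"
      using lu[of 1] lu[of \<i>] by (simp add: forall_2 Basis_complex_def)
    then show "vec_of_complex l \<bullet> b \<le> vec_of_complex u \<bullet> b" if "b \<in> Basis" for b
      using that by (auto simp: Basis_vec_def inner_axis)
  qed
  also have "(\<Prod>b\<in>Basis. (vec_of_complex u - vec_of_complex l) \<bullet> b) = (\<Prod>b\<in>Basis. (u - l) \<bullet> b)"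
  proof -
    have B: "(Basis :: (real^2) set) = {axis 1 1, axis 2 1}"
      by (auto simp: Basis_vec_def UNIV_2)
    have n: "axis (1::2) (1::real) \<noteq> axis 2 1"
      by (simp add: axis_eq_axis)
    have "(\<Prod>b\<in>{axis 1 1, axis 2 1}. (vec_of_complex u - vec_of_complex l) \<bullet> b) = (\<Prod>b\<in>Basis. (u - l) \<bullet> b)"
      using n by (simp add: Basis_complex_def inner_axis)
    then show ?thesis unfolding B .
  qed
  finally show "emeasure (distr lborel borel complex_of_vec) (box l u) = ennreal (\<Prod>b\<in>Basis. (u - l) \<bullet> b)" .
qed simp

lemma sets_hyperbolic_measure [simp, measurable_cong]: "sets hyperbolic_measure = sets borel"
  by (simp add: hyperbolic_measure_def)

lemma upper_half_plane_borel [measurable]: "upper_half_plane \<in> sets borel"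
  unfolding upper_half_plane_def by (intro borel_open open_halfspace_Im_gt)

lemma hyperbolic_measure_vec:
  assumes [measurable]: "S \<in> sets borel" and "S \<subseteq> upper_half_plane"
  shows "emeasure hyperbolic_measure S
    = (\<integral>\<^sup>+v. ennreal (indicator (complex_of_vec -` S) v * (1 / (v $ 2)\<^sup>2)) \<partial>lborel)"
proof -
  have "emeasure hyperbolic_measure S
      = (\<integral>\<^sup>+z. indicator upper_half_plane z * ennreal (1 / (Im z)\<^sup>2) * indicator S z \<partial>lborel)"
    unfolding hyperbolic_measure_def by (subst emeasure_density) auto
  also have "\<dots> = (\<integral>\<^sup>+z. ennreal (indicator S z * (1 / (Im z)\<^sup>2)) \<partial>lborel)"
    using assms by (intro nn_integral_cong) (auto simp: indicator_def)
  also have "\<dots> = (\<integral>\<^sup>+v. ennreal (indicator S (complex_of_vec v) * (1 / (Im (complex_of_vec v))\<^sup>2)) \<partial>lborel)"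
    by (subst lborel_complex_eq_distr, subst nn_integral_distr) auto
  finally show ?thesis by (simp add: indicator_def)
qed

lemma moebius_measurable [measurable]: "moebius g \<in> borel_measurable borel"
  unfolding moebius_def[abs_def] aut_j_def by measurable

lemma moebius_image_eq:
  assumes "det g = 1" "S \<subseteq> upper_half_plane"
  shows "moebius g ` S = upper_half_plane \<inter> moebius (adj2 g) -` S"
proof (intro equalityI subsetI)
  fix x assume "x \<in> moebius g ` S"
  then show "x \<in> upper_half_plane \<inter> moebius (adj2 g) -` S"
    using assms moebius_adj2(1)[OF assms(1)] Im_moebius_pos[OF assms(1)]
    by (auto simp: upper_half_plane_def subset_iff)
next
  fix x assume "x \<in> upper_half_plane \<inter> moebius (adj2 g) -` S"
  then show "x \<in> moebius g ` S"
    using moebius_adj2(2)[OF assms(1), of x] by (auto simp: upper_half_plane_def intro!: rev_image_eqI)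
qed

lemma moebius_image_borel:
  assumes "det g = 1" "S \<subseteq> upper_half_plane" and [measurable]: "S \<in> sets borel"
  shows "moebius g ` S \<in> sets borel"
proof -
  have "upper_half_plane \<inter> (moebius (adj2 g) -` S \<inter> space borel) \<in> sets borel"
    by (intro sets.Int upper_half_plane_borel measurable_sets[OF moebius_measurable]) fact
  then show ?thesis by (simp add: moebius_image_eq assms)
qed

lemma moebius_has_field_derivative:
  assumes "det g = 1" "aut_j g z \<noteq> 0"
  shows "(moebius g has_field_derivative 1 / (aut_j g z)\<^sup>2) (at z within A)"
proof -
  have "((\<lambda>z. (of_real (entry g 1 1) * z + of_real (entry g 1 2)) / (of_real (entry g 2 1) * z + of_real (entry g 2 2)))
     has_field_derivative (of_real (entry g 1 1) * aut_j g z
       - (of_real (entry g 1 1) * z + of_real (entry g 1 2)) * of_real (entry g 2 1)) / (aut_j g z * aut_j g z)) (at z within A)"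
    using assms(2) unfolding aut_j_def by (auto intro!: derivative_eq_intros)
  moreover have "of_real (entry g 1 1) * aut_j g z
       - (of_real (entry g 1 1) * z + of_real (entry g 1 2)) * of_real (entry g 2 1) = 1"
  proof -
    have "of_real (entry g 1 1) * of_real (entry g 2 2) - of_real (entry g 1 2) * of_real (entry g 2 1) = (1::complex)"
      using assms(1) by (simp add: det_2 flip: of_real_mult of_real_diff)
    then show ?thesis by (simp add: aut_j_def algebra_simps)
  qed
  ultimately show ?thesis
    by (simp add: moebius_def[abs_def] aut_j_def power2_eq_square)
qed

lemma det_matrix_complex_mult:
  "det (matrix (\<lambda>v. vec_of_complex (m * complex_of_vec v))) = (cmod m)\<^sup>2"
  using cmod_power2[of m]
  by (simp add: det_2 matrix_def axis_def complex_of_vec_def power2_eq_square)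

text \<open>With \<open>j = aut_j g z\<close> the Jacobian is \<open>|j|^-4\<close>, while
  \<open>Im\<close> is divided by \<open>|j|^2\<close>, so the density \<open>1 / Im^2\<close>
  absorbs it exactly. Finite area makes the density absolutely integrable on \<open>S\<close>, as
  the change of variables requires.\<close>

lemma hyperbolic_measure_moebius:
  assumes g: "det g = 1" and S: "S \<subseteq> upper_half_plane" and [measurable]: "S \<in> sets borel"
    and fin: "emeasure hyperbolic_measure S < \<infinity>"
  shows "emeasure hyperbolic_measure (moebius g ` S) = emeasure hyperbolic_measure S"
proof -
  define h :: "real^2 \<Rightarrow> real" where "h v = 1 / (v $ 2)\<^sup>2" for v
  define S' where "S' = complex_of_vec -` S"
  define G where "G v = vec_of_complex (moebius g (complex_of_vec v))" for v
  define G' where "G' v = (\<lambda>t. vec_of_complex (1 / (aut_j g (complex_of_vec v))\<^sup>2 * complex_of_vec t))" for v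
  have pos: "v $ 2 > 0" if "v \<in> S'" for v :: "real^2"
    using that S by (auto simp: S'_def upper_half_plane_def)
  have jnz: "aut_j g (complex_of_vec v) \<noteq> 0" if "v \<in> S'" for v
    using pos[OF that] g by (intro aut_j_nonzero) auto
  have S'_borel [measurable]: "S' \<in> sets borel"
    unfolding S'_def using measurable_sets[OF complex_of_vec_measurable assms(3)] by simp
  have h_borel [measurable]: "h \<in> borel_measurable borel" unfolding h_def by measurable
  have h_nonneg: "0 \<le> h v" for v by (simp add: h_def)
  have GS: "G ` S' = complex_of_vec -` (moebius g ` S)"
  proof (intro equalityI subsetI)
    fix v assume "v \<in> complex_of_vec -` (moebius g ` S)"
    then obtain z where "z \<in> S" "complex_of_vec v = moebius g z" by auto
    then have "v = G (vec_of_complex z)" "vec_of_complex z \<in> S'"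
      by (auto simp: G_def S'_def) (metis complex_vec_inverse(2))
    then show "v \<in> G ` S'" by blast
  qed (auto simp: G_def S'_def)
  have der: "(G has_derivative G' v) (at v within S')" if "v \<in> S'" for v
    unfolding G_def G'_def
    using bounded_linear.has_derivative[OF bounded_linear_vec_of_complex
      has_derivative_compose[OF bounded_linear.has_derivative[OF bounded_linear_complex_of_vec has_derivative_ident]
        moebius_has_field_derivative[OF g jnz[OF that], unfolded has_field_derivative_def]]] .
  have inj: "inj_on G S'"
  proof (rule inj_onI)
    fix u v assume uv: "u \<in> S'" "v \<in> S'" "G u = G v"
    then have "moebius g (complex_of_vec u) = moebius g (complex_of_vec v)"
      by (metis G_def complex_vec_inverse(1))
    then have "complex_of_vec u = complex_of_vec v"
      using moebius_adj2(1)[OF g] uv pos by (metis Re_Im_complex_of_vec(2))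
    then show "u = v" by (metis complex_vec_inverse(2))
  qed
  have eq: "\<bar>det (matrix (G' v))\<bar> * h (G v) = h v" if "v \<in> S'" for v
    unfolding G'_def det_matrix_complex_mult h_def G_def
    using jnz[OF that] pos[OF that]
    by (simp add: norm_divide norm_power power_divide Im_moebius[OF g] flip: power_mult)
  have fin': "(\<integral>\<^sup>+v. ennreal (indicator S' v * h v) \<partial>lborel) < \<infinity>"
    using fin hyperbolic_measure_vec[OF assms(3) S] by (simp add: S'_def h_def)
  have "integrable lborel (\<lambda>v. indicator S' v * h v)"
    by (rule integrableI_nonneg) (use fin' in \<open>auto simp: h_def\<close>)
  then have "set_integrable lborel S' h" by (simp add: set_integrable_def)
  then have ai: "h absolutely_integrable_on S'"
    unfolding set_integrable_def using integrable_completion by blast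
  have ai': "(\<lambda>v. \<bar>det (matrix (G' v))\<bar> * h (G v)) absolutely_integrable_on S'"
    by (rule absolutely_integrable_spike[OF ai, of "{}"]) (auto simp: eq)
  have int': "integral S' (\<lambda>v. \<bar>det (matrix (G' v))\<bar> * h (G v)) = integral S' h"
    by (rule integral_cong) (simp add: eq)
  \<comment> \<open>The formula concerns vector-valued integrands; \<open>h\<close> is passed to it
    as a map into \<open>real^1\<close>.\<close>
  have "h absolutely_integrable_on (G ` S') \<and> integral (G ` S') h = integral S' h"
    using has_absolute_integral_change_of_variables[OF _ der inj, of "\<lambda>x. vec (h x) :: real^1" "vec (integral S' h)"] ai' int'
    unfolding absolutely_integrable_on_1_iff integral_on_1_eq
    by (simp add: sets_completionI_sets)
  then have "(h has_integral (integral S' h)) (G ` S')"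
    using set_lebesgue_integral_eq_integral(1) by (metis has_integral_iff)
  then have 1: "integral\<^sup>N lborel (\<lambda>x. indicator (G ` S') x * h x) = ennreal (integral S' h)"
    by (intro nn_integral_has_integral_lebesgue h_nonneg)
  have "(h has_integral (integral S' h)) S'"
    using ai set_lebesgue_integral_eq_integral(1) by (metis has_integral_iff)
  then have 2: "integral\<^sup>N lborel (\<lambda>x. indicator S' x * h x) = ennreal (integral S' h)"
    by (intro nn_integral_has_integral_lebesgue h_nonneg)
  have "moebius g ` S \<subseteq> upper_half_plane"
    using moebius_image_eq[OF g S] by blast
  then show ?thesis
    using 1 2 hyperbolic_measure_vec[OF assms(3) S] hyperbolic_measure_vec[OF moebius_image_borel[OF g S assms(3)]]
    by (simp add: h_def flip: S'_def GS)
qed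

text \<open>Since \<open>(Im z - Im w)^2\<close> is at most \<open>|z - w|^2\<close>, the hypothesis
  is a quadratic inequality for the two heights; it confines their ratio to the interval from 1/2 to
  2.\<close>

lemma ptinv_small:
  assumes "Im z > 0" "Im w > 0" "ptinv z w < 1/4"
  shows "Im w / 2 < Im z" "Im z < 2 * Im w" "cmod (z - w) < Im w"
proof -
  let ?y = "Im z" and ?v = "Im w"
  have yv: "?y * ?v > 0" using assms by simp
  have c: "(cmod (z - w))\<^sup>2 < ?y * ?v / 4"
    using assms yv by (simp add: ptinv_def field_simps)
  have "(?y - ?v)\<^sup>2 \<le> (cmod (z - w))\<^sup>2" by (simp add: cmod_power2)
  then have q: "(?y - ?v)\<^sup>2 < ?y * ?v / 4" using c by simp
  show 1: "?v / 2 < ?y"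
  proof (rule ccontr)
    assume "\<not> ?v / 2 < ?y"
    then have "0 \<le> ?v - 2 * ?y" by simp
    \<comment> \<open>With \<open>y\<close> and \<open>v\<close> the two heights, this product is
      \<open>v^2 - 9/4 y v + y^2/2\<close>; against \<open>y^2 + v^2 < 9/4 y v\<close> it would
      force \<open>y^2 / 2 < 0\<close>.\<close>
    then have "0 \<le> (?v - 2 * ?y) * (?v - ?y / 4)" using assms by (intro mult_nonneg_nonneg) auto
    moreover have "?y * ?y > 0" using assms by simp
    ultimately show False using q yv by (simp add: power2_eq_square algebra_simps)
  qed
  show 2: "?y < 2 * ?v"
  proof (rule ccontr)
    assume "\<not> ?y < 2 * ?v"
    then have "0 \<le> ?y - 2 * ?v" by simp
    then have "0 \<le> (?y - 2 * ?v) * (?y - ?v / 4)" using assms by (intro mult_nonneg_nonneg) auto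
    moreover have "?v * ?v > 0" using assms by simp
    ultimately show False using q yv by (simp add: power2_eq_square algebra_simps)
  qed
  have "?y * ?v < 2 * ?v * ?v" using 2 assms by simp
  moreover have "?v * ?v > 0" using assms by simp
  ultimately have "(cmod (z - w))\<^sup>2 < ?v\<^sup>2" using c unfolding power2_eq_square by linarith
  then show "cmod (z - w) < ?v" by (rule power2_less_imp_less) (use assms in auto)
qed

section \<open>Finite covolume: the thick part is compact modulo the group\<close>

text \<open>A hyperbolic disc about \<open>w\<close> of a fixed radius, namely
  \<open>2 arsinh(1/4)\<close>.\<close>

definition nbhd :: "complex \<Rightarrow> complex set" where
  "nbhd w = {z. Im z > 0 \<and> ptinv z w < 1/4}"

lemma nbhd_subset: "nbhd w \<subseteq> upper_half_plane"
  by (auto simp: nbhd_def upper_half_plane_def)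

lemma nbhd_borel [measurable]: "nbhd w \<in> sets borel"
proof -
  have "nbhd w = {z. Im z > 0} \<inter> {z. (cmod (z - w))\<^sup>2 / (Im z * Im w) < 1/4}"
    by (auto simp: nbhd_def ptinv_def)
  also have "\<dots> \<in> sets borel" by measurable
  finally show ?thesis .
qed

text \<open>With \<open>v = Im w\<close>, the disc contains the Euclidean disc of radius
  \<open>v/4\<close>, on which the density is at least \<open>1 / (2 v)^2\<close>; the heights
  cancel and leave a bound independent of \<open>w\<close>.\<close>

lemma nbhd_measure_lower:
  assumes "Im w > 0"
  shows "ennreal (unit_ball_vol 2 / 64) \<le> emeasure hyperbolic_measure (nbhd w)"
proof -
  let ?v = "Im w"
  have sub: "z \<in> nbhd w \<and> Im z \<le> 2 * ?v" if z: "z \<in> ball w (?v / 4)" for z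
  proof -
    have d: "cmod (z - w) < ?v / 4" using z by (simp add: dist_norm norm_minus_commute)
    have "\<bar>Im z - ?v\<bar> \<le> cmod (z - w)" using abs_Im_le_cmod[of "z - w"] by simp
    then have im: "3 / 4 * ?v < Im z" "Im z \<le> 2 * ?v" using d assms by linarith+
    then have pos: "Im z > 0" using assms by simp
    have "(cmod (z - w))\<^sup>2 < (?v / 4)\<^sup>2" using d by (intro power_strict_mono) auto
    also have "\<dots> \<le> (Im z * ?v) / 4" 
      using mult_strict_right_mono[OF im(1) assms] assms by (simp add: power2_eq_square)
    finally have "ptinv z w < 1/4" using pos assms by (simp add: ptinv_def divide_less_eq)
    then show ?thesis using pos im by (simp add: nbhd_def)
  qed
  have "ennreal (unit_ball_vol 2 / 64) = ennreal (1 / (2 * ?v)\<^sup>2) * ennreal (unit_ball_vol 2 * (?v / 4) ^ 2)"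
    using assms by (simp add: power2_eq_square flip: ennreal_mult')
  also have "\<dots> = ennreal (1 / (2 * ?v)\<^sup>2) * emeasure lborel (ball w (?v / 4))"
    using assms by (simp add: emeasure_ball)
  also have "\<dots> = (\<integral>\<^sup>+z. ennreal (1 / (2 * ?v)\<^sup>2) * indicator (ball w (?v / 4)) z \<partial>lborel)"
    by (simp add: nn_integral_cmult_indicator)
  also have "\<dots> \<le> (\<integral>\<^sup>+z. indicator upper_half_plane z * ennreal (1 / (Im z)\<^sup>2) * indicator (nbhd w) z \<partial>lborel)"
  proof (rule nn_integral_mono)
    fix z
    show "ennreal (1 / (2 * ?v)\<^sup>2) * indicator (ball w (?v / 4)) z
      \<le> indicator upper_half_plane z * ennreal (1 / (Im z)\<^sup>2) * indicator (nbhd w) z"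
    proof (cases "z \<in> ball w (?v / 4)")
      case True
      then have "z \<in> nbhd w" "Im z \<le> 2 * ?v" using sub by auto
      moreover have "Im z > 0" using \<open>z \<in> nbhd w\<close> by (simp add: nbhd_def)
      ultimately have "1 / (2 * ?v)\<^sup>2 \<le> 1 / (Im z)\<^sup>2"
        using assms by (intro divide_left_mono power_mono) auto
      then show ?thesis
        using \<open>z \<in> nbhd w\<close> \<open>Im z > 0\<close> True by (simp add: upper_half_plane_def ennreal_leI)
    qed simp
  qed
  also have "\<dots> = emeasure hyperbolic_measure (nbhd w)"
    unfolding hyperbolic_measure_def by (subst emeasure_density) auto
  finally show ?thesis .
qed

lemma nbhd_measure_finite:
  assumes "Im w > 0"
  shows "emeasure hyperbolic_measure (nbhd w) < \<infinity>"
proof -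
  let ?v = "Im w"
  have "emeasure hyperbolic_measure (nbhd w)
    = (\<integral>\<^sup>+z. indicator upper_half_plane z * ennreal (1 / (Im z)\<^sup>2) * indicator (nbhd w) z \<partial>lborel)"
    unfolding hyperbolic_measure_def by (subst emeasure_density) auto
  also have "\<dots> \<le> (\<integral>\<^sup>+z. ennreal (1 / (?v / 2)\<^sup>2) * indicator (ball w ?v) z \<partial>lborel)"
  proof (rule nn_integral_mono)
    fix z
    show "indicator upper_half_plane z * ennreal (1 / (Im z)\<^sup>2) * indicator (nbhd w) z
      \<le> ennreal (1 / (?v / 2)\<^sup>2) * indicator (ball w ?v) z"
    proof (cases "z \<in> nbhd w")
      case True
      then have *: "Im z > 0" "?v / 2 < Im z" "cmod (z - w) < ?v"
        using ptinv_small[of z w] assms by (auto simp: nbhd_def)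
      then have "1 / (Im z)\<^sup>2 \<le> 1 / (?v / 2)\<^sup>2"
        using assms by (intro divide_left_mono power_mono) auto
      then show ?thesis
        using * True by (simp add: upper_half_plane_def ennreal_leI dist_norm norm_minus_commute)
    qed simp
  qed
  also have "\<dots> = ennreal (1 / (?v / 2)\<^sup>2) * emeasure lborel (ball w ?v)"
    by (simp add: nn_integral_cmult_indicator)
  also have "\<dots> < \<infinity>"
    using emeasure_bounded_finite[OF bounded_ball, of w ?v] by (simp add: ennreal_mult_less_top less_top)
  finally show ?thesis .
qed

text \<open>A compact set with room for every centre whose \<open>nbhd\<close> meets
  \<open>nbhd p\<close>. Two applications of \<open>ptinv_small\<close> through a common point give
  the distance \<open>(2 + 1) * Im p\<close> and the height \<open>Im p / 4\<close>.\<close>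

definition big_nbhd :: "complex \<Rightarrow> complex set" where
  "big_nbhd p = {w. cmod (w - p) \<le> 3 * Im p \<and> Im p / 4 \<le> Im w}"

lemma compact_big_nbhd: "compact (big_nbhd p)"
proof -
  have "big_nbhd p = cball p (3 * Im p) \<inter> {w. Im p / 4 \<le> Im w}"
    by (auto simp: big_nbhd_def dist_norm norm_minus_commute)
  then show ?thesis
    by (metis closed_halfspace_Im_ge compact_Int_closed compact_cball)
qed

lemma big_nbhdI:
  assumes "Im w > 0" "Im p > 0" "z \<in> nbhd w" "z \<in> nbhd p"
  shows "w \<in> big_nbhd p"
proof -
  have z: "Im z > 0" using assms by (simp add: nbhd_def)
  have "ptinv z p < 1/4" "ptinv w z < 1/4"
    using assms ptinv_commute by (auto simp: nbhd_def)
  note * = ptinv_small[OF z assms(2) this(1)] ptinv_small[OF assms(1) z this(2)]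
  have "cmod (w - p) \<le> cmod (w - z) + cmod (z - p)"
    using norm_triangle_ineq[of "w - z" "z - p"] by simp
  then show ?thesis using * unfolding big_nbhd_def by simp
qed

context fuchsian
begin

lemma countable_group: "countable \<Gamma>"
proof -
  have "\<Gamma> = (\<Union>n::nat. {g \<in> \<Gamma>. norm g \<le> real n})"
  proof safe
    fix g assume "g \<in> \<Gamma>"
    moreover obtain n where "norm g \<le> real n" using real_arch_simple by blast
    ultimately show "g \<in> (\<Union>n. {g \<in> \<Gamma>. norm g \<le> real n})" by blast
  qed
  also have "countable \<dots>"
    by (rule countable_UN) (auto intro: countable_finite finite_bounded)
  finally show ?thesis .
qed

section \<open>How often translates of one neighbourhood overlap\<close>

text \<open>If the conjugates are close, \<open>adj2 g ** h\<close> has \<open>eta2\<close> at most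
  \<open>(7/100)^2 < 1/100\<close> at \<open>w\<close>; thickness makes it central, and closeness to
  1 excludes -1. The separation is uniform in \<open>w\<close>.\<close>

lemma thick_conj_at_separated:
  assumes w: "w \<in> thick" and g: "g \<in> \<Gamma>" and h: "h \<in> \<Gamma>"
    and ng: "norm (conj_at w g) \<le> 7" and close: "norm (conj_at w g - conj_at w h) < 1/100"
  shows "g = h"
proof -
  have w0: "Im w > 0" using w by (simp add: thick_def)
  let ?k = "adj2 g ** h"
  have k: "?k \<in> \<Gamma>" using g h by (intro mult_mem adj2_mem)
  have d: "det g = 1" using g det_1 by blast
  have dM: "det (conj_at w g) = 1" using d w0 by (simp add: det_conj_at)
  have "conj_at w ?k - mat 1 = adj2 (conj_at w g) ** (conj_at w h - conj_at w g)"
    using adj2_mult(2)[OF dM] w0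
    by (simp add: conj_at_mult conj_at_adj2 mat2_eq_iff entry_mult algebra_simps)
  also have "norm \<dots> \<le> norm (conj_at w g) * norm (conj_at w h - conj_at w g)"
    using norm_mult_mat2_le[of "adj2 (conj_at w g)"] by simp
  also have "\<dots> \<le> 7 * (1/100)"
    using ng close by (intro mult_mono) (auto simp: norm_minus_commute)
  finally have le: "norm (conj_at w ?k - mat 1) \<le> 7/100" by simp
  then have sq: "(norm (conj_at w ?k - mat 1))\<^sup>2 \<le> (7/100)\<^sup>2" by (intro power_mono) auto
  have "eta2 ?k w \<le> (norm (conj_at w ?k - mat 1))\<^sup>2"
    using k det_1 w0 by (intro eta2_le) auto
  then have "eta2 ?k w < 1/100" using sq by (simp add: power2_eq_square)
  then have "central ?k" using w k by (force simp: thick_def)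
  then consider "?k = mat 1" | "?k = mat (-1)" by (auto simp: central_def)
  then have "?k = mat 1"
  proof cases
    case 2
    then have "(norm (conj_at w ?k - mat 1))\<^sup>2 = 8" by (simp add: norm_mat2_sq)
    then show ?thesis using sq by (simp add: power2_eq_square)
  qed
  then have "g ** adj2 g ** h = g" by (simp flip: matrix_mul_assoc)
  then show ?thesis using adj2_mult(1)[OF d] by simp
qed

text \<open>For \<open>x\<close> in the half-plane these are the elements whose translate of
  \<open>nbhd w\<close> contains \<open>x\<close>.\<close>

definition hits :: "complex \<Rightarrow> complex \<Rightarrow> (real^2^2) set" where
  "hits w x = {g \<in> \<Gamma>. moebius (adj2 g) x \<in> nbhd w}"

text \<open>Two hits differ by an element \<open>b\<close> that takes some point of
  \<open>nbhd w\<close> to another, so \<open>b w\<close> lies in \<open>big_nbhd w\<close>. There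
  \<open>ptinv w (b w)\<close> is at most \<open>3^2 * 4 = 36\<close>, and
  \<open>36 + 2 \<le> 7^2\<close>.\<close>

lemma hits_conj_at:
  assumes w: "Im w > 0" and x: "Im x > 0" and g: "g \<in> hits w x" "g0 \<in> hits w x"
  shows "norm (conj_at w (adj2 g ** g0)) \<le> 7"
proof -
  have mem: "g \<in> \<Gamma>" "g0 \<in> \<Gamma>" using g by (auto simp: hits_def)
  define b where "b = adj2 g ** g0"
  define z0 where "z0 = moebius (adj2 g0) x"
  have db: "det b = 1" using mem det_1 by (simp add: b_def det_mul)
  have z0: "Im z0 > 0" "z0 \<in> nbhd w" using g by (auto simp: z0_def hits_def nbhd_def)
  have "moebius b z0 = moebius (adj2 g) x"
    unfolding b_def z0_def using mem det_1 x
    by (subst moebius_mult) (auto simp: aut_j_nonzero Im_moebius_pos moebius_adj2)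
  then have bz: "moebius b z0 \<in> nbhd w" "Im (moebius b z0) > 0" using g by (auto simp: hits_def nbhd_def)
  have bw: "Im (moebius b w) > 0" using db w by (rule Im_moebius_pos)
  have "ptinv (moebius b z0) (moebius b w) < 1/4"
    using z0 w db by (simp add: ptinv_moebius nbhd_def)
  then have "moebius b w \<in> big_nbhd w"
    using bz bw w by (intro big_nbhdI[of _ _ "moebius b z0"]) (auto simp: nbhd_def)
  then have *: "cmod (w - moebius b w) \<le> 3 * Im w" "Im w / 4 \<le> Im (moebius b w)"
    by (auto simp: big_nbhd_def norm_minus_commute)
  have "(cmod (w - moebius b w))\<^sup>2 \<le> (3 * Im w)\<^sup>2"
    using * by (intro power_mono) auto
  also have "\<dots> \<le> 36 * (Im w * Im (moebius b w))"
    using * w by (simp add: power2_eq_square)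
  finally have "ptinv w (moebius b w) \<le> 36"
    using w bw by (simp add: ptinv_def divide_le_eq)
  then have "(norm (conj_at w b))\<^sup>2 \<le> 7\<^sup>2"
    using w db by (simp add: norm_conj_at_sq displ_sq)
  then show ?thesis unfolding b_def by (rule power2_le_imp_le) simp
qed

text \<open>Packing: relative to one hit, the conjugates of the others lie in the ball of radius 7
  and are 1/100 apart, so each ball of radius 1/200 in a finite cover contains at most one. The
  cover depends neither on \<open>w\<close> nor on \<open>x\<close>.\<close>

lemma hits_card_bound:
  obtains M :: nat where "\<And>w x. w \<in> thick \<Longrightarrow> Im x > 0 \<Longrightarrow> finite (hits w x) \<and> card (hits w x) \<le> M"
proof -
  have "compact (cball (0 :: real^2^2) 7)" by (rule compact_cball)
  then obtain C where C: "finite C" "cball (0 :: real^2^2) 7 \<subseteq> (\<Union>c\<in>C. ball c (1/200))"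
    unfolding compact_eq_totally_bounded by (metis zero_less_divide_1_iff zero_less_numeral)
  show ?thesis
  proof (rule that[of "card C"])
    fix w x assume w: "w \<in> thick" and x: "Im x > 0"
    have w0: "Im w > 0" using w by (simp add: thick_def)
    show "finite (hits w x) \<and> card (hits w x) \<le> card C"
    proof (cases "hits w x = {}")
      case False
      then obtain g0 where g0: "g0 \<in> hits w x" by blast
      have "\<exists>c\<in>C. dist c (conj_at w (adj2 g ** g0)) < 1/200" if "g \<in> hits w x" for g
        using hits_conj_at[OF w0 x that g0] C(2) by (force simp: subset_iff)
      then obtain c where c: "\<And>g. g \<in> hits w x \<Longrightarrow> c g \<in> C \<and> dist (c g) (conj_at w (adj2 g ** g0)) < 1/200"
        by metis
      have "inj_on c (hits w x)"
      proof (rule inj_onI)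
        fix g h assume gh: "g \<in> hits w x" "h \<in> hits w x" "c g = c h"
        have mem: "g \<in> \<Gamma>" "h \<in> \<Gamma>" "g0 \<in> \<Gamma>" using gh g0 by (auto simp: hits_def)
        have "dist (conj_at w (adj2 g ** g0)) (conj_at w (adj2 h ** g0)) < 1/200 + 1/200"
          using c[OF gh(1)] c[OF gh(2)] gh(3)
            dist_triangle3[of "conj_at w (adj2 g ** g0)" "conj_at w (adj2 h ** g0)" "c g"] by simp
        then have *: "norm (conj_at w (adj2 g ** g0) - conj_at w (adj2 h ** g0)) < 1/100"
          by (simp add: dist_norm)
        have "adj2 g ** g0 = adj2 h ** g0"
          by (rule thick_conj_at_separated[OF w _ _ hits_conj_at[OF w0 x gh(1) g0] *])
             (use mem in \<open>auto intro: mult_mem adj2_mem\<close>)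
        then have "adj2 g ** (g0 ** adj2 g0) = adj2 h ** (g0 ** adj2 g0)"
          by (simp add: matrix_mul_assoc)
        then have "adj2 g = adj2 h" using mem det_1 by (simp add: adj2_mult)
        then show "g = h" by (simp add: mat2_eq_iff adj2_def)
      qed
      moreover have "c ` hits w x \<subseteq> C" using c by auto
      ultimately show ?thesis
        using C(1) by (meson card_inj_on_le inj_on_finite)
    qed auto
  qed
qed

section \<open>Area in the quotient\<close>

text \<open>The representatives in \<open>F\<close> of the points that \<open>nbhd w\<close> covers
  in the quotient.\<close>

definition orbit_nbhd :: "complex set \<Rightarrow> complex \<Rightarrow> complex set" where
  "orbit_nbhd F w = F \<inter> (\<Union>g\<in>\<Gamma>. moebius g ` nbhd w)"

lemma orbit_nbhd_borel:
  assumes "F \<in> sets borel"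
  shows "orbit_nbhd F w \<in> sets borel"
  unfolding orbit_nbhd_def
  by (intro sets.Int assms sets.countable_UN' countable_group image_subsetI moebius_image_borel nbhd_subset nbhd_borel det_1)

text \<open>Unfolding. Every point of \<open>nbhd w\<close> is moved into \<open>F\<close> by some
  \<open>g\<close>, so the area is at most the sum over \<open>g\<close> of the areas of the pieces
  \<open>B g\<close>. Their images lie in \<open>orbit_nbhd F w\<close> and have the same areas, and
  each point there is covered at most \<open>M\<close> times.\<close>

lemma nbhd_measure_le:
  assumes F [measurable]: "F \<in> sets borel" and FH: "F \<subseteq> upper_half_plane"
    and rep: "\<And>z. z \<in> upper_half_plane \<Longrightarrow> \<exists>g\<in>\<Gamma>. moebius g z \<in> F"
    and w: "w \<in> thick" and M: "\<And>x. Im x > 0 \<Longrightarrow> finite (hits w x) \<and> card (hits w x) \<le> M"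
  shows "emeasure hyperbolic_measure (nbhd w) \<le> of_nat M * emeasure hyperbolic_measure (orbit_nbhd F w)"
proof -
  have w0: "Im w > 0" using w by (simp add: thick_def)
  define B where "B g = nbhd w \<inter> moebius g -` F" for g
  have B_borel [measurable]: "B g \<in> sets borel" for g
    unfolding B_def using measurable_sets[OF moebius_measurable F] by auto
  have BH: "B g \<subseteq> upper_half_plane" for g using nbhd_subset by (auto simp: B_def)
  have hm [measurable]: "A \<in> sets borel \<Longrightarrow> A \<in> sets hyperbolic_measure" for A by simp
  have "emeasure hyperbolic_measure (nbhd w) = (\<integral>\<^sup>+z. indicator (nbhd w) z \<partial>hyperbolic_measure)"
    by simp
  also have "\<dots> \<le> (\<integral>\<^sup>+z. (\<integral>\<^sup>+g. indicator (B g) z \<partial>count_space \<Gamma>) \<partial>hyperbolic_measure)"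
  proof (rule nn_integral_mono)
    fix z
    show "indicator (nbhd w) z \<le> (\<integral>\<^sup>+g. indicator (B g) z \<partial>count_space \<Gamma>)"
    proof (cases "z \<in> nbhd w")
      case True
      then obtain g where g: "g \<in> \<Gamma>" "moebius g z \<in> F" using rep nbhd_subset by blast
      then have "(1::ennreal) = indicator (B g) z" using True by (simp add: B_def)
      also have "\<dots> \<le> (\<integral>\<^sup>+g. indicator (B g) z \<partial>count_space \<Gamma>)"
        using g(1) by (rule nn_integral_ge_point)
      finally show ?thesis using True by simp
    qed simp
  qed
  also have "\<dots> = (\<integral>\<^sup>+g. (\<integral>\<^sup>+z. indicator (B g) z \<partial>hyperbolic_measure) \<partial>count_space \<Gamma>)"
    by (intro nn_integral_count_space_nn_integral countable_group) auto
  also have "\<dots> = (\<integral>\<^sup>+g. (\<integral>\<^sup>+x. indicator (moebius g ` B g) x \<partial>hyperbolic_measure) \<partial>count_space \<Gamma>)"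
  proof (rule nn_integral_cong)
    fix g assume "g \<in> space (count_space \<Gamma>)"
    then have g: "det g = 1" using det_1 by simp
    have "emeasure hyperbolic_measure (B g) \<le> emeasure hyperbolic_measure (nbhd w)"
      by (intro emeasure_mono) (auto simp: B_def)
    then have "emeasure hyperbolic_measure (B g) < \<infinity>"
      using nbhd_measure_finite[OF w0] by simp
    then have "emeasure hyperbolic_measure (moebius g ` B g) = emeasure hyperbolic_measure (B g)"
      by (intro hyperbolic_measure_moebius g BH B_borel)
    then show "(\<integral>\<^sup>+z. indicator (B g) z \<partial>hyperbolic_measure) = (\<integral>\<^sup>+x. indicator (moebius g ` B g) x \<partial>hyperbolic_measure)"
      using moebius_image_borel[OF g BH B_borel] by simp
  qed
  also have "\<dots> = (\<integral>\<^sup>+x. (\<integral>\<^sup>+g. indicator (moebius g ` B g) x \<partial>count_space \<Gamma>) \<partial>hyperbolic_measure)"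
    by (intro nn_integral_count_space_nn_integral[symmetric] countable_group borel_measurable_indicator hm
        moebius_image_borel BH B_borel det_1)
  also have "\<dots> \<le> (\<integral>\<^sup>+x. of_nat M * indicator (orbit_nbhd F w) x \<partial>hyperbolic_measure)"
  proof (rule nn_integral_mono)
    fix x
    have sub: "{g \<in> \<Gamma>. x \<in> moebius g ` B g} \<subseteq> hits w x"
    proof safe
      fix g z assume gz: "g \<in> \<Gamma>" "z \<in> B g"
      then have "moebius (adj2 g) (moebius g z) = z"
        using moebius_adj2(1)[of g z] det_1 BH by (auto simp: upper_half_plane_def subset_iff)
      then show "g \<in> hits w (moebius g z)" using gz by (simp add: hits_def B_def)
    qed
    show "(\<integral>\<^sup>+g. indicator (moebius g ` B g) x \<partial>count_space \<Gamma>) \<le> of_nat M * indicator (orbit_nbhd F w) x"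
    proof (cases "x \<in> orbit_nbhd F w")
      case True
      then have x: "Im x > 0" using FH by (auto simp: orbit_nbhd_def upper_half_plane_def)
      have "(\<integral>\<^sup>+g. indicator (moebius g ` B g) x \<partial>count_space \<Gamma>)
          = (\<integral>\<^sup>+g. indicator {g \<in> \<Gamma>. x \<in> moebius g ` B g} g \<partial>count_space \<Gamma>)"
        by (intro nn_integral_cong) (auto simp: indicator_def)
      also have "\<dots> = emeasure (count_space \<Gamma>) {g \<in> \<Gamma>. x \<in> moebius g ` B g}"
        by (intro nn_integral_indicator) auto
      also have "\<dots> = of_nat (card {g \<in> \<Gamma>. x \<in> moebius g ` B g})"
        using M[OF x] sub finite_subset by (intro emeasure_count_space_finite) auto
      also have "\<dots> \<le> of_nat M"
        using M[OF x] card_mono[OF _ sub] by (meson le_trans of_nat_mono)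
      finally show ?thesis using True by simp
    next
      case False
      then have "{g \<in> \<Gamma>. x \<in> moebius g ` B g} = {}"
        by (auto simp: orbit_nbhd_def B_def)
      then have "(\<integral>\<^sup>+g. indicator (moebius g ` B g) x \<partial>count_space \<Gamma>) = (\<integral>\<^sup>+g. 0 \<partial>count_space \<Gamma>)"
        by (intro nn_integral_cong) (auto simp: indicator_def)
      then show ?thesis by simp
    qed
  qed
  also have "\<dots> = of_nat M * emeasure hyperbolic_measure (orbit_nbhd F w)"
    by (intro nn_integral_cmult_indicator hm orbit_nbhd_borel F)
  finally show ?thesis .
qed

text \<open>Siegel: a maximal family of thick points with inequivalent neighbourhoods is finite,
  since each neighbourhood takes up a fixed amount of area in the quotient.\<close>

theorem thick_cocompact:
  assumes cofin: "finite_covolume \<Gamma>"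
  obtains K where "compact K" "K \<subseteq> upper_half_plane" "\<And>w. w \<in> thick \<Longrightarrow> \<exists>g\<in>\<Gamma>. moebius g w \<in> K"
proof -
  obtain F where F: "F \<in> sets borel" "F \<subseteq> upper_half_plane"
      "\<forall>z\<in>upper_half_plane. \<exists>!w. w \<in> F \<and> (\<exists>g\<in>\<Gamma>. w = moebius g z)"
      "emeasure hyperbolic_measure F < \<infinity>"
    using cofin by (auto simp: finite_covolume_def)
  have rep: "\<exists>g\<in>\<Gamma>. moebius g z \<in> F" if "z \<in> upper_half_plane" for z
    using F(3) that by metis
  obtain M where M: "\<And>w x. w \<in> thick \<Longrightarrow> Im x > 0 \<Longrightarrow> finite (hits w x) \<and> card (hits w x) \<le> M"
    using hits_card_bound by blast
  define E where "E = orbit_nbhd F"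
  define c where "c = unit_ball_vol 2 / 64"
  have c: "c > 0" by (simp add: c_def)
  have low: "ennreal c \<le> of_nat M * emeasure hyperbolic_measure (E w)" if "w \<in> thick" for w
    using nbhd_measure_lower[of w] nbhd_measure_le[OF F(1,2) rep that M[OF that]] that
    unfolding E_def c_def thick_def by (auto intro: order_trans)
  have Eb: "E w \<in> sets hyperbolic_measure" for w
    using orbit_nbhd_borel[OF F(1)] by (simp add: E_def)
  define good where "good P \<longleftrightarrow> finite P \<and> P \<subseteq> thick \<and> disjoint_family_on E P" for P
  obtain A where A: "emeasure hyperbolic_measure F = ennreal A" "A \<ge> 0"
    using F(4) by (cases "emeasure hyperbolic_measure F") auto
  have bound: "real (card P) * c \<le> M * A" if "good P" for P
  proof -
    have P: "finite P" "P \<subseteq> thick" "disjoint_family_on E P" using that by (auto simp: good_def)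
    have "ennreal (real (card P) * c) = (\<Sum>w\<in>P. ennreal c)"
      using c by (simp add: ennreal_mult ennreal_of_nat_eq_real_of_nat)
    also have "\<dots> \<le> (\<Sum>w\<in>P. of_nat M * emeasure hyperbolic_measure (E w))"
      using P low by (intro sum_mono) auto
    also have "\<dots> = of_nat M * (\<Sum>w\<in>P. emeasure hyperbolic_measure (E w))"
      by (simp add: sum_distrib_left)
    also have "(\<Sum>w\<in>P. emeasure hyperbolic_measure (E w)) = emeasure hyperbolic_measure (\<Union>w\<in>P. E w)"
      using P Eb by (intro sum_emeasure) auto
    also have "of_nat M * \<dots> \<le> of_nat M * emeasure hyperbolic_measure F"
      using F(1) by (intro mult_left_mono emeasure_mono) (auto simp: E_def orbit_nbhd_def)
    also have "\<dots> = ennreal (M * A)"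
      using A by (simp add: ennreal_mult ennreal_of_nat_eq_real_of_nat)
    finally show ?thesis using A by (simp add: ennreal_le_iff)
  qed
  \<comment> \<open>All admissible families have at most \<open>M * A / c\<close> members, so one of
    maximal size exists without an appeal to Zorn's lemma.\<close>
  have "good {}" by (simp add: good_def disjoint_family_on_def)
  moreover have "\<forall>P. good P \<longrightarrow> card P \<le> nat \<lceil>M * A / c\<rceil>"
  proof (intro allI impI)
    fix P assume "good P"
    then have "real (card P) \<le> M * A / c" using bound c by (simp add: pos_le_divide_eq)
    then show "card P \<le> nat \<lceil>M * A / c\<rceil>" by linarith
  qed
  ultimately obtain P where P: "good P" "\<And>Q. good Q \<Longrightarrow> card Q \<le> card P"
    using ex_has_greatest_nat[of good "{}" card "Suc (nat \<lceil>M * A / c\<rceil>)"]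
    by (auto simp: le_imp_less_Suc)
  have P': "finite P" "P \<subseteq> thick" "disjoint_family_on E P" using P by (auto simp: good_def)
  show ?thesis
  proof (rule that[of "\<Union>p\<in>P. big_nbhd p"])
    show "compact (\<Union>p\<in>P. big_nbhd p)"
      using P' compact_big_nbhd by auto
    show "(\<Union>p\<in>P. big_nbhd p) \<subseteq> upper_half_plane"
      using P' by (fastforce simp: big_nbhd_def thick_def upper_half_plane_def)
  next
    fix w assume w: "w \<in> thick"
    have "\<exists>p\<in>P. E w \<inter> E p \<noteq> {}"
    proof (rule ccontr)
      assume no: "\<not> (\<exists>p\<in>P. E w \<inter> E p \<noteq> {})"
      \<comment> \<open>Its area is bounded below by a positive constant. Nonemptiness excludes the
        case that \<open>w\<close> already belongs to \<open>P\<close>.\<close>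
      have "E w \<noteq> {}"
      proof
        assume "E w = {}"
        then show False using low[OF w] c by simp
      qed
      then have "w \<notin> P" using no by auto
      moreover have "good (insert w P)"
        using P' w no by (auto simp: good_def disjoint_family_on_def)
      ultimately show False using P(2)[of "insert w P"] P' by simp
    qed
    then obtain p x where p: "p \<in> P" "x \<in> E w" "x \<in> E p" by blast
    then obtain g h z z' where gh: "g \<in> \<Gamma>" "h \<in> \<Gamma>" "z \<in> nbhd w" "z' \<in> nbhd p" "x = moebius g z" "x = moebius h z'"
      by (auto simp: E_def orbit_nbhd_def)
    define k where "k = adj2 h ** g"
    have kG: "k \<in> \<Gamma>" using gh by (auto simp: k_def intro: mult_mem adj2_mem)
    have pos: "Im w > 0" "Im p > 0" "Im z > 0" "Im z' > 0"
      using w p P' gh by (auto simp: thick_def nbhd_def)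
    have dets: "det g = 1" "det h = 1" "det k = 1" using gh kG det_1 by auto
    have "moebius k z = moebius (adj2 h) (moebius g z)"
      using pos dets by (simp add: k_def moebius_mult aut_j_nonzero)
    also have "\<dots> = z'" using gh pos dets by (metis moebius_adj2(1))
    finally have kz: "moebius k z = z'" .
    \<comment> \<open>\<open>z'\<close> lies in the neighbourhoods of both \<open>p\<close> and
      \<open>moebius k w\<close>, which puts the second centre into
      \<open>big_nbhd p\<close>.\<close>
    have "ptinv z' (moebius k w) = ptinv z w"
      using ptinv_moebius[OF dets(3) pos(3,1)] by (simp add: kz)
    then have "z' \<in> nbhd (moebius k w)" using gh pos by (simp add: nbhd_def)
    then have "moebius k w \<in> big_nbhd p"
      using pos gh dets by (intro big_nbhdI[of _ _ z'] Im_moebius_pos) auto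
    then show "\<exists>g\<in>\<Gamma>. moebius g w \<in> (\<Union>p\<in>P. big_nbhd p)" using kG p by blast
  qed
qed

text \<open>The tube bounds depend on the element, so only finitely many elements may be used. An
  element \<open>g\<close> that is small at a thin point is also small at some thick
  \<open>w\<close>; moving \<open>w\<close> into the compact set \<open>K\<close> conjugates
  \<open>g\<close> to an element that is small somewhere in \<open>K\<close>, and by proper
  discontinuity there are finitely many of these.\<close>

theorem invariant_bounded:
  fixes \<phi> :: "complex \<Rightarrow> real"
  assumes cofin: "finite_covolume \<Gamma>"
    and cont: "continuous_on upper_half_plane \<phi>"
    and inv: "\<And>g z. g \<in> \<Gamma> \<Longrightarrow> Im z > 0 \<Longrightarrow> \<phi> (moebius g z) = \<phi> z"
    and tube: "\<And>g. g \<in> \<Gamma> \<Longrightarrow> \<not> central g \<Longrightarrow> \<exists>C. \<forall>z. Im z > 0 \<longrightarrow> eta2 g z \<le> 1/100 \<longrightarrow> \<phi> z \<le> C"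
  obtains C where "\<And>z. Im z > 0 \<Longrightarrow> \<phi> z \<le> C"
proof -
  obtain K where K: "compact K" "K \<subseteq> upper_half_plane" "\<And>w. w \<in> thick \<Longrightarrow> \<exists>g\<in>\<Gamma>. moebius g w \<in> K"
    using thick_cocompact[OF cofin] by blast
  have "compact (\<phi> ` K)" using K cont by (intro compact_continuous_image) (auto intro: continuous_on_subset)
  then obtain C0 where C0: "\<And>z. z \<in> K \<Longrightarrow> \<phi> z \<le> C0"
    using compact_imp_bounded bounded_iff by (metis image_eqI real_norm_def abs_le_D1)
  define S where "S = {g \<in> \<Gamma>. \<exists>z\<in>K. eta2 g z \<le> 1/100}"
  have S: "finite S" unfolding S_def using K by (intro finite_eta2_le)
  obtain t where t: "\<And>g z. g \<in> \<Gamma> \<Longrightarrow> \<not> central g \<Longrightarrow> Im z > 0 \<Longrightarrow> eta2 g z \<le> 1/100 \<Longrightarrow> \<phi> z \<le> t g"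
    using tube by metis
  show ?thesis
  proof (rule that[of "max C0 (Max (insert 0 (t ` S)))"])
    fix z assume z: "Im z > 0"
    show "\<phi> z \<le> max C0 (Max (insert 0 (t ` S)))"
    proof (cases "z \<in> thick")
      case True
      then obtain g where "g \<in> \<Gamma>" "moebius g z \<in> K" using K(3) by blast
      then have "\<phi> z \<le> C0" using C0 inv z by metis
      then show ?thesis by simp
    next
      case False
      then obtain g w where g: "g \<in> \<Gamma>" "\<not> central g" "eta2 g z \<le> 1/100" "w \<in> thick" "eta2 g w \<le> 1/100"
        using thin_to_thick z by blast
      obtain h where h: "h \<in> \<Gamma>" "moebius h w \<in> K" using K(3) g by blast
      define g' where "g' = h ** g ** adj2 h"
      have g': "g' \<in> \<Gamma>" using g h by (auto simp: g'_def intro: mult_mem adj2_mem)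
      have dets: "det g = 1" "det h = 1" using g h det_1 by auto
      have w0: "Im w > 0" using g by (simp add: thick_def)
      have e: "eta2 g' (moebius h z) \<le> 1/100" "eta2 g' (moebius h w) \<le> 1/100"
        using g dets z w0 by (simp_all add: g'_def eta2_moebius)
      have "\<not> central g'"
      proof
        assume "central g'"
        moreover have "adj2 h ** g' ** h = (adj2 h ** h) ** g ** (adj2 h ** h)"
          by (simp add: g'_def matrix_mul_assoc)
        then have "g = adj2 h ** g' ** h" using dets by (simp add: adj2_mult)
        moreover have "adj2 h ** mat (-1) ** h = mat (-1)"
          using dets by (auto simp: mat2_eq_iff entry_mult det_2 algebra_simps)
        ultimately have "central g" using dets by (auto simp: central_def adj2_mult)
        with g show False by simp
      qed
      then have "\<phi> (moebius h z) \<le> t g'"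
        using g' e dets z by (intro t Im_moebius_pos) auto
      moreover have "g' \<in> S" using g' e h by (auto simp: S_def)
      ultimately have "\<phi> z \<le> Max (insert 0 (t ` S))"
        using inv[OF h(1) z] S by (metis Max_ge finite.insertI finite_imageI image_eqI insertI2 order_trans)
      then show ?thesis by simp
    qed
  qed
qed

end

section \<open>Fourier expansions at a cusp\<close>

lemma e2pi_add: "e2pi (z + w) = e2pi z * e2pi w"
  by (simp add: e2pi_def exp_add algebra_simps)

lemma e2pi_of_int [simp]: "e2pi (of_int n) = 1"
  using exp_integer_2pi[of "of_int n"] by (simp add: e2pi_def mult_ac)

lemma e2pi_of_nat_mult: "e2pi (of_nat n * z) = e2pi z ^ n"
  by (simp add: e2pi_def mult_ac flip: exp_of_nat_mult)

lemma norm_e2pi: "cmod (e2pi z) = exp (- 2 * pi * Im z)"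
  by (simp add: e2pi_def)

lemma e2pi_nonzero [simp]: "e2pi z \<noteq> 0"
  by (simp add: e2pi_def)

lemma e2pi_Ln:
  assumes "q \<noteq> 0" shows "e2pi (Ln q / (2 * of_real pi * \<i>)) = q"
  using assms by (simp add: e2pi_def)

lemma e2pi_eq_imp:
  assumes "e2pi z = e2pi w" obtains n :: int where "z = w + of_int n"
proof -
  obtain n :: int where "2 * of_real pi * \<i> * z = 2 * of_real pi * \<i> * w + (of_int (2 * n) * pi) * \<i>"
    using assms unfolding e2pi_def exp_eq by blast
  then have "2 * of_real pi * \<i> * z = 2 * of_real pi * \<i> * (w + of_int n)"
    by (simp add: algebra_simps)
  then have "z = w + of_int n" by simp
  then show ?thesis using that by blast
qed

lemma Im_gt_0_of_e2pi:
  assumes "e2pi z = q" "cmod q < 1" shows "Im z > 0"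
  using assms by (auto simp: norm_e2pi zero_less_mult_iff)

text \<open>\<open>g\<close> factors through \<open>q = e2pi z\<close>. Holomorphy away from 0 is
  checked on two slit discs that cover the punctured disc, each with its own logarithm, and the
  limit at infinity makes 0 a removable singularity with value 0.\<close>

lemma periodic_factor:
  assumes hol: "g holomorphic_on upper_half_plane"
    and per: "\<And>z. Im z > 0 \<Longrightarrow> g (z + 1) = g z"
    and lim: "(g \<longlongrightarrow> 0) (filtercomap Im at_top)"
  obtains F where "F holomorphic_on ball 0 1" "F 0 = 0" "\<And>z. Im z > 0 \<Longrightarrow> g z = F (e2pi z)"
proof -
  have per_nat: "g (z + of_nat n) = g z" if "Im z > 0" for z n
    using that
  proof (induction n)
    case (Suc n)
    have "g (z + of_nat (Suc n)) = g ((z + of_nat n) + 1)" by (simp add: add_ac)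
    also have "\<dots> = g z" using per[of "z + of_nat n"] Suc by simp
    finally show ?case .
  qed simp
  have per_int: "g (z + of_int n) = g z" if "Im z > 0" for z n
  proof (cases "n \<ge> 0")
    case True
    then show ?thesis using per_nat[OF that, of "nat n"] by (simp add: of_nat_nat)
  next
    case False
    then have "of_nat (nat (- n)) = (- of_int n :: complex)" by simp
    then show ?thesis using per_nat[of "z + of_int n" "nat (- n)"] that by simp
  qed
  define F where "F q = (if q = 0 then 0 else g (Ln q / (2 * of_real pi * \<i>)))" for q
  have Fg: "g z = F (e2pi z)" if "Im z > 0" for z
  proof -
    have "e2pi (Ln (e2pi z) / (2 * of_real pi * \<i>)) = e2pi z" by (simp add: e2pi_Ln)
    then obtain n where n: "Ln (e2pi z) / (2 * of_real pi * \<i>) = z + of_int n" by (rule e2pi_eq_imp)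
    then show ?thesis using per_int[OF that, of n] by (simp add: F_def)
  qed
  define A1 where "A1 = {q. cmod q < 1 \<and> q \<notin> \<real>\<^sub>\<le>\<^sub>0}"
  define A2 where "A2 = {q. cmod q < 1 \<and> - q \<notin> \<real>\<^sub>\<le>\<^sub>0}"
  have A1: "A1 = ball 0 1 \<inter> - \<real>\<^sub>\<le>\<^sub>0" by (auto simp: A1_def)
  have A2: "A2 = ball 0 1 \<inter> uminus -` (- \<real>\<^sub>\<le>\<^sub>0)" by (auto simp: A2_def)
  have o1: "open A1" unfolding A1 by (intro open_Int open_ball open_Compl closed_nonpos_Reals_complex)
  have o2: "open A2" unfolding A2
    by (intro open_Int open_ball open_vimage continuous_intros) (simp add: open_Compl)
  have h1: "F holomorphic_on A1"
  proof -
    have "(g \<circ> (\<lambda>q. Ln q / (2 * of_real pi * \<i>))) holomorphic_on A1"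
    proof (rule holomorphic_on_compose_gen[OF _ hol])
      show "(\<lambda>q. Ln q / (2 * of_real pi * \<i>)) holomorphic_on A1"
        by (intro holomorphic_intros) (auto simp: A1_def)
      show "(\<lambda>q. Ln q / (2 * of_real pi * \<i>)) ` A1 \<subseteq> upper_half_plane"
      proof safe
        fix q assume q: "q \<in> A1"
        then have "q \<noteq> 0" by (auto simp: A1_def)
        then show "Ln q / (2 * of_real pi * \<i>) \<in> upper_half_plane"
          using Im_gt_0_of_e2pi[OF e2pi_Ln] q by (simp add: upper_half_plane_def A1_def)
      qed
    qed
    moreover have "F q = (g \<circ> (\<lambda>q. Ln q / (2 * of_real pi * \<i>))) q" if "q \<in> A1" for q
      using that by (auto simp: F_def A1_def)
    ultimately show ?thesis using holomorphic_transform by metis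
  qed
  \<comment> \<open>On the second slit disc the logarithm of \<open>- q\<close> is used; the half
    period compensates the sign because \<open>e2pi (1/2) = -1\<close>.\<close>
  have half: "e2pi (Ln (- q) / (2 * of_real pi * \<i>) + 1/2) = q" if "q \<noteq> 0" for q
  proof -
    have "e2pi (1/2) = -1" by (simp add: e2pi_def mult.commute)
    then show ?thesis using that by (simp add: e2pi_add e2pi_Ln)
  qed
  have h2: "F holomorphic_on A2"
  proof -
    have im: "Im (Ln (- q) / (2 * of_real pi * \<i>) + 1/2) > 0" if "q \<in> A2" for q
    proof -
      have "q \<noteq> 0" "cmod q < 1" using that by (auto simp: A2_def)
      then show ?thesis using Im_gt_0_of_e2pi[OF half, of q] by blast
    qed
    have "(g \<circ> (\<lambda>q. Ln (- q) / (2 * of_real pi * \<i>) + 1/2)) holomorphic_on A2"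
    proof (rule holomorphic_on_compose_gen[OF _ hol])
      show "(\<lambda>q. Ln (- q) / (2 * of_real pi * \<i>) + 1/2) holomorphic_on A2"
        by (intro holomorphic_intros) (auto simp: A2_def)
      show "(\<lambda>q. Ln (- q) / (2 * of_real pi * \<i>) + 1/2) ` A2 \<subseteq> upper_half_plane"
        using im by (auto simp: upper_half_plane_def)
    qed
    moreover have "(g \<circ> (\<lambda>q. Ln (- q) / (2 * of_real pi * \<i>) + 1/2)) q = F q" if "q \<in> A2" for q
    proof -
      have "q \<noteq> 0" using that by (auto simp: A2_def)
      then show ?thesis using Fg[OF im[OF that]] half[of q] by simp
    qed
    ultimately show ?thesis using holomorphic_transform by metis
  qed
  have "ball 0 1 - {0} = A1 \<union> A2"
  proof (intro equalityI subsetI)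
    fix q :: complex assume q: "q \<in> ball 0 1 - {0}"
    then have "q \<notin> \<real>\<^sub>\<le>\<^sub>0 \<or> - q \<notin> \<real>\<^sub>\<le>\<^sub>0"
      by (auto simp: complex_nonpos_Reals_iff complex_eq_iff)
    then show "q \<in> A1 \<union> A2" using q by (auto simp: A1_def A2_def)
  qed (auto simp: A1_def A2_def)
  then have punct: "F holomorphic_on ball 0 1 - {0}"
    using holomorphic_on_Un[OF h1 h2 o1 o2] by simp
  have F0: "(F \<longlongrightarrow> F 0) (at 0)"
  proof (rule LIM_I)
    fix r :: real assume r: "r > 0"
    have "eventually (\<lambda>z. cmod (g z) < r) (filtercomap Im at_top)"
      using tendstoD[OF lim r] by simp
    then obtain Y where Y: "\<And>z. Im z \<ge> Y \<Longrightarrow> cmod (g z) < r"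
      by (auto simp: eventually_filtercomap_at_top_linorder)
    show "\<exists>s>0. \<forall>q. q \<noteq> 0 \<and> norm (q - 0) < s \<longrightarrow> norm (F q - F 0) < r"
    proof (intro exI conjI allI impI)
      show "exp (- 2 * pi * Y) > 0" by simp
      fix q :: complex assume q: "q \<noteq> 0 \<and> norm (q - 0) < exp (- 2 * pi * Y)"
      define z where "z = Ln q / (2 * of_real pi * \<i>)"
      have "exp (- 2 * pi * Im z) < exp (- 2 * pi * Y)"
        using q e2pi_Ln[of q] norm_e2pi[of z] by (simp add: z_def)
      then have "Im z \<ge> Y" by simp
      then show "norm (F q - F 0) < r" using Y q by (simp add: F_def z_def)
    qed
  qed
  show ?thesis
  proof (rule that[of F])
    show "F holomorphic_on ball 0 1"
    proof (rule no_isolated_singularity'[where K = "{0}"])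
      show "(F \<longlongrightarrow> F z) (at z within ball 0 1)" if "z \<in> {0}" for z
        using that tendsto_mono[OF at_le[OF subset_UNIV] F0] by simp
    qed (use punct in auto)
  qed (use Fg in \<open>auto simp: F_def\<close>)
qed

text \<open>After rescaling to period 1 the factor \<open>F\<close> vanishes at 0, so it is at most
  a constant times \<open>|q|\<close> on a closed disc, and \<open>|q|\<close> is the stated
  exponential.\<close>

lemma periodic_decay:
  assumes hol: "g holomorphic_on upper_half_plane"
    and w: "w > 0" and per: "\<And>z. Im z > 0 \<Longrightarrow> g (z + of_real w) = g z"
    and lim: "(g \<longlongrightarrow> 0) (filtercomap Im at_top)" and Y: "Y > 0"
  obtains C where "C \<ge> 0" "\<And>z. Im z \<ge> Y \<Longrightarrow> cmod (g z) \<le> C * exp (- 2 * pi * Im z / w)"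
proof -
  define g' where "g' z = g (of_real w * z)" for z
  have "(g \<circ> (\<lambda>z. of_real w * z)) holomorphic_on upper_half_plane"
    by (rule holomorphic_on_compose_gen[OF _ hol]) (use w in \<open>auto intro!: holomorphic_intros simp: upper_half_plane_def\<close>)
  then have hol': "g' holomorphic_on upper_half_plane" by (simp add: g'_def[abs_def] o_def)
  have per': "g' (z + 1) = g' z" if "Im z > 0" for z
    using per[of "of_real w * z"] that w by (simp add: g'_def algebra_simps)
  have lim': "(g' \<longlongrightarrow> 0) (filtercomap Im at_top)"
  proof (rule tendstoI)
    fix r :: real assume "r > 0"
    then obtain B where B: "\<And>z. Im z \<ge> B \<Longrightarrow> dist (g z) 0 < r"
      using tendstoD[OF lim] by (auto simp: eventually_filtercomap_at_top_linorder)
    have "dist (g' z) 0 < r" if "Im z \<ge> B / w" for z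
      using that w B[of "of_real w * z"] by (simp add: g'_def field_simps)
    then show "eventually (\<lambda>z. dist (g' z) 0 < r) (filtercomap Im at_top)"
      by (auto simp: eventually_filtercomap_at_top_linorder)
  qed
  obtain F where F: "F holomorphic_on ball 0 1" "F 0 = 0" "\<And>z. Im z > 0 \<Longrightarrow> g' z = F (e2pi z)"
    using periodic_factor[OF hol' per' lim'] by blast
  define \<rho> where "\<rho> = exp (- 2 * pi * Y / w)"
  have \<rho>: "0 < \<rho>" "\<rho> < 1" using Y w by (auto simp: \<rho>_def)
  have sub: "cball (0::complex) \<rho> \<subseteq> ball 0 1" using \<rho> by auto
  have "continuous_on (cball 0 \<rho>) (deriv F)"
    using holomorphic_deriv[OF F(1) open_ball] sub
    by (meson continuous_on_subset holomorphic_on_imp_continuous_on)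
  then have "bounded (deriv F ` cball 0 \<rho>)"
    by (intro compact_imp_bounded compact_continuous_image compact_cball)
  then obtain C where C: "\<And>q. q \<in> cball 0 \<rho> \<Longrightarrow> cmod (deriv F q) \<le> C"
    unfolding bounded_iff by blast
  have bd: "cmod (F q) \<le> C * cmod q" if "q \<in> cball 0 \<rho>" for q
  proof -
    have "cmod (F q - F 0) \<le> C * cmod (q - 0)"
    proof (rule field_differentiable_bound[of "cball 0 \<rho>" F "deriv F"])
      show "(F has_field_derivative deriv F z) (at z within cball 0 \<rho>)" if "z \<in> cball 0 \<rho>" for z
        using F(1) that sub holomorphic_derivI[OF F(1) open_ball] by blast
    qed (use C that \<rho> in auto)
    then show ?thesis using F(2) by simp
  qed
  have "cmod (deriv F 0) \<le> C" using C[of 0] \<rho> by auto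
  then have C0: "C \<ge> 0" using norm_ge_zero order_trans by blast
  show ?thesis
  proof (rule that[OF C0])
    fix z assume z: "Im z \<ge> Y"
    define z' where "z' = z / of_real w"
    have z': "Im z' = Im z / w" "g z = g' z'" using w by (auto simp: z'_def g'_def)
    have "Im z' > 0" using z' z Y w by simp
    then have "g z = F (e2pi z')" using z' F(3) by simp
    moreover have "cmod (e2pi z') = exp (- 2 * pi * Im z / w)" by (simp add: norm_e2pi z')
    moreover have "exp (- 2 * pi * Im z / w) \<le> \<rho>" using z w by (simp add: \<rho>_def divide_right_mono)
    ultimately show "cmod (g z) \<le> C * exp (- 2 * pi * Im z / w)"
      using bd[of "e2pi z'"] by simp
  qed
qed

text \<open>If the coefficients differed, the difference series would have isolated zeros, yet it
  vanishes on the whole disc. The point 0 is not of the form \<open>e2pi z\<close>, so agreement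
  there is taken from the constant coefficients.\<close>

lemma power_series_eqI:
  fixes a b :: "nat \<Rightarrow> complex"
  assumes a: "\<And>q. cmod q < 1 \<Longrightarrow> q \<noteq> 0 \<Longrightarrow> (\<lambda>n. a n * q ^ n) sums F q"
    and b: "\<And>q. cmod q < 1 \<Longrightarrow> q \<noteq> 0 \<Longrightarrow> (\<lambda>n. b n * q ^ n) sums F q" and "a 0 = b 0"
  shows "a = b"
proof (rule ccontr)
  assume "a \<noteq> b"
  then obtain m where m: "a m \<noteq> b m" by blast
  then have "m > 0" using assms(3) by (cases m) auto
  have s: "(\<lambda>n. (a n - b n) * (q - 0) ^ n) sums 0" if "cmod (q - 0) < 1" for q
  proof (cases "q = 0")
    case True
    then show ?thesis using assms(3) powser_sums_zero[of "\<lambda>n. a n - b n"] by simp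
  next
    case False
    then show ?thesis using sums_diff[OF a b, of q q] that by (simp add: algebra_simps)
  qed
  obtain s where s: "s > 0" "\<And>z::complex. z \<in> cball 0 s - {0} \<Longrightarrow> (0::complex) \<noteq> 0"
    using powser_0_nonzero[of 1 0 "\<lambda>n. a n - b n" "\<lambda>_. 0" m, OF _ s] m \<open>m > 0\<close> by auto
  have "of_real s \<in> cball (0::complex) s - {0}" using s by simp
  then show False using s by blast
qed

lemma sums_F_of_fourier:
  assumes "\<And>z. Im z > 0 \<Longrightarrow> (\<lambda>n. a n * e2pi (of_nat n * z)) sums g z" "\<And>z. Im z > 0 \<Longrightarrow> g z = F (e2pi z)"
    and "cmod q < 1" "q \<noteq> 0"
  shows "(\<lambda>n. a n * q ^ n) sums F q"
proof -
  define z where "z = Ln q / (2 * of_real pi * \<i>)"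
  have z: "e2pi z = q" using assms by (simp add: z_def e2pi_Ln)
  then have "Im z > 0" using Im_gt_0_of_e2pi assms by blast
  then show ?thesis using assms(1)[of z] assms(2)[of z] z by (simp add: e2pi_of_nat_mult)
qed

text \<open>The Taylor coefficients of the factor at 0 satisfy the defining condition, and
  uniqueness of power series makes the definite description in \<open>fourier_coeff\<close> denote
  them.\<close>

theorem fourier_expansion:
  assumes hol: "g holomorphic_on upper_half_plane"
    and per: "\<And>z. Im z > 0 \<Longrightarrow> g (z + 1) = g z"
    and lim: "(g \<longlongrightarrow> 0) (filtercomap Im at_top)"
  shows "fourier_coeff g 0 = 0"
    and "\<And>z. Im z > 0 \<Longrightarrow> (\<lambda>n. fourier_coeff g n * e2pi (of_nat n * z)) sums g z"
proof -
  obtain F where F: "F holomorphic_on ball 0 1" "F 0 = 0" "\<And>z. Im z > 0 \<Longrightarrow> g z = F (e2pi z)"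
    using periodic_factor[OF assms] by blast
  define a where "a n = (deriv ^^ n) F 0 / fact n" for n
  have a: "(\<lambda>n. a n * q ^ n) sums F q" if "cmod q < 1" for q
    using holomorphic_power_series[OF F(1), of q] that by (simp add: a_def)
  define P where "P a \<longleftrightarrow> a 0 = 0 \<and> (\<forall>z\<in>upper_half_plane. (\<lambda>n. a n * e2pi (of_nat n * z)) sums g z)" for a
  have "P a"
    unfolding P_def
  proof (intro conjI ballI)
    show "a 0 = 0" using F by (simp add: a_def)
    fix z assume z: "z \<in> upper_half_plane"
    then have "cmod (e2pi z) < 1" by (simp add: norm_e2pi upper_half_plane_def)
    then show "(\<lambda>n. a n * e2pi (of_nat n * z)) sums g z"
      using a[of "e2pi z"] F(3) z by (simp add: e2pi_of_nat_mult upper_half_plane_def)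
  qed
  moreover have "b = a" if "P b" for b
  proof (rule power_series_eqI[of b F a])
    show "(\<lambda>n. b n * q ^ n) sums F q" if "cmod q < 1" "q \<noteq> 0" for q
      using \<open>P b\<close> F(3) that by (intro sums_F_of_fourier) (auto simp: P_def upper_half_plane_def)
    show "b 0 = a 0" using \<open>P a\<close> \<open>P b\<close> by (simp add: P_def)
  qed (use a in auto)
  ultimately have "P (THE a. P a)" by (metis theI)
  moreover have "fourier_coeff g = (THE a. P a)" unfolding fourier_coeff_def P_def ..
  ultimately have "P (fourier_coeff g)" by simp
  then show "fourier_coeff g 0 = 0" "\<And>z. Im z > 0 \<Longrightarrow> (\<lambda>n. fourier_coeff g n * e2pi (of_nat n * z)) sums g z"
    by (auto simp: P_def upper_half_plane_def)
qed

section \<open>Mean squares of the coefficients\<close>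

lemma sum_roots_of_unity:
  fixes L :: nat and n m :: nat
  assumes "n < L" "m < L"
  shows "(\<Sum>j<L. e2pi (of_nat j * of_real ((real n - real m) / real L))) = (if n = m then of_nat L else 0)"
proof (cases "n = m")
  case True
  then show ?thesis by (simp add: e2pi_def)
next
  case False
  define x where "x = e2pi (of_real ((real n - real m) / real L))"
  have L: "real L > 0" using assms by simp
  have "x \<noteq> 1"
  proof
    assume "x = 1"
    then have "e2pi (of_real ((real n - real m) / real L)) = e2pi 0" by (simp add: x_def e2pi_def)
    then obtain k :: int where "complex_of_real ((real n - real m) / real L) = 0 + of_int k" by (rule e2pi_eq_imp)
    then have "Re (complex_of_real ((real n - real m) / real L)) = Re (of_int k)" by (metis add_0)
    then have "(real n - real m) / real L = of_int k" by (simp only: Re_complex_of_real complex_Re_of_int)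
    then have "real n - real m = of_int k * real L" using L by (simp add: field_simps)
    then have "int n - int m = k * int L" by (metis of_int_diff of_int_eq_iff of_int_mult of_int_of_nat_eq)
    then have "int L dvd int n - int m" by simp
    moreover have "\<bar>int n - int m\<bar> < int L" "int n - int m \<noteq> 0" using assms False by auto
    ultimately show False using zdvd_imp_le[of "int L" "\<bar>int n - int m\<bar>"] by simp
  qed
  have "x ^ L = e2pi (of_nat L * of_real ((real n - real m) / real L))"
    unfolding x_def e2pi_of_nat_mult ..
  also have "of_nat L * complex_of_real ((real n - real m) / real L) = of_int (int n - int m)"
    using assms by simp
  finally have "x ^ L = 1" by (simp only: e2pi_of_int)
  then have "(\<Sum>j<L. x ^ j) = 0" using \<open>x \<noteq> 1\<close> by (simp add: sum_gp_strict)
  then show ?thesis using False by (simp add: x_def e2pi_of_nat_mult del: of_real_divide of_real_diff)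
qed

text \<open>Parseval for the cyclic group of order \<open>L\<close>: equally spaced sample points
  stand in for an integral over one period.\<close>

lemma discrete_parseval:
  fixes c :: "nat \<Rightarrow> complex"
  assumes L: "L > 0"
  shows "(\<Sum>j<L. (cmod (\<Sum>n<L. c n * e2pi (of_nat n * of_real (real j / real L))))\<^sup>2) = real L * (\<Sum>n<L. (cmod (c n))\<^sup>2)"
proof -
  define t :: "nat \<Rightarrow> nat \<Rightarrow> complex" where "t j n = of_nat n * of_real (real j / real L)" for j n
  have cnj: "cnj (e2pi (t j n)) = e2pi (- t j n)" for j n
    by (simp add: e2pi_def exp_cnj t_def)
  have t: "e2pi (t j n) * e2pi (- t j m) = e2pi (of_nat j * of_real ((real n - real m) / real L))" for j n m
    unfolding e2pi_add[symmetric] by (simp add: t_def algebra_simps diff_divide_distrib)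
  have "complex_of_real (\<Sum>j<L. (cmod (\<Sum>n<L. c n * e2pi (t j n)))\<^sup>2)
     = (\<Sum>j<L. (\<Sum>n<L. c n * e2pi (t j n)) * cnj (\<Sum>n<L. c n * e2pi (t j n)))"
    unfolding of_real_sum complex_norm_square ..
  also have "\<dots> = (\<Sum>j<L. (\<Sum>n<L. c n * e2pi (t j n)) * (\<Sum>n<L. cnj (c n) * e2pi (- t j n)))"
    by (simp add: cnj)
  also have "\<dots> = (\<Sum>j<L. \<Sum>n<L. \<Sum>m<L. c n * cnj (c m) * e2pi (of_nat j * of_real ((real n - real m) / real L)))"
    unfolding sum_product t[symmetric] by (simp only: mult_ac)
  also have "\<dots> = (\<Sum>n<L. \<Sum>j<L. \<Sum>m<L. c n * cnj (c m) * e2pi (of_nat j * of_real ((real n - real m) / real L)))"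
    by (rule sum.swap)
  also have "\<dots> = (\<Sum>n<L. \<Sum>m<L. \<Sum>j<L. c n * cnj (c m) * e2pi (of_nat j * of_real ((real n - real m) / real L)))"
    by (intro sum.cong refl sum.swap)
  also have "\<dots> = (\<Sum>n<L. \<Sum>m<L. c n * cnj (c m) * (if n = m then of_nat L else 0))"
    by (intro sum.cong refl) (simp add: sum_roots_of_unity del: of_real_divide of_real_diff flip: sum_distrib_left)
  also have "\<dots> = (\<Sum>n<L. of_nat L * of_real ((cmod (c n))\<^sup>2))"
  proof (intro sum.cong refl)
    fix n assume "n \<in> {..<L}"
    then have "(\<Sum>m<L. c n * cnj (c m) * (if n = m then of_nat L else 0)) = of_nat L * (c n * cnj (c n))"
      by (simp add: if_distrib sum.delta cong: if_cong)
    then show "(\<Sum>m<L. c n * cnj (c m) * (if n = m then of_nat L else 0)) = of_nat L * of_real ((cmod (c n))\<^sup>2)"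
      by (simp only: complex_norm_square)
  qed
  also have "\<dots> = complex_of_real (real L * (\<Sum>n<L. (cmod (c n))\<^sup>2))"
    by (simp add: sum_distrib_left)
  finally show ?thesis unfolding t_def by (simp only: of_real_eq_iff)
qed

text \<open>The partial sum of length \<open>L\<close> is sampled at exactly \<open>L\<close>
  points, so there is no aliasing; it is bounded by \<open>M\<close> plus the tail
  \<open>\<delta> L\<close>, which tends to 0.\<close>

lemma bessel_fourier:
  assumes a: "\<And>x. (\<lambda>n. c n * e2pi (of_nat n * of_real x)) sums G x"
    and abs: "summable (\<lambda>n. cmod (c n))" and bd: "\<And>x. cmod (G x) \<le> M"
  shows "(\<Sum>n<N. (cmod (c n))\<^sup>2) \<le> M\<^sup>2"
proof -
  define \<delta> where "\<delta> L = (\<Sum>n. cmod (c (n + L)))" for L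
  have ne: "cmod (e2pi (of_nat n * of_real x)) = 1" for n x
    by (simp add: norm_e2pi)
  have part: "cmod (\<Sum>n<L. c n * e2pi (of_nat n * of_real x)) \<le> M + \<delta> L" for L x
  proof -
    have sm: "summable (\<lambda>n. c (n + L) * e2pi (of_nat (n + L) * of_real x))"
      using sums_summable[OF a[of x]] summable_ignore_initial_segment by fastforce
    have "G x = (\<Sum>n. c (n + L) * e2pi (of_nat (n + L) * of_real x)) + (\<Sum>n<L. c n * e2pi (of_nat n * of_real x))"
      using suminf_split_initial_segment[OF sums_summable[OF a[of x]], of L] sums_unique[OF a[of x]] by simp
    then have "cmod (\<Sum>n<L. c n * e2pi (of_nat n * of_real x)) \<le> cmod (G x) + cmod (\<Sum>n. c (n + L) * e2pi (of_nat (n + L) * of_real x))"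
      using norm_triangle_ineq4[of "G x" "\<Sum>n. c (n + L) * e2pi (of_nat (n + L) * of_real x)"] by simp
    also have "cmod (\<Sum>n. c (n + L) * e2pi (of_nat (n + L) * of_real x)) \<le> (\<Sum>n. cmod (c (n + L) * e2pi (of_nat (n + L) * of_real x)))"
      by (rule summable_norm) (use summable_ignore_initial_segment[OF abs, of L] ne in \<open>simp add: norm_mult del: of_nat_add\<close>)
    also have "\<dots> = \<delta> L" unfolding \<delta>_def by (simp add: norm_mult ne del: of_nat_add)
    finally show ?thesis using bd[of x] by simp
  qed
  have le: "(\<Sum>n<N. (cmod (c n))\<^sup>2) \<le> (M + \<delta> L)\<^sup>2" if "L \<ge> max N 1" for L
  proof -
    have L: "L > 0" using that by simp
    have "real L * (\<Sum>n<L. (cmod (c n))\<^sup>2) \<le> (\<Sum>j<L. (M + \<delta> L)\<^sup>2)"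
      unfolding discrete_parseval[OF L, symmetric]
      by (intro sum_mono power_mono part norm_ge_zero)
    then have "(\<Sum>n<L. (cmod (c n))\<^sup>2) \<le> (M + \<delta> L)\<^sup>2" using L by simp
    moreover have "(\<Sum>n<N. (cmod (c n))\<^sup>2) \<le> (\<Sum>n<L. (cmod (c n))\<^sup>2)"
      using that by (intro sum_mono2) auto
    ultimately show ?thesis by simp
  qed
  have "\<delta> \<longlonglongrightarrow> 0"
    unfolding \<delta>_def using suminf_exist_split2[OF abs] .
  then have "(\<lambda>L. (M + \<delta> L)\<^sup>2) \<longlonglongrightarrow> (M + 0)\<^sup>2" by (intro tendsto_intros)
  then have "(\<Sum>n<N. (cmod (c n))\<^sup>2) \<le> (M + 0)\<^sup>2"
    by (rule LIMSEQ_le_const) (use le in blast)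
  then show ?thesis by simp
qed

text \<open>Cauchy-Schwarz on the block from \<open>2^j\<close> to \<open>2^(j+1)\<close> costs a
  factor \<open>2^(j/2)\<close>, so the block contributes at most a constant times
  \<open>\<theta>^j\<close> with \<open>\<theta> = 2 powr ((k+1)/2 - s) < 1\<close>.\<close>

lemma summable_dyadic:
  fixes b :: "nat \<Rightarrow> real"
  assumes nn: "\<And>n. b n \<ge> 0" and C: "C \<ge> 0"
    and sq: "\<And>N. N > 0 \<Longrightarrow> (\<Sum>n<N. (b n)\<^sup>2) \<le> C * real N ^ k" and s: "s > (real k + 1) / 2"
  shows "summable (\<lambda>n. b n * real n powr (- s))"
proof -
  define \<theta> where "\<theta> = 2 powr ((real k + 1) / 2 - s)"
  have \<theta>: "0 < \<theta>" "\<theta> < 1" using s by (auto simp: \<theta>_def powr_less_one)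
  define D where "D = sqrt (C * 2 ^ k)"
  have block: "(\<Sum>n=2^j..<2^Suc j. b n * real n powr (- s)) \<le> D * \<theta> ^ j" for j :: nat
  proof -
    let ?I = "{2^j..<2^Suc j :: nat}"
    have s0: "s > 0" using s by (smt (verit) divide_nonneg_nonneg of_nat_0_le_iff)
    have "(\<Sum>n\<in>?I. b n)\<^sup>2 \<le> (\<Sum>n\<in>?I. (b n)\<^sup>2) * (\<Sum>n\<in>?I. 1\<^sup>2)"
      using Cauchy_Schwarz_ineq_sum[of b "\<lambda>_. 1" ?I] by simp
    also have "\<dots> \<le> (C * real (2^Suc j) ^ k) * 2 ^ j"
    proof (rule mult_mono)
      have "(\<Sum>n\<in>?I. (b n)\<^sup>2) \<le> (\<Sum>n<2^Suc j. (b n)\<^sup>2)" by (intro sum_mono2) auto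
      also have "\<dots> \<le> C * real (2^Suc j) ^ k" by (rule sq) simp
      finally show "(\<Sum>n\<in>?I. (b n)\<^sup>2) \<le> C * real (2^Suc j) ^ k" .
    qed (use C in auto)
    also have "\<dots> = D\<^sup>2 * (2 ^ j) ^ (k + 1)"
      using C by (simp add: D_def power_mult_distrib algebra_simps)
    also have "\<dots> = (D * ((2 ^ j) powr ((real k + 1) / 2)))\<^sup>2"
    proof -
      have "((2 ^ j) powr ((real k + 1) / 2))\<^sup>2 = (2 ^ j) powr (real (k + 1))"
        by (simp only: power2_eq_square powr_add[symmetric]) (simp add: add.commute)
      also have "\<dots> = (2 ^ j) ^ (k + 1)" by (rule powr_realpow) simp
      finally show ?thesis by (simp add: power_mult_distrib)
    qed
    finally have 1: "(\<Sum>n\<in>?I. b n) \<le> D * ((2 ^ j) powr ((real k + 1) / 2))"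
      by (rule power2_le_imp_le) (use C in \<open>simp add: D_def\<close>)
    have "(\<Sum>n\<in>?I. b n * real n powr (- s)) \<le> (\<Sum>n\<in>?I. b n * (2 ^ j) powr (- s))"
    proof (intro sum_mono mult_left_mono nn)
      fix n :: nat assume n: "n \<in> ?I"
      then have "(2::real) ^ j \<le> real n" by (metis atLeastLessThan_iff of_nat_le_iff of_nat_numeral of_nat_power)
      then show "real n powr (- s) \<le> (2 ^ j) powr (- s)" using s0 by (intro powr_mono2') auto
    qed
    also have "\<dots> = (\<Sum>n\<in>?I. b n) * (2 ^ j) powr (- s)" by (simp add: sum_distrib_right)
    also have "\<dots> \<le> D * ((2 ^ j) powr ((real k + 1) / 2)) * (2 ^ j) powr (- s)"
      using 1 by (intro mult_right_mono) auto
    also have "\<dots> = D * (2 ^ j) powr ((real k + 1) / 2 - s)" unfolding mult.assoc powr_add[symmetric] by simp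
    also have "(2 ^ j) powr ((real k + 1) / 2 - s) = \<theta> ^ j"
      by (simp add: \<theta>_def powr_powr mult.commute flip: powr_realpow)
    finally show ?thesis .
  qed
  have D0: "D \<ge> 0" using C by (simp add: D_def)
  have dy: "(\<Sum>n=1..<2^J. b n * real n powr (- s)) \<le> (\<Sum>j<J. D * \<theta> ^ j)" for J :: nat
  proof (induction J)
    case (Suc J)
    have "(\<Sum>n=1..<2^Suc J. b n * real n powr (- s))
      = (\<Sum>n=1..<2^J. b n * real n powr (- s)) + (\<Sum>n=2^J..<2^Suc J. b n * real n powr (- s))"
      by (rule sum.atLeastLessThan_concat[symmetric]) auto
    then show ?case using Suc block[of J] by simp
  qed simp
  show ?thesis
  proof (rule summableI_nonneg_bounded)
    show "0 \<le> b n * real n powr (- s)" for n using nn by simp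
    fix n :: nat
    have "(\<Sum>i<n. b i * real i powr (- s)) \<le> (\<Sum>i<2^n. b i * real i powr (- s))"
      using nn less_exp[of n] by (intro sum_mono2) auto
    \<comment> \<open>The term at 0 drops out because \<open>0 powr x = 0\<close>.\<close>
    also have "{..<2^n} = insert 0 {1..<2^n::nat}" by auto
    also have "(\<Sum>i\<in>insert 0 {1..<2^n}. b i * real i powr (- s)) = (\<Sum>i=1..<2^n. b i * real i powr (- s))"
      by simp
    also have "\<dots> \<le> (\<Sum>j<n. D * \<theta> ^ j)" by (rule dy)
    also have "\<dots> = D * (\<Sum>j<n. \<theta> ^ j)" by (simp add: sum_distrib_left)
    also have "\<dots> \<le> D * (1 / (1 - \<theta>))"
    proof (intro mult_left_mono D0)
      have "(\<Sum>j<n. \<theta> ^ j) \<le> (\<Sum>j. \<theta> ^ j)" using \<theta> by (intro sum_le_suminf summable_geometric) auto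
      also have "\<dots> = 1 / (1 - \<theta>)" using \<theta> by (intro suminf_geometric) auto
      finally show "(\<Sum>j<n. \<theta> ^ j) \<le> 1 / (1 - \<theta>)" .
    qed
    finally show "(\<Sum>i<n. b i * real i powr (- s)) \<le> D * (1 / (1 - \<theta>))" .
  qed
qed

section \<open>Cusp forms are bounded\<close>

text \<open>A restatement of \<open>(1 + c y / n)^n \<le> exp (c y)\<close>.\<close>

lemma power_exp_bound:
  fixes c y :: real
  assumes "c > 0" "y > 0"
  shows "y ^ n * exp (- c * y) \<le> (real n / c) ^ n"
proof (cases "n = 0")
  case True then show ?thesis using assms by simp
next
  case False
  have "(c * y / real n) ^ n \<le> (1 + c * y / real n) ^ n"
    using assms by (intro power_mono) auto
  also have "\<dots> \<le> exp (c * y)"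
  proof (rule exp_ge_one_plus_x_over_n_power_n)
    show "- real n \<le> c * y" using assms by (smt (verit) mult_pos_pos of_nat_0_le_iff)
  qed (use False in simp)
  finally have "c ^ n * y ^ n \<le> real n ^ n * exp (c * y)"
    using False by (simp add: power_divide power_mult_distrib field_simps)
  then show ?thesis using assms by (simp add: power_divide exp_minus field_simps)
qed

lemma moebius_P1_mult_None:
  assumes "det A = 1" "det B = 1"
  shows "moebius_P1 (A ** B) None = moebius_P1 A (moebius_P1 B None)"
proof (cases "entry B 2 1 = 0")
  case True
  then have "entry B 1 1 \<noteq> 0" using assms by (auto simp: det_2)
  then show ?thesis using True by (simp add: moebius_P1_def entry_mult)
next
  case False
  then have "entry A 2 1 * (entry B 1 1 / entry B 2 1) + entry A 2 2 = entry (A ** B) 2 1 / entry B 2 1"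
     "entry A 1 1 * (entry B 1 1 / entry B 2 1) + entry A 1 2 = entry (A ** B) 1 1 / entry B 2 1"
    by (simp_all add: entry_mult field_simps)
  then show ?thesis using False by (simp add: moebius_P1_def)
qed

section \<open>Normal forms of single elements\<close>

text \<open>With \<open>s\<close> equal to 1 or -1 this acts as the translation by
  \<open>h / s\<close>; keeping the sign avoids a passage to the quotient by -1.\<close>

definition translation :: "real \<Rightarrow> real \<Rightarrow> real^2^2" where
  "translation s h = sl2 s h 0 s"

lemma aut_j_translation [simp]: "aut_j (translation s h) z = of_real s"
  by (simp add: aut_j_def translation_def)

lemma moebius_translation: "s \<noteq> 0 \<Longrightarrow> moebius (translation s h) z = z + of_real (h / s)"
  by (simp add: moebius_def translation_def aut_j_def field_simps)

lemma moebius_P1_translation [simp]: "moebius_P1 (translation s h) None = None"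
  by (simp add: moebius_P1_def translation_def)

lemma det_translation: "s = 1 \<or> s = -1 \<Longrightarrow> det (translation s h) = 1"
  by (auto simp: det_2 translation_def)

text \<open>The fixed-point polynomial has discriminant \<open>(trace g)^2 - 4\<close>, so there is
  a real fixed point \<open>p\<close>; the conjugating matrix sends infinity to
  \<open>p\<close>.\<close>

lemma conj_upper_triangular:
  assumes "det g = 1" "(trace g)\<^sup>2 \<ge> 4"
  obtains \<sigma> where "det \<sigma> = 1" "entry (adj2 \<sigma> ** g ** \<sigma>) 2 1 = 0"
proof (cases "entry g 2 1 = 0")
  case True
  then show ?thesis by (intro that[of "mat 1"]) (simp_all add: entry_mult adj2_def)
next
  case False
  define a b c d where "a = entry g 1 1" and "b = entry g 1 2" and "c = entry g 2 1" and "d = entry g 2 2"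
  note defs = a_def b_def c_def d_def
  have det: "a * d - b * c = 1" and c: "c \<noteq> 0" and tr: "(a + d)\<^sup>2 \<ge> 4"
    using assms False by (auto simp: defs det_2 trace_mat2)
  define r where "r = sqrt ((a + d)\<^sup>2 - 4)"
  have r: "r\<^sup>2 = (a + d)\<^sup>2 - 4" using tr by (simp add: r_def)
  define p where "p = (a - d + r) / (2 * c)"
  have "2 * c * p = a - d + r" using c by (simp add: p_def)
  then have "(2 * c * p - (a - d))\<^sup>2 = (a + d)\<^sup>2 - 4" using r by simp
  then have "4 * c * (c * p\<^sup>2 + (d - a) * p - b) = 0"
    using det by (simp add: power2_eq_square algebra_simps)
  then have "c * p\<^sup>2 + (d - a) * p - b = 0" using c by simp
  then show ?thesis
    by (intro that[of "sl2 p (-1) 1 0"])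
       (simp_all add: det_2 entry_mult power2_eq_square algebra_simps flip: defs)
qed

text \<open>Equal diagonal entries give a translation up to sign. Otherwise there is a second fixed
  point \<open>b / (d - a)\<close>, and shifting it to 0 diagonalises \<open>g\<close>.\<close>

lemma upper_triangular_normal_form:
  assumes "det g = 1" "\<not> central g" "entry g 2 1 = 0"
  obtains \<tau> s h where "det \<tau> = 1" "s = 1 \<or> s = -1" "h \<noteq> 0" "g ** \<tau> = \<tau> ** translation s h"
  | \<tau> l where "det \<tau> = 1" "l \<noteq> 0" "l\<^sup>2 \<noteq> 1" "g ** \<tau> = \<tau> ** sl2 l 0 0 (1 / l)"
proof -
  define a b d where "a = entry g 1 1" and "b = entry g 1 2" and "d = entry g 2 2"
  note defs = a_def b_def d_def
  have det: "a * d = 1" using assms by (simp add: det_2 defs)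
  have g: "g = sl2 a b 0 d" using assms by (simp add: mat2_eq_iff defs)
  have a: "a \<noteq> 0" using det by auto
  then have d: "d = 1 / a" using det by (simp add: nonzero_eq_divide_eq mult.commute)
  show ?thesis
  proof (cases "a = d")
    case True
    then have "a\<^sup>2 = 1" using det by (simp add: power2_eq_square)
    then have "a = 1 \<or> a = -1" by (simp add: power2_eq_1_iff)
    moreover have "b \<noteq> 0" using assms(2) True assms(3) unfolding central_iff[OF assms(1)] by (simp add: defs)
    moreover have "g ** mat 1 = mat 1 ** translation a b" using True by (simp add: g translation_def)
    ultimately show ?thesis using that(1)[of "mat 1" a b] by simp
  next
    case False
    then have "a\<^sup>2 \<noteq> 1" using det a by (metis mult_left_cancel power2_eq_square)
    moreover have "g ** sl2 1 (b / (d - a)) 0 1 = sl2 1 (b / (d - a)) 0 1 ** sl2 a 0 0 (1 / a)"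
      using False by (simp add: mat2_eq_iff entry_mult g d[symmetric] field_simps)
    ultimately show ?thesis using a by (intro that(2)[of "sl2 1 (b / (d - a)) 0 1" a]) (simp_all add: det_2)
  qed
qed

lemma parabolic_or_hyperbolic_normal_form:
  assumes "det g = 1" "\<not> central g" "(trace g)\<^sup>2 \<ge> 4"
  obtains \<sigma> s h where "det \<sigma> = 1" "s = 1 \<or> s = -1" "h \<noteq> 0" "g ** \<sigma> = \<sigma> ** translation s h"
  | \<sigma> l where "det \<sigma> = 1" "l \<noteq> 0" "l\<^sup>2 \<noteq> 1" "g ** \<sigma> = \<sigma> ** sl2 l 0 0 (1 / l)"
proof -
  obtain \<sigma> where \<sigma>: "det \<sigma> = 1" "entry (adj2 \<sigma> ** g ** \<sigma>) 2 1 = 0"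
    using conj_upper_triangular assms by blast
  define g0 where "g0 = adj2 \<sigma> ** g ** \<sigma>"
  have d0: "det g0 = 1" using \<sigma> assms by (simp add: g0_def det_mul)
  have "\<sigma> ** g0 = (\<sigma> ** adj2 \<sigma>) ** g ** \<sigma>" by (simp add: g0_def matrix_mul_assoc)
  then have e: "\<sigma> ** g0 = g ** \<sigma>" using \<sigma> by (simp add: adj2_mult)
  have "\<not> central g0"
  proof
    assume "central g0"
    moreover have "g = \<sigma> ** g0 ** adj2 \<sigma>" using \<sigma> by (simp add: e adj2_mult flip: matrix_mul_assoc)
    moreover have "\<sigma> ** mat (-1) ** adj2 \<sigma> = mat (-1)"
      using \<sigma>(1) by (auto simp: mat2_eq_iff entry_mult det_2 algebra_simps)
    ultimately have "central g" using \<sigma> by (auto simp: central_def adj2_mult)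
    with assms show False by simp
  qed
  then show ?thesis
  proof (rule upper_triangular_normal_form[OF d0])
    show "entry g0 2 1 = 0" using \<sigma> by (simp add: g0_def)
  next
    fix \<tau> s h assume "det \<tau> = 1" "s = 1 \<or> s = -1" "h \<noteq> 0" "g0 ** \<tau> = \<tau> ** translation s h"
    then show thesis using that(1)[of "\<sigma> ** \<tau>" s h] \<sigma> e
      by (metis (no_types, lifting) det_mul matrix_mul_assoc mult_1)
  next
    fix \<tau> l assume "det \<tau> = 1" "l \<noteq> 0" "l\<^sup>2 \<noteq> 1" "g0 ** \<tau> = \<tau> ** sl2 l 0 0 (1 / l)"
    then show thesis using that(2)[of "\<sigma> ** \<tau>" l] \<sigma> e
      by (metis (no_types, lifting) det_mul matrix_mul_assoc mult_1)
  qed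
qed

section \<open>Tubes of elliptic and hyperbolic elements\<close>

text \<open>The fixed point is \<open>x0 + i sqrt D\<close>. With \<open>t = Re z - x0\<close> and
  \<open>y = Im z\<close>, bounded displacement becomes \<open>t^2 + y^2 + D \<le> C * y\<close>,
  which confines \<open>z\<close> to a box away from the real axis.\<close>

lemma elliptic_tube_compact:
  assumes det: "det g = 1" and tr: "(trace g)\<^sup>2 < 4"
  obtains K where "compact K" "K \<subseteq> upper_half_plane" "\<And>z. Im z > 0 \<Longrightarrow> (displ g z)\<^sup>2 \<le> B \<Longrightarrow> z \<in> K"
proof -
  define a b c d where "a = entry g 1 1" and "b = entry g 1 2" and "c = entry g 2 1" and "d = entry g 2 2"
  note defs = a_def b_def c_def d_def
  have det: "a * d - b * c = 1" and tr: "(a + d)\<^sup>2 < 4"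
    using det tr by (auto simp: defs det_2 trace_mat2)
  have c: "c \<noteq> 0"
  proof
    assume "c = 0"
    then have "(a + d)\<^sup>2 = (a - d)\<^sup>2 + 4" using det by (simp add: power2_eq_square algebra_simps)
    then show False using tr by (smt (verit) zero_le_power2)
  qed
  define x0 where "x0 = (a - d) / (2 * c)"
  define D where "D = (4 - (a + d)\<^sup>2) / (4 * c\<^sup>2)"
  have D: "D > 0" using tr c by (simp add: D_def)
  have Dx: "D = - (b / c) - x0\<^sup>2"
  proof -
    have "4 * c\<^sup>2 * D = 4 - (a + d)\<^sup>2" using c by (simp add: D_def)
    also have "\<dots> = - 4 * (b * c) - (a - d)\<^sup>2" using det by (simp add: power2_eq_square algebra_simps)
    also have "\<dots> = 4 * c\<^sup>2 * (- (b / c) - x0\<^sup>2)" using c by (simp add: x0_def power2_eq_square field_simps)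
    finally show ?thesis using c by simp
  qed
  define C where "C = sqrt (\<bar>B\<bar> / c\<^sup>2 + 4 * D)"
  have C: "C > 0" using D c by (simp add: C_def add_nonneg_pos)
  have C2: "C\<^sup>2 = \<bar>B\<bar> / c\<^sup>2 + 4 * D" using D by (simp add: C_def)
  define K where "K = cbox (Complex (x0 - C) (D / C)) (Complex (x0 + C) C)"
  show ?thesis
  proof (rule that[of K])
    show "compact K" by (simp add: K_def)
    show "K \<subseteq> upper_half_plane"
      using C D by (auto simp: K_def in_cbox_complex_iff upper_half_plane_def intro: less_le_trans[of 0 "D / C"])
    fix z assume z: "Im z > 0" "(displ g z)\<^sup>2 \<le> B"
    define t y where "t = Re z - x0" and "y = Im z"
    have zt: "z = Complex (t + x0) y" by (simp add: t_def y_def complex_eq_iff)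
    have y: "y > 0" using z by (simp add: y_def)
    have q: "of_real c * z\<^sup>2 + of_real (d - a) * z - of_real b = of_real c * Complex (t\<^sup>2 - y\<^sup>2 + D) (2 * t * y)"
    proof -
      have "d - a = - 2 * c * x0" "b = - c * (D + x0\<^sup>2)" using c by (simp_all add: x0_def Dx)
      then have "of_real c * z\<^sup>2 + of_real (d - a) * z - of_real b
        = of_real c * z\<^sup>2 + of_real (- 2 * c * x0) * z - of_real (- c * (D + x0\<^sup>2))" by (simp only:)
      then show ?thesis by (simp add: zt complex_eq_iff power2_eq_square algebra_simps)
    qed
    have "(cmod (of_real c * z\<^sup>2 + of_real (d - a) * z - of_real b))\<^sup>2 = c\<^sup>2 * ((t\<^sup>2 - y\<^sup>2 + D)\<^sup>2 + (2 * t * y)\<^sup>2)"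
      unfolding q by (simp add: norm_mult power_mult_distrib cmod_power2)
    \<comment> \<open>Both sides are the product of the squared distances from
      \<open>t + i y\<close> to \<open>i sqrt D\<close> and to \<open>- i sqrt D\<close>.\<close>
    also have "(t\<^sup>2 - y\<^sup>2 + D)\<^sup>2 + (2 * t * y)\<^sup>2 = (t\<^sup>2 + y\<^sup>2 + D)\<^sup>2 - 4 * y\<^sup>2 * D"
      by (simp add: power2_eq_square algebra_simps)
    finally have "(displ g z)\<^sup>2 * y\<^sup>2 = c\<^sup>2 * ((t\<^sup>2 + y\<^sup>2 + D)\<^sup>2 - 4 * y\<^sup>2 * D)"
      using y unfolding displ_def power_divide by (simp add: y_def flip: defs)
    moreover have "(displ g z)\<^sup>2 * y\<^sup>2 \<le> \<bar>B\<bar> * y\<^sup>2" using z by (intro mult_right_mono) auto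
    ultimately have "(t\<^sup>2 + y\<^sup>2 + D)\<^sup>2 \<le> (C * y)\<^sup>2"
      unfolding power_mult_distrib C2 using c by (simp add: field_simps)
    then have le: "t\<^sup>2 + y\<^sup>2 + D \<le> C * y" by (rule power2_le_imp_le) (use C y in simp)
    have "y * y \<le> C * y" using le D by (smt (verit) zero_le_power2 power2_eq_square)
    then have 1: "y \<le> C" using y by simp
    have "D \<le> C * y" using le by (smt (verit) zero_le_power2)
    then have 2: "D / C \<le> y" using C by (simp add: field_simps)
    have "t\<^sup>2 \<le> C * y" using le D by (smt (verit) zero_le_power2)
    also have "\<dots> \<le> C * C" using 1 C by (intro mult_left_mono) auto
    finally have "t\<^sup>2 \<le> C\<^sup>2" by (simp add: power2_eq_square)
    then have "\<bar>t\<bar> \<le> C" using C by (metis abs_le_square_iff abs_of_pos)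
    then show "z \<in> K" using 1 2 by (auto simp: K_def in_cbox_complex_iff zt)
  qed
qed

text \<open>The axis is the imaginary half-line, and bounded displacement means a cone
  \<open>|z| \<le> Q * Im z\<close> about it. The dilation by \<open>l^2\<close> leaves
  \<open>\<psi>\<close> invariant and moves every point of the cone into the compact part with
  \<open>1 \<le> |z| \<le> M\<close>.\<close>

lemma hyperbolic_tube_bounded:
  fixes \<psi> :: "complex \<Rightarrow> real"
  assumes l: "l \<noteq> 0" "l\<^sup>2 \<noteq> 1" and cont: "continuous_on upper_half_plane \<psi>"
    and inv: "\<And>z. Im z > 0 \<Longrightarrow> \<psi> (of_real (l\<^sup>2) * z) = \<psi> z"
  obtains C where "\<And>z. Im z > 0 \<Longrightarrow> (displ (sl2 l 0 0 (1 / l)) z)\<^sup>2 \<le> B \<Longrightarrow> \<psi> z \<le> C"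
proof -
  define M where "M = max (l\<^sup>2) (1 / l\<^sup>2)"
  have l2: "l\<^sup>2 > 0" using l by simp
  have M: "M > 1"
  proof (cases "l\<^sup>2 > 1")
    case False
    then have "l\<^sup>2 < 1" using l by simp
    then show ?thesis using l2 by (auto simp: M_def less_max_iff_disj)
  qed (auto simp: M_def)
  have invM: "\<psi> (of_real M * z) = \<psi> z" if "Im z > 0" for z
  proof (cases "M = l\<^sup>2")
    case True then show ?thesis using inv[OF that] by simp
  next
    case False
    then have M': "M = 1 / l\<^sup>2" by (auto simp: M_def)
    have "Im (of_real M * z) > 0" using M that by simp
    from inv[OF this] show ?thesis using l2 by (simp add: M' flip: of_real_power)
  qed
  have invn: "\<psi> (of_real (M ^ n) * z) = \<psi> z" if "Im z > 0" for z n
  proof (induction n)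
    case (Suc n)
    have "Im (of_real (M ^ n) * z) > 0" using M that by simp
    from invM[OF this] show ?case using Suc by (simp add: mult_ac)
  qed simp
  define Q where "Q = sqrt \<bar>B\<bar> / \<bar>l - 1 / l\<bar>"
  have ll: "l - 1 / l \<noteq> 0" using l by (auto simp: field_simps power2_eq_square)
  define K where "K = cball 0 M \<inter> {z. 1 \<le> cmod z \<and> cmod z \<le> Q * Im z}"
  have "closed {z. 1 \<le> cmod z \<and> cmod z \<le> Q * Im z}"
    by (intro closed_Collect_conj closed_Collect_le continuous_intros)
  then have K: "compact K" unfolding K_def by (intro compact_Int_closed compact_cball)
  have Q0: "Q \<ge> 0" by (simp add: Q_def)
  have "K \<subseteq> upper_half_plane"
  proof
    fix z assume "z \<in> K"
    then have "Q * Im z \<ge> 1" by (auto simp: K_def)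
    then show "z \<in> upper_half_plane" using Q0 unfolding upper_half_plane_def
      by (smt (verit) mem_Collect_eq mult_nonneg_nonpos)
  qed
  then have "compact (\<psi> ` K)" using K cont by (intro compact_continuous_image) (auto intro: continuous_on_subset)
  then obtain C where C: "\<And>z. z \<in> K \<Longrightarrow> \<psi> z \<le> C"
    using compact_imp_bounded bounded_iff by (metis image_eqI real_norm_def abs_le_D1)
  \<comment> \<open>A power of \<open>M\<close> first makes the modulus at least 1; dividing by the
    largest power of \<open>M\<close> not exceeding it then brings the modulus between 1 and
    \<open>M\<close>.\<close>
  have scale: "\<exists>w. Im w > 0 \<and> \<psi> w = \<psi> z \<and> 1 \<le> cmod w \<and> cmod w \<le> M \<and> (\<exists>r>0. w = of_real r * z)"
    if z: "Im z > 0" for z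
  proof -
    have z0: "cmod z > 0" using z by (metis zero_less_norm_iff less_irrefl zero_complex.simps(2))
    obtain n0 where n0: "1 / cmod z < M ^ n0" using real_arch_pow[OF M] by blast
    define z1 where "z1 = of_real (M ^ n0) * z"
    have z1: "cmod z1 \<ge> 1" "Im z1 > 0" "\<psi> z1 = \<psi> z"
      using n0 z0 M z invn[OF z] by (simp_all add: z1_def norm_mult norm_power field_simps)
    define n where "n = (LEAST n. cmod z1 < M ^ Suc n)"
    obtain m where "cmod z1 < M ^ m" using real_arch_pow[OF M] by blast
    then have "cmod z1 < M ^ Suc m" using M by (simp add: less_le_trans mult_le_cancel_right1)
    then have n: "cmod z1 < M ^ Suc n" unfolding n_def by (rule LeastI)
    have n': "M ^ n \<le> cmod z1"
    proof (cases n)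
      case 0 then show ?thesis using z1 by simp
    next
      case (Suc j)
      then have "j < n" by simp
      then have "\<not> cmod z1 < M ^ Suc j" unfolding n_def by (rule not_less_Least)
      then show ?thesis using Suc by simp
    qed
    define w where "w = z1 / of_real (M ^ n)"
    have Mn: "M ^ n > 0" using M by simp
    have w: "Im w > 0" using z1 Mn by (simp add: w_def Im_divide_of_real)
    have "of_real (M ^ n) * w = z1" using M by (simp add: w_def)
    then have "\<psi> w = \<psi> z" using invn[OF w, of n] z1 by simp
    moreover have "1 \<le> cmod w \<and> cmod w \<le> M" using n n' Mn M
      by (simp add: w_def norm_divide norm_power field_simps)
    moreover have "w = of_real (M ^ n0 / M ^ n) * z" by (simp add: w_def z1_def)
    then have "\<exists>r>0. w = of_real r * z" using M by (intro exI[of _ "M ^ n0 / M ^ n"]) simp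
    ultimately show ?thesis using w by blast
  qed
  show ?thesis
  proof (rule that[of C])
    fix z assume z: "Im z > 0" "(displ (sl2 l 0 0 (1 / l)) z)\<^sup>2 \<le> B"
    obtain w r where w: "Im w > 0" "\<psi> w = \<psi> z" "1 \<le> cmod w" "cmod w \<le> M" "r > 0" "w = of_real r * z"
      using scale[OF z(1)] by blast
    have "displ (sl2 l 0 0 (1 / l)) z = \<bar>l - 1 / l\<bar> * cmod z / Im z"
    proof -
      have "cmod (of_real (1 / l - l) * z) = \<bar>l - 1 / l\<bar> * cmod z"
        by (simp only: norm_mult norm_of_real) (simp add: abs_minus_commute)
      then show ?thesis by (simp add: displ_def)
    qed
    moreover have "displ (sl2 l 0 0 (1 / l)) z \<le> sqrt \<bar>B\<bar>"
      using z by (intro real_le_rsqrt) simp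
    then have "Im z * displ (sl2 l 0 0 (1 / l)) z \<le> Im z * sqrt \<bar>B\<bar>" using z by (intro mult_left_mono) auto
    ultimately have "cmod z \<le> Q * Im z" using z ll by (simp add: Q_def field_simps)
    then have "r * cmod z \<le> r * (Q * Im z)" using w by (intro mult_left_mono) auto
    then have "w \<in> K" using w by (simp add: K_def norm_mult mult_ac)
    then show "\<psi> z \<le> C" using C w by metis
  qed
qed

section \<open>The invariant function of a cusp form\<close>

locale cusp_form_setting = fuchsian +
  fixes k :: nat and f :: "complex \<Rightarrow> complex"
  assumes cofinite: "finite_covolume \<Gamma>" and width: "cusp_at_infinity_of_width \<Gamma> 1"
    and even_k: "even k" and cusp_form: "cusp_form \<Gamma> k f"
begin

lemma f_holomorphic: "f holomorphic_on upper_half_plane"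
  using cusp_form by (simp add: cusp_form_def)

lemma f_moebius: "g \<in> \<Gamma> \<Longrightarrow> Im z > 0 \<Longrightarrow> f (moebius g z) = aut_j g z ^ k * f z"
  using cusp_form by (simp add: cusp_form_def upper_half_plane_def)

text \<open>The weight \<open>k\<close> action on \<open>f\<close>, formed for matrices outside the
  group as well, since these carry infinity to the other cusps.\<close>

definition slash :: "real^2^2 \<Rightarrow> complex \<Rightarrow> complex" where
  "slash \<sigma> z = f (moebius \<sigma> z) / aut_j \<sigma> z ^ k"

lemma slash_holomorphic:
  assumes "det \<sigma> = 1"
  shows "slash \<sigma> holomorphic_on upper_half_plane"
proof -
  have nz: "aut_j \<sigma> z \<noteq> 0" if "z \<in> upper_half_plane" for z
    using that assms aut_j_nonzero by (simp add: upper_half_plane_def)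
  have m: "moebius \<sigma> holomorphic_on upper_half_plane"
    unfolding moebius_def[abs_def] using nz unfolding aut_j_def by (intro holomorphic_intros) auto
  have "(f \<circ> moebius \<sigma>) holomorphic_on upper_half_plane"
    by (rule holomorphic_on_compose_gen[OF m f_holomorphic])
       (use assms Im_moebius_pos in \<open>auto simp: upper_half_plane_def\<close>)
  then have "(\<lambda>z. f (moebius \<sigma> z)) holomorphic_on upper_half_plane" by (simp add: o_def)
  moreover have "(\<lambda>z. aut_j \<sigma> z ^ k) holomorphic_on upper_half_plane"
    unfolding aut_j_def by (intro holomorphic_intros)
  ultimately show ?thesis
    unfolding slash_def[abs_def] using nz by (intro holomorphic_on_divide) auto
qed

text \<open>The relation between \<open>g\<close> and \<open>\<sigma>\<close> expresses both the
  point and the cocycle of \<open>g\<close> at \<open>\<sigma> z\<close> through the translated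
  argument. The remaining factor \<open>s^k\<close> is 1 because \<open>k\<close> is even.\<close>

lemma slash_periodic:
  assumes g: "g \<in> \<Gamma>" "det \<sigma> = 1" "s = 1 \<or> s = -1" "g ** \<sigma> = \<sigma> ** translation s h" and z: "Im z > 0"
  shows "slash \<sigma> (z + of_real (h / s)) = slash \<sigma> z"
proof -
  let ?z = "z + of_real (h / s)"
  have sk: "of_real s ^ k = (1::complex)" using g(3) even_k by (auto simp: uminus_power_if)
  have s0: "s \<noteq> 0" using g by auto
  have Iz: "Im ?z > 0" using z by simp
  have nz: "aut_j \<sigma> z \<noteq> 0" "aut_j \<sigma> ?z \<noteq> 0" using aut_j_nonzero g z by auto
  have Is: "Im (moebius \<sigma> z) > 0" using Im_moebius_pos g z by blast
  have "moebius (g ** \<sigma>) z = moebius (\<sigma> ** translation s h) z" using g by simp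
  then have m: "moebius g (moebius \<sigma> z) = moebius \<sigma> ?z"
    using nz s0 by (simp add: moebius_mult moebius_translation)
  have "aut_j (g ** \<sigma>) z = aut_j (\<sigma> ** translation s h) z" using g by simp
  then have j: "aut_j g (moebius \<sigma> z) * aut_j \<sigma> z = aut_j \<sigma> ?z * of_real s"
    using nz s0 by (simp add: aut_j_mult moebius_translation)
  have "f (moebius \<sigma> ?z) = aut_j g (moebius \<sigma> z) ^ k * f (moebius \<sigma> z)"
    using f_moebius[OF g(1) Is] m by simp
  then have "f (moebius \<sigma> ?z) * aut_j \<sigma> z ^ k = (aut_j g (moebius \<sigma> z) * aut_j \<sigma> z) ^ k * f (moebius \<sigma> z)"
    by (simp add: power_mult_distrib mult_ac)
  also have "\<dots> = aut_j \<sigma> ?z ^ k * f (moebius \<sigma> z)" by (simp add: j power_mult_distrib sk)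
  finally show ?thesis using nz by (simp add: slash_def field_simps)
qed

lemma cusp_mem:
  assumes "g \<in> \<Gamma>" "det \<sigma> = 1" "s = 1 \<or> s = -1" "h \<noteq> 0" "g ** \<sigma> = \<sigma> ** translation s h"
  shows "moebius_P1 \<sigma> None \<in> cusps \<Gamma>"
proof -
  have g: "g = \<sigma> ** translation s h ** adj2 \<sigma>"
    using assms by (metis adj2_mult(1) matrix_mul_assoc matrix_mul_rid)
  have dg: "det g = 1" using assms det_1 by blast
  have "trace g = det \<sigma> * (2 * s)"
    unfolding g by (simp add: trace_mat2 entry_mult translation_def det_2 algebra_simps)
  then have tr: "\<bar>trace g\<bar> = 2" using assms by auto
  have nc: "\<not> central g"
  proof
    assume "central g"
    then have "translation s h = mat 1 \<or> translation s h = mat (-1)"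
    proof -
      have "adj2 \<sigma> ** (g ** \<sigma>) = translation s h"
        using assms by (simp add: matrix_mul_assoc adj2_mult)
      moreover have "adj2 \<sigma> ** (mat (-1) ** \<sigma>) = mat (-1)"
        using assms(2) by (auto simp: mat2_eq_iff entry_mult det_2 algebra_simps)
      ultimately show ?thesis using \<open>central g\<close> assms(2) by (auto simp: central_def adj2_mult)
    qed
    then show False using assms by (auto simp: mat2_eq_iff translation_def)
  qed
  have "moebius_P1 g (moebius_P1 \<sigma> None) = moebius_P1 (\<sigma> ** translation s h) None"
    using moebius_P1_mult_None[OF dg assms(2)] assms by simp
  also have "\<dots> = moebius_P1 \<sigma> None"
    using moebius_P1_mult_None[OF assms(2) det_translation[OF assms(3)], of h] by simp
  finally show ?thesis
    using assms dg tr nc unfolding cusps_def parabolic_def central_def mat_minus1[symmetric] by blast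
qed

text \<open>The definition of a cusp form only demands a limit 0 at the cusp; periodicity improves
  this to an exponential rate.\<close>

lemma slash_decay:
  assumes g: "g \<in> \<Gamma>" "det \<sigma> = 1" "s = 1 \<or> s = -1" "h \<noteq> 0" "g ** \<sigma> = \<sigma> ** translation s h" and Y: "Y > 0"
  obtains C c where "C \<ge> 0" "c > 0" "\<And>z. Im z \<ge> Y \<Longrightarrow> cmod (slash \<sigma> z) \<le> C * exp (- c * Im z)"
proof -
  have per: "slash \<sigma> (z + of_real (h / s)) = slash \<sigma> z" if "Im z > 0" for z
    using slash_periodic g that by blast
  have per': "slash \<sigma> (z + of_real \<bar>h\<bar>) = slash \<sigma> z" if z: "Im z > 0" for z
  proof (cases "\<bar>h\<bar> = h / s")
    case True then show ?thesis using per[OF z] by simp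
  next
    case False
    then have "h / s = - \<bar>h\<bar>" using g by (auto simp: abs_if)
    then show ?thesis using per[of "z + of_real \<bar>h\<bar>"] z by simp
  qed
  have lim: "(slash \<sigma> \<longlongrightarrow> 0) (filtercomap Im at_top)"
    using cusp_form cusp_mem[OF g] g(2) unfolding cusp_form_def slash_def[abs_def] by blast
  obtain C where C: "C \<ge> 0" "\<And>z. Im z \<ge> Y \<Longrightarrow> cmod (slash \<sigma> z) \<le> C * exp (- 2 * pi * Im z / \<bar>h\<bar>)"
    using periodic_decay[OF slash_holomorphic[OF g(2)] _ per' lim Y] g(4) by auto
  show ?thesis
    by (rule that[of C "2 * pi / \<bar>h\<bar>"]) (use C g(4) in auto)
qed

definition phi :: "complex \<Rightarrow> real" where
  "phi z = (cmod (f z))\<^sup>2 * Im z ^ k"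

lemma phi_continuous: "continuous_on upper_half_plane phi"
  unfolding phi_def[abs_def]
  by (intro continuous_intros holomorphic_on_imp_continuous_on f_holomorphic)

lemma phi_moebius:
  assumes "det \<sigma> = 1" "Im z > 0"
  shows "phi (moebius \<sigma> z) = (cmod (slash \<sigma> z))\<^sup>2 * Im z ^ k"
  using aut_j_nonzero[OF assms]
  by (simp add: phi_def slash_def Im_moebius[OF assms(1)] norm_divide norm_power power_divide flip: power_mult)
     (simp add: mult.commute)

lemma phi_invariant:
  assumes "g \<in> \<Gamma>" "Im z > 0"
  shows "phi (moebius g z) = phi z"
  using aut_j_nonzero[of g z] assms det_1
  by (simp add: phi_moebius slash_def f_moebius) (simp add: phi_def)

lemma conj_tube:
  assumes "g ** \<sigma> = \<sigma> ** b" "det \<sigma> = 1" "det b = 1" "Im z > 0"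
  shows "eta2 g z = eta2 b (moebius (adj2 \<sigma>) z)"
proof -
  have "g = \<sigma> ** b ** adj2 \<sigma>"
    using assms by (metis adj2_mult(1) matrix_mul_assoc matrix_mul_rid)
  then show ?thesis
    using eta2_moebius[OF assms(3,2), of "moebius (adj2 \<sigma>) z"] assms
    by (simp add: moebius_adj2 Im_moebius_pos)
qed

text \<open>An elliptic tube is compact, a parabolic one is a horoball on which \<open>slash\<close>
  decays, and a hyperbolic one is compact modulo a dilation that leaves \<open>phi\<close> invariant
  in the conjugated coordinate.\<close>

lemma phi_bounded_tube:
  assumes g: "g \<in> \<Gamma>" "\<not> central g"
  shows "\<exists>C. \<forall>z. Im z > 0 \<longrightarrow> eta2 g z \<le> 1/100 \<longrightarrow> phi z \<le> C"
proof (cases "(trace g)\<^sup>2 < 4")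
  case True
  obtain K where K: "compact K" "K \<subseteq> upper_half_plane"
     "\<And>z. Im z > 0 \<Longrightarrow> (displ g z)\<^sup>2 \<le> 1/100 - 4 + 2 * \<bar>trace g\<bar> \<Longrightarrow> z \<in> K"
    using elliptic_tube_compact[OF _ True] det_1 g by blast
  have "compact (phi ` K)" using K phi_continuous by (intro compact_continuous_image) (auto intro: continuous_on_subset)
  then obtain C where "\<And>z. z \<in> K \<Longrightarrow> phi z \<le> C"
    using compact_imp_bounded bounded_iff by (metis image_eqI real_norm_def abs_le_D1)
  then show ?thesis using K(3) by (auto simp: eta2_def intro!: exI[of _ C])
next
  case False
  have d: "det g = 1" using g det_1 by blast
  from False have "(trace g)\<^sup>2 \<ge> 4" by simp
  with d g(2) show ?thesis
  proof (cases rule: parabolic_or_hyperbolic_normal_form)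
    case (1 \<sigma> s h)
    then have db: "det (translation s h) = 1" by (intro det_translation)
    obtain C c where C: "C \<ge> 0" "c > 0" "\<And>z. Im z \<ge> 10 * \<bar>h\<bar> \<Longrightarrow> cmod (slash \<sigma> z) \<le> C * exp (- c * Im z)"
      using slash_decay[OF g(1) 1, of "10 * \<bar>h\<bar>"] 1 by auto
    have pe: "y ^ k * exp (- 2 * c * y) \<le> (real k / (2 * c)) ^ k" if "y > 0" for y
      using power_exp_bound[of "2 * c" y k] C that by simp
    have "phi z \<le> C\<^sup>2 * (real k / (2 * c)) ^ k" if z: "Im z > 0" "eta2 g z \<le> 1/100" for z
    proof -
      define w where "w = moebius (adj2 \<sigma>) z"
      have w: "Im w > 0" "z = moebius \<sigma> w" using z 1 by (simp_all add: w_def Im_moebius_pos moebius_adj2)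
      have "eta2 (translation s h) w \<le> 1/100" using conj_tube[OF 1(4) 1(1) db z(1)] z by (simp add: w_def)
      \<comment> \<open>For trace 2 or -2 the correction in \<open>eta2\<close> cancels, so the
        bound 1/100 means \<open>\<bar>h\<bar> / Im w \<le> 1/10\<close>. This is where the height
        \<open>10 * \<bar>h\<bar>\<close> above comes from.\<close>
      then have "(displ (translation s h) w)\<^sup>2 \<le> 1/100"
        using 1(2) by (auto simp: eta2_def trace_mat2 translation_def)
      moreover have "displ (translation s h) w = \<bar>h\<bar> / Im w" by (simp add: displ_def translation_def)
      ultimately have "(\<bar>h\<bar> / Im w)\<^sup>2 \<le> (1/10)\<^sup>2" by (simp add: power2_eq_square)
      then have "\<bar>h\<bar> / Im w \<le> 1/10" by (rule power2_le_imp_le) simp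
      then have hw: "Im w \<ge> 10 * \<bar>h\<bar>" using w by (simp add: field_simps)
      have "phi z = (cmod (slash \<sigma> w))\<^sup>2 * Im w ^ k" using w 1 by (simp add: phi_moebius)
      also have "\<dots> \<le> (C * exp (- c * Im w))\<^sup>2 * Im w ^ k"
        using C hw w by (intro mult_right_mono power_mono) auto
      also have "\<dots> = C\<^sup>2 * (Im w ^ k * exp (- 2 * c * Im w))"
        by (simp add: power_mult_distrib mult_ac flip: exp_double)
      also have "\<dots> \<le> C\<^sup>2 * (real k / (2 * c)) ^ k" using pe[OF w(1)] by (intro mult_left_mono) auto
      finally show ?thesis .
    qed
    then show ?thesis by blast
  next
    case (2 \<sigma> l)
    define b where "b = sl2 l 0 0 (1 / l)"
    have db: "det b = 1" using 2 by (simp add: b_def det_2)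
    define \<psi> where "\<psi> z = phi (moebius \<sigma> z)" for z
    have cont: "continuous_on upper_half_plane \<psi>"
    proof -
      have "continuous_on upper_half_plane (\<lambda>z. (cmod (slash \<sigma> z))\<^sup>2 * Im z ^ k)"
        by (intro continuous_intros holomorphic_on_imp_continuous_on slash_holomorphic 2)
      then show ?thesis
        by (rule continuous_on_eq) (use 2 in \<open>simp add: \<psi>_def phi_moebius upper_half_plane_def\<close>)
    qed
    have inv: "\<psi> (of_real (l\<^sup>2) * z) = \<psi> z" if z: "Im z > 0" for z
    proof -
      have "moebius b z = of_real (l\<^sup>2) * z" using 2 by (simp add: b_def moebius_def aut_j_def power2_eq_square)
      moreover have "moebius (g ** \<sigma>) z = moebius (\<sigma> ** b) z" unfolding 2(4)[folded b_def] ..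
      then have "moebius g (moebius \<sigma> z) = moebius \<sigma> (moebius b z)"
        using z 2(1) db by (simp add: moebius_mult aut_j_nonzero)
      ultimately show ?thesis using phi_invariant[OF g(1), of "moebius \<sigma> z"] z 2 by (simp add: \<psi>_def Im_moebius_pos)
    qed
    obtain C where C: "\<And>z. Im z > 0 \<Longrightarrow> (displ b z)\<^sup>2 \<le> 1/100 - 4 + 2 * \<bar>trace b\<bar> \<Longrightarrow> \<psi> z \<le> C"
      using hyperbolic_tube_bounded[OF 2(2,3) cont inv] unfolding b_def by blast
    have "phi z \<le> C" if z: "Im z > 0" "eta2 g z \<le> 1/100" for z
    proof -
      define w where "w = moebius (adj2 \<sigma>) z"
      have w: "Im w > 0" "z = moebius \<sigma> w" using z 2 by (simp_all add: w_def Im_moebius_pos moebius_adj2)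
      have "eta2 b w \<le> 1/100" using conj_tube[of g \<sigma> b z] 2 db z by (simp add: w_def b_def)
      then have "\<psi> w \<le> C" using C[OF w(1)] by (simp add: eta2_def)
      then show ?thesis using w by (simp add: \<psi>_def)
    qed
    then show ?thesis by blast
  qed
qed

theorem phi_bounded:
  obtains C where "C > 0" "\<And>z. Im z > 0 \<Longrightarrow> (cmod (f z))\<^sup>2 * Im z ^ k \<le> C"
proof -
  obtain C where C: "\<And>z. Im z > 0 \<Longrightarrow> phi z \<le> C"
    using invariant_bounded[OF cofinite phi_continuous phi_invariant phi_bounded_tube] by blast
  show ?thesis by (rule that[of "max C 1"]) (use C in \<open>auto simp: phi_def le_max_iff_disj\<close>)
qed

end

section \<open>Mellin transforms\<close>

lemma set_integrable_exp_minus: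
  fixes c :: real
  assumes "c > 0"
  shows "set_integrable lborel {0<..} (\<lambda>y. exp (- c * y))"
proof -
  have "(\<lambda>y. exp (- c * y)) integrable_on {0..}"
    using has_integral_exp_minus_to_infinity[OF assms, of 0] by blast
  then have "(\<lambda>y. exp (- c * y)) absolutely_integrable_on {0..}"
    by (rule nonnegative_absolutely_integrable_1) simp
  then have "set_integrable lebesgue {0<..} (\<lambda>y. exp (- c * y))"
    by (rule set_integrable_subset) auto
  moreover have "(\<lambda>x. indicat_real {0<..} x *\<^sub>R exp (- c * x)) \<in> borel_measurable lborel" by measurable
  ultimately show ?thesis unfolding set_integrable_def by (simp add: integrable_completion)
qed

text \<open>\<open>y powr m\<close> is at most \<open>y^n + (1/y)^n\<close>. Half of the decay in
  \<open>y\<close> absorbs the first term, the decay in \<open>1/y\<close> absorbs the second, and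
  the other half in \<open>y\<close> remains as an integrable majorant.\<close>

lemma powr_exp_bound:
  fixes c :: real
  assumes c: "c > 0"
  shows "\<exists>K\<ge>0. \<forall>y>0. \<forall>m. \<bar>m\<bar> \<le> real n \<longrightarrow> y powr m * exp (- c * (y + 1 / y)) \<le> K * exp (- (c / 2) * y)"
proof (intro exI conjI allI impI)
  show "0 \<le> 2 * (real n / (c / 2)) ^ n" using c by simp
  fix y m :: real assume y: "y > 0" and m: "\<bar>m\<bar> \<le> real n"
  have y1: "1 / y > 0" using y by simp
  have 1: "y powr m \<le> y ^ n + (1 / y) ^ n"
  proof (cases "y \<ge> 1")
    case True
    then have "y powr m \<le> y powr real n" using m by (intro powr_mono) auto
    also have "\<dots> = y ^ n" using y by (simp add: powr_realpow)
    also have "\<dots> \<le> y ^ n + (1 / y) ^ n" using y by simp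
    finally show ?thesis .
  next
    case False
    then have "y powr m \<le> y powr (- real n)" using m y by (intro powr_mono') auto
    also have "\<dots> = (1 / y) ^ n" using y by (simp add: powr_minus powr_realpow field_simps)
    also have "\<dots> \<le> y ^ n + (1 / y) ^ n" using y by simp
    finally show ?thesis .
  qed
  have 2: "y ^ n * exp (- (c / 2) * y) \<le> (real n / (c / 2)) ^ n" "(1 / y) ^ n * exp (- (c / 2) * (1 / y)) \<le> (real n / (c / 2)) ^ n"
    by (rule power_exp_bound; use c y y1 in simp)+
  have 3: "y ^ n * exp (- (c / 2) * y - c / y) \<le> (real n / (c / 2)) ^ n"
  proof -
    have "y ^ n * exp (- (c / 2) * y - c / y) \<le> y ^ n * exp (- (c / 2) * y)"
      using c y by (intro mult_left_mono) auto
    with 2(1) show ?thesis by simp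
  qed
  have 4: "(1 / y) ^ n * exp (- (c / 2) * y - c / y) \<le> (real n / (c / 2)) ^ n"
  proof -
    have "- (c / 2) * y - c / y \<le> - (c / 2) * (1 / y)"
    proof -
      have "0 \<le> (c / 2) * y" "0 \<le> c * (1 / y)" using c y by simp_all
      then show ?thesis by (simp add: field_simps)
    qed
    then have "(1 / y) ^ n * exp (- (c / 2) * y - c / y) \<le> (1 / y) ^ n * exp (- (c / 2) * (1 / y))"
      using y by (intro mult_left_mono) auto
    with 2(2) show ?thesis by simp
  qed
  have "exp (- c * (y + 1 / y)) = exp (- (c / 2) * y - c / y) * exp (- (c / 2) * y)"
    by (simp add: algebra_simps flip: exp_add)
  then have "y powr m * exp (- c * (y + 1 / y)) \<le> (y ^ n + (1 / y) ^ n) * (exp (- (c / 2) * y - c / y) * exp (- (c / 2) * y))"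
    using 1 by (simp add: mult_right_mono)
  also have "\<dots> = (y ^ n * exp (- (c / 2) * y - c / y) + (1 / y) ^ n * exp (- (c / 2) * y - c / y)) * exp (- (c / 2) * y)"
    by (simp only: algebra_simps)
  also have "\<dots> \<le> (2 * (real n / (c / 2)) ^ n) * exp (- (c / 2) * y)"
    using 3 4 by (intro mult_right_mono) auto
  finally show "y powr m * exp (- c * (y + 1 / y)) \<le> 2 * (real n / (c / 2)) ^ n * exp (- (c / 2) * y)" .
qed

lemma norm_of_real_powr:
  assumes "y > 0" shows "cmod (of_real y powr z) = y powr Re z"
  using norm_powr_real_powr[of "of_real y" z] assms by simp

text \<open>Compact intervals filling the half-line: differentiation under the integral is done on
  each of them, and the limit is taken afterwards.\<close>

definition exhausting_interval :: "nat \<Rightarrow> real set" where "exhausting_interval n = cbox (1 / (real n + 1)) (real n + 1)"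

lemma exhausting_interval_pos: "y \<in> exhausting_interval n \<Longrightarrow> y > 0"
  by (auto simp: exhausting_interval_def intro: less_le_trans[of 0 "1 / (real n + 1)"])

lemma incseq_exhausting_interval: "incseq exhausting_interval"
  by (auto simp: incseq_def exhausting_interval_def intro: order_trans[rotated] frac_le)

lemma UN_exhausting_interval: "(\<Union>n. exhausting_interval n) = {0<..}"
proof (intro equalityI subsetI)
  fix y :: real assume y: "y \<in> {0<..}"
  obtain n where n: "max y (1 / y) \<le> real n" using real_arch_simple by blast
  then have "1 / y \<le> real n + 1" "y \<le> real n + 1" by auto
  then have "1 / (real n + 1) \<le> y" using y by (simp add: field_simps)
  then show "y \<in> (\<Union>n. exhausting_interval n)" using \<open>y \<le> real n + 1\<close> by (auto simp: exhausting_interval_def)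
qed (auto dest: exhausting_interval_pos)

locale mellin =
  fixes F :: "real \<Rightarrow> complex" and C c :: real
  assumes cont: "continuous_on {0<..} F" and c: "c > 0" and C: "C \<ge> 0"
    and bd: "\<And>y. y > 0 \<Longrightarrow> cmod (F y) \<le> C * exp (- c * (y + 1 / y))"
begin

definition transform :: "complex \<Rightarrow> complex" where
  "transform s = (LBINT y:{0<..}. F y * of_real y powr (s - 1))"

lemma integrand_continuous: "continuous_on {0<..} (\<lambda>y. F y * of_real y powr (s - 1))"
  by (intro continuous_intros cont) auto

text \<open>The majorant serves a whole vertical strip of \<open>s\<close>, which is what locally
  uniform convergence needs.\<close>

lemma integrand_bound:
  "\<exists>K\<ge>0. \<forall>y>0. \<forall>s. \<bar>Re s - 1\<bar> \<le> real n \<longrightarrow> cmod (F y * of_real y powr (s - 1)) \<le> K * exp (- (c / 2) * y)"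
proof -
  obtain K where K: "K \<ge> 0" "\<And>y m. y > 0 \<Longrightarrow> \<bar>m\<bar> \<le> real n \<Longrightarrow> y powr m * exp (- c * (y + 1 / y)) \<le> K * exp (- (c / 2) * y)"
    using powr_exp_bound[OF c, of n] by blast
  show ?thesis
  proof (intro exI conjI allI impI)
    show "0 \<le> C * K" using C K by simp
    fix y :: real and s assume y: "y > 0" and s: "\<bar>Re s - 1\<bar> \<le> real n"
    have "cmod (F y * of_real y powr (s - 1)) = cmod (F y) * y powr (Re s - 1)"
      using y by (simp add: norm_mult norm_of_real_powr)
    also have "\<dots> \<le> (C * exp (- c * (y + 1 / y))) * y powr (Re s - 1)"
      using bd[OF y] by (intro mult_right_mono) auto
    also have "\<dots> = C * (y powr (Re s - 1) * exp (- c * (y + 1 / y)))" by simp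
    also have "\<dots> \<le> C * (K * exp (- (c / 2) * y))"
      using K(2)[OF y s] C by (intro mult_left_mono) auto
    finally show "cmod (F y * of_real y powr (s - 1)) \<le> C * K * exp (- (c / 2) * y)" by simp
  qed
qed

lemma integrable: "set_integrable lborel {0<..} (\<lambda>y. F y * of_real y powr (s - 1))"
proof -
  obtain n where "\<bar>Re s - 1\<bar> \<le> real n" using real_arch_simple by blast
  then obtain K where K: "K \<ge> 0" "\<And>y. y > 0 \<Longrightarrow> cmod (F y * of_real y powr (s - 1)) \<le> K * exp (- (c / 2) * y)"
    using integrand_bound[of n] by blast
  have "set_integrable lborel {0<..} (\<lambda>y. exp (- (c / 2) * y))"
    using c by (intro set_integrable_exp_minus) simp
  then have "set_integrable lborel {0<..} (\<lambda>y. K * exp (- (c / 2) * y))"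
    by (intro set_integrable_mult_right)
  then show ?thesis
  proof (rule set_integrable_bound)
    show "set_borel_measurable lborel {0<..} (\<lambda>y. F y * of_real y powr (s - 1))"
      using borel_measurable_continuous_on_indicator[OF _ integrand_continuous] by (simp add: set_borel_measurable_def)
    show "AE y in lborel. y \<in> {0<..} \<longrightarrow> cmod (F y * of_real y powr (s - 1)) \<le> norm (K * exp (- (c / 2) * y))"
      using K by (intro AE_I2) auto
  qed
qed

lemma truncated_holomorphic: "(\<lambda>s. LBINT y:exhausting_interval n. F y * of_real y powr (s - 1)) holomorphic_on UNIV"
proof -
  have sub: "exhausting_interval n \<subseteq> {0<..}" using exhausting_interval_pos by auto
  have "(\<lambda>s. integral (cbox (1 / (real n + 1)) (real n + 1)) (\<lambda>y. F y * of_real y powr (s - 1))) holomorphic_on UNIV"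
  proof (rule leibniz_rule_holomorphic)
    fix s :: complex and y :: real assume y: "y \<in> cbox (1 / (real n + 1)) (real n + 1)"
    then have "of_real y \<noteq> (0::complex)" using exhausting_interval_pos[of y n] by (simp add: exhausting_interval_def)
    then have "((\<lambda>s. of_real y powr (s - 1)) has_field_derivative
      Ln (of_real y) * of_real y powr (s - 1) * 1) (at s within UNIV)"
      by (intro DERIV_chain2[OF has_field_derivative_powr_right]) (auto intro!: derivative_eq_intros)
    from DERIV_cmult[OF this, of "F y"]
    show "((\<lambda>s. F y * of_real y powr (s - 1)) has_field_derivative
      F y * (of_real y powr (s - 1) * Ln (of_real y))) (at s within UNIV)"
      by (simp add: mult_ac)
  next
    fix s :: complex
    show "(\<lambda>y. F y * of_real y powr (s - 1)) integrable_on cbox (1 / (real n + 1)) (real n + 1)"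
      using integrand_continuous sub unfolding exhausting_interval_def
      by (intro integrable_continuous) (rule continuous_on_subset)
  next
    have F: "continuous_on (UNIV \<times> cbox (1 / (real n + 1)) (real n + 1)) (\<lambda>p :: complex \<times> real. F (snd p))"
      by (rule continuous_on_compose2[OF cont]) (use sub in \<open>auto simp: exhausting_interval_def intro!: continuous_intros\<close>)
    have "continuous_on (UNIV \<times> cbox (1 / (real n + 1)) (real n + 1))
      (\<lambda>p :: complex \<times> real. F (snd p) * (of_real (snd p) powr (fst p - 1) * Ln (of_real (snd p))))"
      using exhausting_interval_pos[of _ n] unfolding exhausting_interval_def
      by (intro continuous_intros F) force+
    then show "continuous_on (UNIV \<times> cbox (1 / (real n + 1)) (real n + 1))
      (\<lambda>(s, y). F y * (of_real y powr (s - 1) * Ln (of_real y)))"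
      by (simp add: case_prod_unfold)
  qed auto
  moreover have "(LBINT y:exhausting_interval n. F y * of_real y powr (s - 1))
      = integral (cbox (1 / (real n + 1)) (real n + 1)) (\<lambda>y. F y * of_real y powr (s - 1))" for s
  proof -
    have "set_integrable lborel (exhausting_interval n) (\<lambda>y. F y * of_real y powr (s - 1))"
      by (rule set_integrable_subset[OF integrable]) (use sub in \<open>auto simp: exhausting_interval_def\<close>)
    from set_borel_integral_eq_integral(2)[OF this] show ?thesis by (simp add: exhausting_interval_def)
  qed
  ultimately show ?thesis by simp
qed

text \<open>Over a closed unit disc in \<open>s\<close> the truncation error is at most the tail of
  one integrable majorant, so the transform is a locally uniform limit of entire functions.\<close>

theorem transform_entire: "transform holomorphic_on UNIV"
proof (rule holomorphic_uniform_sequence[OF open_UNIV truncated_holomorphic])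
  fix s0 :: complex
  obtain n where n: "\<bar>Re s0 - 1\<bar> + 1 \<le> real n" using real_arch_simple by blast
  obtain K where K: "K \<ge> 0" "\<And>y s. y > 0 \<Longrightarrow> \<bar>Re s - 1\<bar> \<le> real n \<Longrightarrow> cmod (F y * of_real y powr (s - 1)) \<le> K * exp (- (c / 2) * y)"
    using integrand_bound[of n] by blast
  let ?E = "\<lambda>y::real. K * exp (- (c / 2) * y)"
  have E: "set_integrable lborel {0<..} ?E"
    using c by (intro set_integrable_mult_right set_integrable_exp_minus) simp
  have Ib: "exhausting_interval i \<in> sets lborel" for i by (simp add: exhausting_interval_def)
  have sub: "exhausting_interval i \<subseteq> {0<..}" for i using exhausting_interval_pos by auto
  have EI: "set_integrable lborel (exhausting_interval i) ?E" for i by (rule set_integrable_subset[OF E Ib sub])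
  have split: "(LBINT y:{0<..}. g y) = (LBINT y:exhausting_interval i. g y) + (LBINT y:{0<..} - exhausting_interval i. g y)"
    if "set_integrable lborel {0<..} g" for g :: "real \<Rightarrow> 'b :: {banach, second_countable_topology}" and i
  proof -
    have "{0<..} = exhausting_interval i \<union> ({0<..} - exhausting_interval i)" using sub by blast
    then show ?thesis
      using set_integral_Un[of "exhausting_interval i" "{0<..} - exhausting_interval i" lborel g]
        set_integrable_subset[OF that Ib sub] set_integrable_subset[OF that, of "{0<..} - exhausting_interval i"] Ib by auto
  qed
  have lim: "(\<lambda>i. LBINT y:exhausting_interval i. ?E y) \<longlonglongrightarrow> (LBINT y:{0<..}. ?E y)"
    using set_integral_cont_up[OF Ib incseq_exhausting_interval, of ?E] E by (simp add: UN_exhausting_interval)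
  show "\<exists>d>0. cball s0 d \<subseteq> UNIV \<and>
    uniform_limit (cball s0 d) (\<lambda>i s. LBINT y:exhausting_interval i. F y * of_real y powr (s - 1)) transform sequentially"
  proof (intro exI[of _ 1] conjI uniform_limitI)
    fix e :: real assume e: "e > 0"
    have "eventually (\<lambda>i. dist (LBINT y:exhausting_interval i. ?E y) (LBINT y:{0<..}. ?E y) < e) sequentially"
      using lim e by (rule tendstoD)
    then show "eventually (\<lambda>i. \<forall>s\<in>cball s0 1. dist (LBINT y:exhausting_interval i. F y * of_real y powr (s - 1)) (transform s) < e) sequentially"
    proof (rule eventually_mono, intro ballI)
      fix i s assume small: "dist (LBINT y:exhausting_interval i. ?E y) (LBINT y:{0<..}. ?E y) < e" and s: "s \<in> cball s0 1"
      have "\<bar>Re s - Re s0\<bar> \<le> 1" using s abs_Re_le_cmod[of "s - s0"] by (simp add: dist_norm norm_minus_commute)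
      then have sn: "\<bar>Re s - 1\<bar> \<le> real n" using n by linarith
      have mem: "{0<..} - exhausting_interval i \<in> sets lborel" using Ib by auto
      have "transform s - (LBINT y:exhausting_interval i. F y * of_real y powr (s - 1)) = (LBINT y:{0<..} - exhausting_interval i. F y * of_real y powr (s - 1))"
        using split[OF integrable[of s], of i] by (simp add: transform_def)
      also have "cmod \<dots> \<le> (LBINT y:{0<..} - exhausting_interval i. cmod (F y * of_real y powr (s - 1)))"
        by (rule set_integral_norm_bound) (rule set_integrable_subset[OF integrable mem], simp)
      also have "\<dots> \<le> (LBINT y:{0<..} - exhausting_interval i. ?E y)"
      proof (rule set_integral_mono)
        show "set_integrable lborel ({0<..} - exhausting_interval i) (\<lambda>y. cmod (F y * of_real y powr (s - 1)))"
          by (intro set_integrable_norm set_integrable_subset[OF integrable mem]) simp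
        show "set_integrable lborel ({0<..} - exhausting_interval i) ?E"
          by (rule set_integrable_subset[OF E mem]) simp
      qed (use K(2)[OF _ sn] in auto)
      also have "\<dots> = (LBINT y:{0<..}. ?E y) - (LBINT y:exhausting_interval i. ?E y)" using split[OF E, of i] by simp
      also have "\<dots> < e" using small by (simp add: dist_real_def)
      finally show "dist (LBINT y:exhausting_interval i. F y * of_real y powr (s - 1)) (transform s) < e"
        by (simp add: dist_norm norm_minus_commute)
    qed
  qed auto
qed

end

text \<open>Euler's integral for Gamma after substituting \<open>t * y\<close>; the factor
  \<open>of_real t powr (1 - s)\<close> restores the power of \<open>y\<close>.\<close>

lemma mellin_exp:
  assumes t: "t > 0" and s: "Re s > 0"
  shows "has_bochner_integral lborel
    (\<lambda>y. indicator {0<..} y *\<^sub>R (of_real (exp (- t * y)) * of_real y powr (s - 1))) (Gamma s * of_real t powr (- s))"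
proof -
  let ?g = "\<lambda>y. complex_of_real y powr (s - 1) / of_real (exp y)"
  have meas: "(\<lambda>y. indicator {0<..} y *\<^sub>R ?g y) \<in> borel_measurable borel"
  proof -
    have "continuous_on {0<..} ?g" by (intro continuous_intros) auto
    then show ?thesis by (intro borel_measurable_continuous_on_indicator) auto
  qed
  have "set_integrable lebesgue {0<..} ?g" using absolutely_integrable_Gamma_integral'[OF s] .
  then have i: "set_integrable lborel {0<..} ?g"
    unfolding set_integrable_def using meas by (simp add: integrable_completion)
  have "(LBINT y:{0<..}. ?g y) = Gamma s"
    using set_borel_integral_eq_integral(2)[OF i] Gamma_integral_complex'[OF s] by (simp add: integral_unique)
  then have "has_bochner_integral lborel (\<lambda>y. indicator {0<..} y *\<^sub>R ?g y) (Gamma s)"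
    using i unfolding set_integrable_def set_lebesgue_integral_def has_bochner_integral_iff by simp
  then have "has_bochner_integral lborel (\<lambda>y. indicator {0<..} (0 + t * y) *\<^sub>R ?g (0 + t * y)) (Gamma s /\<^sub>R \<bar>t\<bar>)"
    using lborel_has_bochner_integral_real_affine_iff[of t _ "Gamma s" 0] t by fastforce
  then have "has_bochner_integral lborel (\<lambda>y. of_real t powr (1 - s) * (indicator {0<..} (0 + t * y) *\<^sub>R ?g (0 + t * y)))
     (of_real t powr (1 - s) * (Gamma s /\<^sub>R \<bar>t\<bar>))"
    by (rule has_bochner_integral_mult_right)
  moreover have "of_real t powr (1 - s) * (indicator {0<..} (0 + t * y) *\<^sub>R ?g (0 + t * y))
     = indicator {0<..} y *\<^sub>R (of_real (exp (- t * y)) * of_real y powr (s - 1))" for y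
  proof (cases "y > 0")
    case True
    have "(of_real t * of_real y) powr (s - 1) = of_real t powr (s - 1) * complex_of_real y powr (s - 1)"
      using t True by (intro powr_times_real) auto
    moreover have "of_real t powr (1 - s) * of_real t powr (s - 1) = (1::complex)"
      using t by (simp flip: powr_add)
    ultimately show ?thesis using True t by (simp add: exp_minus divide_inverse mult_ac)
  next
    case False
    then show ?thesis using t by (simp add: zero_less_mult_iff)
  qed
  moreover have "of_real t powr (1 - s) * (Gamma s /\<^sub>R \<bar>t\<bar>) = Gamma s * of_real t powr (- s)"
    using t by (simp add: powr_diff powr_minus scaleR_conv_of_real field_simps)
  ultimately show ?thesis by simp
qed

section \<open>The additive twists\<close>

context cusp_form_setting
begin

lemma stabiliser_infinity:
  "(g \<in> \<Gamma> \<or> - g \<in> \<Gamma>) \<and> moebius_P1 g None = None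
    \<longleftrightarrow> (\<exists>n::int. g = translation 1 (of_int n) \<or> g = - translation 1 (of_int n))"
  using width unfolding cusp_at_infinity_of_width_def Let_def translation_def sl2_def by simp

lemma uminus_translation: "- translation s h = translation (- s) (- h)"
  by (simp add: mat2_eq_iff translation_def)

text \<open>The width condition determines elements only up to sign; with either sign
  \<open>translation s s\<close> acts as \<open>z \<mapsto> z + 1\<close>.\<close>

lemma translation_mem:
  obtains s where "s = 1 \<or> s = -1" "translation s s \<in> \<Gamma>"
proof -
  have "translation 1 1 \<in> \<Gamma> \<or> - translation 1 1 \<in> \<Gamma>"
    using stabiliser_infinity[of "translation 1 1"] by (metis of_int_1)
  then show ?thesis using that[of 1] that[of "-1"] by (auto simp: uminus_translation)
qed

lemma slash_mat_1: "slash (mat 1) = f"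
  by (simp add: fun_eq_iff slash_def aut_j_def)

lemma f_periodic: "Im z > 0 \<Longrightarrow> f (z + 1) = f z"
proof -
  assume z: "Im z > 0"
  obtain s where s: "s = 1 \<or> s = -1" "translation s s \<in> \<Gamma>" by (rule translation_mem)
  have "s / s = 1" using s by auto
  then show ?thesis
    using slash_periodic[of "translation s s" "mat 1" s s z] s z by (simp add: slash_mat_1)
qed

lemma None_cusp: "None \<in> cusps \<Gamma>"
proof -
  obtain s where s: "s = 1 \<or> s = -1" "translation s s \<in> \<Gamma>" by (rule translation_mem)
  then have "moebius_P1 (mat 1) None \<in> cusps \<Gamma>" by (intro cusp_mem[of "translation s s" _ s s]) auto
  then show ?thesis by (simp add: moebius_P1_def)
qed

lemma f_tendsto_0: "(f \<longlongrightarrow> 0) (filtercomap Im at_top)"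
proof -
  have "moebius_P1 (mat 1) None \<in> cusps \<Gamma>" using None_cusp by (simp add: moebius_P1_def)
  then have "(slash (mat 1) \<longlongrightarrow> 0) (filtercomap Im at_top)"
    using cusp_form unfolding cusp_form_def slash_def[abs_def] by (metis det_I)
  then show ?thesis by (simp add: slash_mat_1)
qed

lemma f_decay_at_infinity:
  assumes "Y > 0"
  obtains C c where "C \<ge> 0" "c > 0" "\<And>z. Im z \<ge> Y \<Longrightarrow> cmod (f z) \<le> C * exp (- c * Im z)"
proof -
  obtain s where s: "s = 1 \<or> s = -1" "translation s s \<in> \<Gamma>" by (rule translation_mem)
  show ?thesis
  proof (rule slash_decay[OF s(2) _ s(1) _ _ assms, of "mat 1" s])
    fix C c assume "C \<ge> 0" "c > 0" "\<And>z. Y \<le> Im z \<Longrightarrow> cmod (slash (mat 1) z) \<le> C * exp (- c * Im z)"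
    then show thesis using that by (simp add: slash_mat_1)
  qed (use s in auto)
qed

abbreviation a :: "nat \<Rightarrow> complex" where "a \<equiv> fourier_coeff f"

lemma a_0: "a 0 = 0"
  by (rule fourier_expansion(1)[OF f_holomorphic f_periodic f_tendsto_0])

lemma a_sums: "Im z > 0 \<Longrightarrow> (\<lambda>n. a n * e2pi (of_nat n * z)) sums f z"
  by (rule fourier_expansion(2)[OF f_holomorphic f_periodic f_tendsto_0])

lemma a_abs_summable:
  assumes "y > 0"
  shows "summable (\<lambda>n. cmod (a n) * exp (- 2 * pi * y * real n))"
proof -
  define q0 q where "q0 = e2pi (\<i> * of_real (y / 2))" and "q = e2pi (\<i> * of_real y)"
  have "summable (\<lambda>n. a n * q0 ^ n)"
  proof -
    have "Im (\<i> * of_real (y / 2)) > 0" using assms by simp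
    from sums_summable[OF a_sums[OF this]] show ?thesis by (simp only: q0_def e2pi_of_nat_mult)
  qed
  moreover have "cmod q < cmod q0" using assms by (simp add: q_def q0_def norm_e2pi)
  ultimately have "summable (\<lambda>n. norm (a n * q ^ n))" by (rule powser_insidea)
  moreover have "norm (a n * q ^ n) = cmod (a n) * exp (- 2 * pi * y * real n)" for n
  proof -
    have "norm (q ^ n) = exp (real n * (- 2 * pi * y))"
      unfolding norm_power exp_of_nat_mult by (simp add: q_def norm_e2pi)
    then show ?thesis by (simp add: norm_mult mult_ac)
  qed
  ultimately show ?thesis by simp
qed

text \<open>On the horizontal line at height \<open>1/N\<close> the bound for \<open>phi\<close>
  gives \<open>|f|^2 \<le> C * N^k\<close>, and Bessel's inequality passes this to the coefficients
  damped by \<open>exp (- 2 * pi * n / N)\<close>.\<close>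

lemma coeff_mean_square:
  obtains C where "C \<ge> 0" "\<And>N. N > 0 \<Longrightarrow> (\<Sum>n<N. (cmod (a n))\<^sup>2) \<le> C * real N ^ k"
proof -
  obtain C where C: "C > 0" "\<And>z. Im z > 0 \<Longrightarrow> (cmod (f z))\<^sup>2 * Im z ^ k \<le> C"
    using phi_bounded by blast
  show ?thesis
  proof (rule that[of "exp (4 * pi) * C"])
    show "exp (4 * pi) * C \<ge> 0" using C by simp
    fix N :: nat assume N: "N > 0"
    define y where "y = 1 / real N"
    have y: "y > 0" using N by (simp add: y_def)
    define b where "b n = a n * e2pi (of_nat n * (\<i> * of_real y))" for n
    have nb: "cmod (b n) = cmod (a n) * exp (- 2 * pi * y * real n)" for n
      by (simp add: b_def norm_mult norm_e2pi mult_ac)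
    have "(\<Sum>n<N. (cmod (b n))\<^sup>2) \<le> (sqrt (C / y ^ k))\<^sup>2"
    proof (rule bessel_fourier[where G = "\<lambda>x. f (of_real x + \<i> * of_real y)"])
      show "(\<lambda>n. b n * e2pi (of_nat n * of_real x)) sums f (of_real x + \<i> * of_real y)" for x
        using a_sums[of "of_real x + \<i> * of_real y"] y
        by (simp add: b_def e2pi_add mult.assoc algebra_simps)
      show "summable (\<lambda>n. cmod (b n))" using a_abs_summable[OF y] by (simp add: nb)
      show "cmod (f (of_real x + \<i> * of_real y)) \<le> sqrt (C / y ^ k)" for x
        using C(2)[of "of_real x + \<i> * of_real y"] y by (intro real_le_rsqrt) (simp add: field_simps)
    qed
    also have "\<dots> = C * real N ^ k" using C by (simp add: y_def power_one_over field_simps)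
    finally have le: "(\<Sum>n<N. (cmod (b n))\<^sup>2) \<le> C * real N ^ k" .
    \<comment> \<open>Undoing the squared damping for \<open>n < N\<close> costs at most
      \<open>exp (4 * pi)\<close>.\<close>
    have "(\<Sum>n<N. (cmod (a n))\<^sup>2) \<le> (\<Sum>n<N. exp (4 * pi) * (cmod (b n))\<^sup>2)"
    proof (rule sum_mono)
      fix n assume "n \<in> {..<N}"
      then have "real n / real N \<le> 1" using N by simp
      then have "pi * (real n / real N) \<le> pi" using mult_left_mono[of "real n / real N" 1 pi] by simp
      then have "1 \<le> exp (4 * pi - 4 * pi * y * real n)" by (simp add: y_def)
      then have "(cmod (a n))\<^sup>2 * 1 \<le> (cmod (a n))\<^sup>2 * exp (4 * pi - 4 * pi * y * real n)"
        by (intro mult_left_mono) auto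
      also have "\<dots> = exp (4 * pi) * (cmod (b n))\<^sup>2"
        by (simp add: nb power_mult_distrib exp_diff exp_minus field_simps flip: exp_double)
      finally show "(cmod (a n))\<^sup>2 \<le> exp (4 * pi) * (cmod (b n))\<^sup>2" by simp
    qed
    also have "\<dots> \<le> exp (4 * pi) * (C * real N ^ k)"
      using le by (simp flip: sum_distrib_left)
    finally show "(\<Sum>n<N. (cmod (a n))\<^sup>2) \<le> exp (4 * pi) * C * real N ^ k" by simp
  qed
qed

lemma dirichlet_abs_summable:
  assumes "s > (real k + 1) / 2"
  shows "summable (\<lambda>n. cmod (a n) * real n powr (- s))"
proof -
  obtain C where "C \<ge> 0" "\<And>N. N > 0 \<Longrightarrow> (\<Sum>n<N. (cmod (a n))\<^sup>2) \<le> C * real N ^ k"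
    using coeff_mean_square by blast
  then show ?thesis using assms by (intro summable_dyadic[of _ C k]) auto
qed

text \<open>The conjugating matrix sends infinity to \<open>r\<close>, so the conjugate
  \<open>g0\<close> fixes infinity and is upper triangular; trace 2 or -2 makes its diagonal
  constant.\<close>

lemma parabolic_conj:
  assumes g: "g \<in> \<Gamma>" "parabolic g" "moebius_P1 g (Some r) = Some r"
  obtains s h where "s = 1 \<or> s = -1" "h \<noteq> 0" "g ** sl2 r (-1) 1 0 = sl2 r (-1) 1 0 ** translation s h"
proof -
  define \<sigma> where "\<sigma> = sl2 r (-1) 1 0"
  have d\<sigma>: "det \<sigma> = 1" by (simp add: \<sigma>_def det_2)
  define g0 where "g0 = adj2 \<sigma> ** g ** \<sigma>"
  define s h where "s = entry g0 1 1" and "h = entry g0 1 2"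
  have d: "det g = 1" and tr: "\<bar>trace g\<bar> = 2" and nc: "\<not> central g"
    using g det_1 by (auto simp: parabolic_def central_def mat_minus1)
  have "entry g 2 1 * r + entry g 2 2 \<noteq> 0"
    "entry g 1 1 * r + entry g 1 2 = r * (entry g 2 1 * r + entry g 2 2)"
    using g(3) by (auto simp: moebius_P1_def field_simps split: if_splits)
  then have z: "entry g0 2 1 = 0" by (simp add: g0_def \<sigma>_def entry_mult algebra_simps)
  have "det g0 = 1" using d d\<sigma> by (simp add: g0_def det_mul)
  then have ad: "s * entry g0 2 2 = 1" using z by (simp add: det_2 s_def)
  have "trace g0 = trace g" by (simp add: g0_def \<sigma>_def trace_mat2 entry_mult algebra_simps)
  then have "\<bar>s + entry g0 2 2\<bar> = 2" using tr by (simp add: trace_mat2 s_def)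
  \<comment> \<open>With product 1 and squared sum 4, the two diagonal entries have squared
    difference \<open>4 - 4 = 0\<close>.\<close>
  then have "(s + entry g0 2 2)\<^sup>2 = 2\<^sup>2" by (metis power2_abs)
  then have "(s - entry g0 2 2)\<^sup>2 = 0" using ad by (simp add: power2_eq_square algebra_simps)
  then have eq: "entry g0 2 2 = s" by simp
  then have s: "s = 1 \<or> s = -1" using ad by (metis power2_eq_1_iff power2_eq_square)
  have g0: "g0 = translation s h" using z eq by (simp add: mat2_eq_iff translation_def s_def h_def)
  have e: "g ** \<sigma> = \<sigma> ** g0"
  proof -
    have "\<sigma> ** g0 = (\<sigma> ** adj2 \<sigma>) ** g ** \<sigma>" by (simp add: g0_def matrix_mul_assoc)
    then show ?thesis using d\<sigma> by (simp add: adj2_mult)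
  qed
  have "h \<noteq> 0"
  proof
    assume "h = 0"
    then have "g0 = mat s" using g0 by (simp add: mat2_eq_iff translation_def)
    then have "g ** \<sigma> = mat s ** \<sigma>" using e by (simp add: mat2_eq_iff entry_mult)
    then have "g ** (\<sigma> ** adj2 \<sigma>) = mat s ** (\<sigma> ** adj2 \<sigma>)" by (simp add: matrix_mul_assoc)
    then have "g = mat s" using d\<sigma> by (simp add: adj2_mult)
    then show False using nc s by (auto simp: central_def)
  qed
  then show ?thesis using that s e g0 by (simp add: \<sigma>_def)
qed

text \<open>For \<open>y \<ge> 1\<close> this is decay at infinity. For \<open>y < 1\<close> the
  point \<open>r + i y\<close> is the image of \<open>w = i / y\<close> under the matrix taking
  infinity to \<open>r\<close>, whose automorphy factor at \<open>w\<close> is \<open>w\<close>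
  itself; half of the decay of \<open>slash\<close> absorbs the resulting power of
  \<open>1/y\<close>.\<close>

lemma cusp_decay:
  assumes r: "Some r \<in> cusps \<Gamma>"
  obtains C c where "C \<ge> 0" "c > 0" "\<And>y. y > 0 \<Longrightarrow> cmod (f (Complex r y)) \<le> C * exp (- c * (y + 1 / y))"
proof -
  obtain g where g: "g \<in> \<Gamma>" "parabolic g" "moebius_P1 g (Some r) = Some r"
    using r by (auto simp: cusps_def)
  define \<sigma> where "\<sigma> = sl2 r (-1) 1 0"
  obtain s h where sh: "s = 1 \<or> s = -1" "h \<noteq> 0" "g ** \<sigma> = \<sigma> ** translation s h"
    unfolding \<sigma>_def by (rule parabolic_conj[OF g])
  have d\<sigma>: "det \<sigma> = 1" by (simp add: \<sigma>_def det_2)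
  obtain C2 c2 where 2: "C2 \<ge> 0" "c2 > 0" "\<And>z. Im z \<ge> 1 \<Longrightarrow> cmod (slash \<sigma> z) \<le> C2 * exp (- c2 * Im z)"
    using slash_decay[OF g(1) d\<sigma> sh, of 1] by auto
  obtain C1 c1 where 1: "C1 \<ge> 0" "c1 > 0" "\<And>z. Im z \<ge> 1 \<Longrightarrow> cmod (f z) \<le> C1 * exp (- c1 * Im z)"
    using f_decay_at_infinity[of 1] by auto
  define K where "K = C2 * (real k / (c2 / 2)) ^ k"
  have K: "K \<ge> 0" using 2 by (simp add: K_def)
  \<comment> \<open>\<open>y + 1/y\<close> is at most \<open>2 y\<close> in the first case and
    \<open>2 / y\<close> in the second, where only the rate \<open>c2 / 2\<close> is left.\<close>
  define c where "c = min (c1 / 2) (c2 / 4)"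
  have c: "c > 0" "c \<le> c1 / 2" "c \<le> c2 / 4" using 1 2 by (auto simp: c_def)
  show ?thesis
  proof (rule that[of "max C1 K" c])
    show "max C1 K \<ge> 0" using 1 by simp
    fix y :: real assume y: "y > 0"
    show "cmod (f (Complex r y)) \<le> max C1 K * exp (- c * (y + 1 / y))"
    proof (cases "y \<ge> 1")
      case True
      have "1 / y \<le> 1" using True by simp
      then have "1 / y \<le> y" using True by linarith
      then have "c * (y + 1 / y) \<le> (c1 / 2) * (2 * y)" using c y by (intro mult_mono) auto
      then have "exp (- c1 * y) \<le> exp (- c * (y + 1 / y))" by simp
      then have "C1 * exp (- c1 * y) \<le> max C1 K * exp (- c * (y + 1 / y))"
        using 1 by (intro mult_mono) auto
      then show ?thesis using 1(3)[of "Complex r y"] True by simp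
    next
      case False
      define w where "w = Complex 0 (1 / y)"
      have jw: "aut_j \<sigma> w = w" by (simp add: \<sigma>_def aut_j_def)
      have w0: "w \<noteq> 0" using y by (simp add: w_def complex_eq_iff)
      have mw: "moebius \<sigma> w = Complex r y"
      proof -
        have "w * Complex r y = of_real r * w - 1" using y by (simp add: w_def complex_eq_iff)
        then show ?thesis using w0 unfolding moebius_def jw by (simp add: \<sigma>_def field_simps)
      qed
      have nw: "cmod w = 1 / y" using y by (simp add: w_def cmod_def)
      have "f (Complex r y) = slash \<sigma> w * w ^ k" using w0 by (simp add: slash_def mw jw)
      then have "cmod (f (Complex r y)) = cmod (slash \<sigma> w) * (1 / y) ^ k"
        by (simp add: norm_mult norm_power nw)
      also have "\<dots> \<le> (C2 * exp (- c2 * (1 / y))) * (1 / y) ^ k"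
      proof (rule mult_right_mono)
        have "1 \<le> 1 / y" using False y by (simp add: field_simps)
        then show "cmod (slash \<sigma> w) \<le> C2 * exp (- c2 * (1 / y))"
          using 2(3)[of w] by (simp add: w_def)
      qed (use y in auto)
      also have "\<dots> = C2 * ((1 / y) ^ k * exp (- (c2 / 2) * (1 / y))) * exp (- (c2 / 2) * (1 / y))"
        by (simp add: mult_ac flip: exp_add)
      also have "\<dots> \<le> K * exp (- (c2 / 2) * (1 / y))"
        unfolding K_def using power_exp_bound[of "c2 / 2" "1 / y" k] 2 y
        by (intro mult_right_mono mult_left_mono) auto
      also have "\<dots> \<le> max C1 K * exp (- c * (y + 1 / y))"
      proof (rule mult_mono)
        have "1 \<le> 1 / y" using False y by (simp add: field_simps)
        then have "y \<le> 1 / y" using False by linarith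
        then have "c * (y + 1 / y) \<le> (c2 / 4) * (2 * (1 / y))" using c y by (intro mult_mono) auto
        then show "exp (- (c2 / 2) * (1 / y)) \<le> exp (- c * (y + 1 / y))" by simp
      qed (use K in auto)
      finally show ?thesis .
    qed
  qed (use c in auto)
qed

lemma f_vertical_continuous: "continuous_on {0<..} (\<lambda>y. f (Complex r y))"
proof (rule continuous_on_compose2[OF holomorphic_on_imp_continuous_on[OF f_holomorphic]])
  show "continuous_on {0<..} (\<lambda>y. Complex r y)" by (intro continuous_intros)
qed (auto simp: upper_half_plane_def)

section \<open>Analytic continuation of the twisted series\<close>

definition \<Lambda> :: "real \<Rightarrow> complex \<Rightarrow> complex" where
  "\<Lambda> r s = (LBINT y:{0<..}. f (Complex r y) * of_real y powr (s - 1))"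

lemma
  assumes "Some r \<in> cusps \<Gamma>"
  shows \<Lambda>_entire: "\<Lambda> r holomorphic_on UNIV"
    and \<Lambda>_integrable: "set_integrable lborel {0<..} (\<lambda>y. f (Complex r y) * of_real y powr (s - 1))"
proof -
  obtain C c where C: "C \<ge> 0" "c > 0" "\<And>y. y > 0 \<Longrightarrow> cmod (f (Complex r y)) \<le> C * exp (- c * (y + 1 / y))"
    using cusp_decay assms by blast
  interpret mellin "\<lambda>y. f (Complex r y)" C c
    by unfold_locales (use C f_vertical_continuous in auto)
  show "\<Lambda> r holomorphic_on UNIV"
    using transform_entire by (simp add: transform_def[abs_def] \<Lambda>_def[abs_def])
  show "set_integrable lborel {0<..} (\<lambda>y. f (Complex r y) * of_real y powr (s - 1))"
    by (rule integrable)
qed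

text \<open>Termwise integration of the Fourier series, justified by absolute convergence. The
  factor is written with \<open>rGamma\<close> because that function is entire, so the right-hand
  side makes sense for every \<open>s\<close>.\<close>

lemma dirichlet_sums_\<Lambda>:
  assumes s: "Re s > (real k + 1) / 2"
  shows "(\<lambda>n. a n * e2pi (of_nat n * of_real r) * of_nat n powr (- s)) sums
     (of_real (2 * pi) powr s * rGamma s * \<Lambda> r s)"
proof -
  have s0: "Re s > 0" using s by (smt (verit) divide_nonneg_nonneg of_nat_0_le_iff)
  define g where "g n y = indicator {0<..} y *\<^sub>R
      (a n * e2pi (of_nat n * of_real r) * (of_real (exp (- (2 * pi * real n) * y)) * of_real y powr (s - 1)))" for n and y :: real
  have ne: "cmod (e2pi (of_nat n * of_real r)) = 1" for n by (simp add: norm_e2pi)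
  have bochner: "has_bochner_integral lborel (g n)
      (a n * e2pi (of_nat n * of_real r) * (Gamma s * of_real (2 * pi * real n) powr (- s)))" for n
  proof (cases "n = 0")
    case True
    then show ?thesis using a_0 by (simp add: g_def[abs_def] has_bochner_integral_zero)
  next
    case False
    then have "2 * pi * real n > 0" by simp
    from has_bochner_integral_mult_right[OF mellin_exp[OF this s0], of "a n * e2pi (of_nat n * of_real r)"]
    show ?thesis by (simp add: g_def[abs_def])
  qed
  \<comment> \<open>The absolute integral of a term is the same Mellin integral at the real point
    \<open>Re s\<close>.\<close>
  have norm_bochner: "has_bochner_integral lborel (\<lambda>y. norm (g n y))
      (cmod (a n) * (Gamma (Re s) * (2 * pi * real n) powr (- Re s)))" for n
  proof (cases "n = 0")
    case True
    then show ?thesis using a_0 by (simp add: g_def has_bochner_integral_zero)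
  next
    case False
    then have t: "2 * pi * real n > 0" by simp
    have "Re (complex_of_real (Re s)) > 0" using s0 by simp
    from has_bochner_integral_mult_right[OF has_bochner_integral_Re[OF mellin_exp[OF t this]], of "cmod (a n)"]
    have "has_bochner_integral lborel
      (\<lambda>y. cmod (a n) * Re (indicator {0<..} y *\<^sub>R (of_real (exp (- (2 * pi * real n) * y)) * of_real y powr (of_real (Re s) - 1))))
      (cmod (a n) * Re (Gamma (of_real (Re s)) * of_real (2 * pi * real n) powr (- of_real (Re s))))" .
    moreover have "Re (Gamma (of_real (Re s)) * of_real (2 * pi * real n) powr (- of_real (Re s)))
       = Gamma (Re s) * (2 * pi * real n) powr (- Re s)"
    proof -
      have "Gamma (of_real (Re s)) * complex_of_real (2 * pi * real n) powr (- of_real (Re s))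
         = of_real (Gamma (Re s) * (2 * pi * real n) powr (- Re s))"
        using t by (simp only: Gamma_complex_of_real of_real_mult powr_of_real[symmetric] of_real_minus[symmetric] less_imp_le)
      then show ?thesis by (simp only: Re_complex_of_real)
    qed
    moreover have "cmod (a n) * Re (indicator {0<..} y *\<^sub>R (of_real (exp (- (2 * pi * real n) * y)) * of_real y powr (of_real (Re s) - 1)))
       = norm (g n y)" for y
    proof (cases "y > 0")
      case True
      have "complex_of_real (exp (- (2 * pi * real n) * y)) * of_real y powr (of_real (Re s) - 1)
          = of_real (exp (- (2 * pi * real n) * y) * y powr (Re s - 1))"
        using True by (simp add: powr_of_real[symmetric] del: of_real_exp exp_of_real)
      then show ?thesis using True by (simp add: g_def norm_mult ne norm_of_real_powr del: of_real_exp)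
    qed (simp add: g_def)
    ultimately show ?thesis by simp
  qed
  have "(\<lambda>n. integral\<^sup>L lborel (g n)) sums (\<integral>y. (\<Sum>n. g n y) \<partial>lborel)"
  proof (rule sums_integral)
    show "integrable lborel (g n)" for n using bochner[of n] by (simp add: has_bochner_integral_iff)
    show "AE y in lborel. summable (\<lambda>n. norm (g n y))"
    proof (rule AE_I2)
      fix y :: real
      show "summable (\<lambda>n. norm (g n y))"
      proof (cases "y > 0")
        case True
        have "norm (g n y) = cmod (a n) * exp (- 2 * pi * y * real n) * y powr (Re s - 1)" for n
          using True by (simp add: g_def norm_mult ne norm_of_real_powr mult_ac)
        then show ?thesis using summable_mult2[OF a_abs_summable[OF True]] by simp
      qed (simp add: g_def)
    qed
    have "(\<integral>y. norm (g n y) \<partial>lborel) = (Gamma (Re s) * (2 * pi) powr (- Re s)) * (cmod (a n) * real n powr (- Re s))" for n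
      using norm_bochner[of n] by (simp add: has_bochner_integral_iff powr_mult mult_ac)
    then show "summable (\<lambda>n. \<integral>y. norm (g n y) \<partial>lborel)"
      using summable_mult[OF dirichlet_abs_summable[OF s]] by simp
  qed
  moreover have "(\<integral>y. (\<Sum>n. g n y) \<partial>lborel) = \<Lambda> r s"
    unfolding \<Lambda>_def set_lebesgue_integral_def
  proof (rule Bochner_Integration.integral_cong)
    fix y :: real
    show "(\<Sum>n. g n y) = indicat_real {0<..} y *\<^sub>R (f (Complex r y) * of_real y powr (s - 1))"
    proof (cases "y > 0")
      case True
      have "e2pi (of_nat n * Complex r y) = e2pi (of_nat n * of_real r) * of_real (exp (- (2 * pi * real n) * y))" for n
      proof -
        have "of_nat n * Complex r y = of_nat n * of_real r + of_nat n * (\<i> * of_real y)"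
          by (simp add: complex_eq_iff)
        moreover have "e2pi (of_nat n * (\<i> * of_real y)) = of_real (exp (- (2 * pi * real n) * y))"
          by (simp add: e2pi_def exp_of_real[symmetric] mult_ac)
        ultimately show ?thesis by (simp only: e2pi_add)
      qed
      then have "(\<lambda>n. g n y) sums (f (Complex r y) * of_real y powr (s - 1))"
        using sums_mult2[OF a_sums[of "Complex r y"], of "of_real y powr (s - 1)"] True
        by (simp add: g_def mult_ac del: of_real_exp)
      then show ?thesis using True by (simp add: sums_iff)
    qed (simp add: g_def)
  qed simp
  ultimately have "(\<lambda>n. of_real (2 * pi) powr s * rGamma s * integral\<^sup>L lborel (g n)) sums
     (of_real (2 * pi) powr s * rGamma s * \<Lambda> r s)"
    by (intro sums_mult) simp
  moreover have "of_real (2 * pi) powr s * rGamma s * integral\<^sup>L lborel (g n)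
     = a n * e2pi (of_nat n * of_real r) * of_nat n powr (- s)" for n
  proof -
    have "Gamma s \<noteq> 0" using s0 by (auto simp: Gamma_eq_zero_iff elim!: nonpos_Ints_cases)
    then have G: "rGamma s * Gamma s = 1" by (simp add: rGamma_inverse_Gamma)
    have P: "of_real (2 * pi) powr s * of_real (2 * pi) powr (- s) = (1 :: complex)"
      by (simp flip: powr_add)
    have "complex_of_real (2 * pi * real n) powr (- s) = of_real (2 * pi) powr (- s) * of_nat n powr (- s)"
      using powr_times_real[of "of_real (2 * pi)" "of_nat n" "- s"] by simp
    moreover have "integral\<^sup>L lborel (g n) = a n * e2pi (of_nat n * of_real r) * (Gamma s * of_real (2 * pi * real n) powr (- s))"
      using bochner[of n] by (simp add: has_bochner_integral_iff)
    ultimately have "of_real (2 * pi) powr s * rGamma s * integral\<^sup>L lborel (g n)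
      = (of_real (2 * pi) powr s * of_real (2 * pi) powr (- s)) * (rGamma s * Gamma s)
        * (a n * e2pi (of_nat n * of_real r) * of_nat n powr (- s))"
      by (simp only: mult_ac)
    then show ?thesis by (simp only: G P mult_1)
  qed
  ultimately show ?thesis by simp
qed

text \<open>The right-hand side is an entire extension of the Dirichlet series, and the identity
  theorem makes it the only one, so the definite description is resolved.\<close>

theorem additive_twist_L_eq:
  assumes r: "Some r \<in> cusps \<Gamma>"
  shows "additive_twist_L f k r s = of_real (2 * pi) powr s * rGamma s * \<Lambda> r s"
proof -
  define M where "M s = of_real (2 * pi) powr s * rGamma s * \<Lambda> r s" for s
  define P where "P L \<longleftrightarrow> L holomorphic_on UNIV \<and>
        (\<forall>s. Re s > (real k + 1) / 2 \<longrightarrow>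
           (\<lambda>n. a n * e2pi (of_nat n * of_real r) * of_nat n powr (- s)) sums L s)" for L
  have PM: "P M"
    unfolding P_def M_def[abs_def]
    by (intro conjI holomorphic_intros \<Lambda>_entire r allI impI dirichlet_sums_\<Lambda>) auto
  moreover have "L = M" if "P L" for L
  proof
    fix s
    show "L s = M s"
    proof (rule analytic_continuation_open[where s = "{s. Re s > (real k + 1) / 2}" and s' = UNIV and f = L and g = M])
      show "{s. Re s > (real k + 1) / 2} \<noteq> {}"
        by (auto intro!: exI[of _ "of_real (real k + 2)"])
      show "L z = M z" if "z \<in> {s. Re s > (real k + 1) / 2}" for z
        using \<open>P L\<close> PM that sums_unique2 unfolding P_def by blast
      show "open {s. Re s > (real k + 1) / 2}" by (rule open_halfspace_Re_gt)
    qed (use \<open>P L\<close> PM in \<open>auto simp: P_def\<close>)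
  qed
  ultimately have "(THE L. P L) = M" by (intro the_equality)
  then show ?thesis by (simp add: additive_twist_L_def P_def M_def)
qed

lemma additive_twist_L_dirichlet:
  assumes "Some r \<in> cusps \<Gamma>" "Re s > (real k + 1) / 2"
  shows "additive_twist_L f k r s = (\<Sum>n. a n * e2pi (of_nat n * of_real r) * of_nat n powr (- s))"
  using dirichlet_sums_\<Lambda>[OF assms(2), of r] by (simp add: additive_twist_L_eq[OF assms(1)] sums_iff)

text \<open>The Weierstrass majorant does not involve \<open>r\<close>. Continuity holds on the
  whole real line, which provides values between the cusps.\<close>

lemma dirichlet_continuous:
  assumes s: "Re s > (real k + 1) / 2"
  shows "continuous_on UNIV (\<lambda>r. \<Sum>n. a n * e2pi (of_nat n * of_real r) * of_nat n powr (- s))"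
proof (rule uniform_limit_theorem)
  show "uniform_limit UNIV (\<lambda>N r. \<Sum>n<N. a n * e2pi (of_nat n * of_real r) * of_nat n powr (- s))
     (\<lambda>r. \<Sum>n. a n * e2pi (of_nat n * of_real r) * of_nat n powr (- s)) sequentially"
  proof (rule Weierstrass_m_test)
    show "summable (\<lambda>n. cmod (a n) * real n powr (- Re s))" by (rule dirichlet_abs_summable[OF s])
    show "cmod (a n * e2pi (of_nat n * of_real r) * of_nat n powr (- s)) \<le> cmod (a n) * real n powr (- Re s)" for n r
      using norm_powr_real_powr[of "of_nat n" "- s"] by (simp add: norm_mult norm_e2pi)
  qed
  show "\<forall>\<^sub>F N in sequentially. continuous_on UNIV (\<lambda>r. \<Sum>n<N. a n * e2pi (of_nat n * of_real r) * of_nat n powr (- s))"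
    unfolding e2pi_def by (intro always_eventually allI continuous_intros)
qed simp

end

section \<open>The period relation\<close>

text \<open>Integrability alone yields the limits of the primitive at both ends, because
  \<open>\<Phi>\<close> differs from its value at 1 by an integral over a truncated
  interval.\<close>

lemma half_line_FTC:
  fixes \<Phi> \<phi> :: "real \<Rightarrow> complex"
  assumes der: "\<And>y. y > 0 \<Longrightarrow> (\<Phi> has_vector_derivative \<phi> y) (at y)"
    and int: "set_integrable lborel {0<..} \<phi>"
  obtains l0 l1 where "(\<Phi> \<longlongrightarrow> l0) (at_right 0)" "(\<Phi> \<longlongrightarrow> l1) at_top" "(LBINT y:{0<..}. \<phi> y) = l1 - l0"
proof -
  have ftc: "(LBINT y:{x..z}. \<phi> y) = \<Phi> z - \<Phi> x" if "0 < x" "x \<le> z" for x z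
  proof -
    have "set_integrable lborel {x..z} \<phi>"
      by (rule set_integrable_subset[OF int]) (use that in auto)
    then have "(LBINT y:{x..z}. \<phi> y) = integral {x..z} \<phi>"
      by (rule set_borel_integral_eq_integral(2))
    also have "(\<phi> has_integral (\<Phi> z - \<Phi> x)) {x..z}"
      using that der by (intro fundamental_theorem_of_calculus) (auto intro: has_vector_derivative_at_within)
    then have "integral {x..z} \<phi> = \<Phi> z - \<Phi> x" by (rule integral_unique)
    finally show ?thesis .
  qed
  define l0 where "l0 = \<Phi> 1 - (LBINT y:{0<..1}. \<phi> y)"
  define l1 where "l1 = \<Phi> 1 + (LBINT y:{1..}. \<phi> y)"
  have "((\<lambda>x. LBINT y:{x..1}. \<phi> y) \<longlongrightarrow> (LBINT y:{0<..1}. \<phi> y)) (at_right 0)"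
    by (rule tendsto_set_lebesgue_integral_at_right) (auto intro: set_integrable_subset[OF int])
  then have "((\<lambda>x. \<Phi> 1 - (LBINT y:{x..1}. \<phi> y)) \<longlongrightarrow> l0) (at_right 0)"
    unfolding l0_def by (intro tendsto_intros)
  moreover have "\<forall>\<^sub>F x in at_right 0. \<Phi> 1 - (LBINT y:{x..1}. \<phi> y) = \<Phi> x"
    by (rule eventually_at_rightI[of 0 1]) (auto simp: ftc)
  ultimately have 0: "(\<Phi> \<longlongrightarrow> l0) (at_right 0)" by (rule Lim_transform_eventually)
  have "((\<lambda>x. LBINT y:{1..x}. \<phi> y) \<longlongrightarrow> (LBINT y:{1..}. \<phi> y)) at_top"
    by (rule tendsto_set_lebesgue_integral_at_top) (auto intro: set_integrable_subset[OF int])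
  then have "((\<lambda>x. \<Phi> 1 + (LBINT y:{1..x}. \<phi> y)) \<longlongrightarrow> l1) at_top"
    unfolding l1_def by (intro tendsto_intros)
  moreover have "\<forall>\<^sub>F x in at_top. \<Phi> 1 + (LBINT y:{1..x}. \<phi> y) = \<Phi> x"
    using eventually_ge_at_top[of 1] by eventually_elim (simp add: ftc)
  ultimately have 1: "(\<Phi> \<longlongrightarrow> l1) at_top" by (rule Lim_transform_eventually)
  have "exhausting_interval n \<in> sets lborel" for n by (simp add: exhausting_interval_def)
  from set_integral_cont_up[OF this incseq_exhausting_interval, of \<phi>]
  have "(\<lambda>n. LBINT y:exhausting_interval n. \<phi> y) \<longlonglongrightarrow> (LBINT y:{0<..}. \<phi> y)"
    using int by (simp add: UN_exhausting_interval)
  moreover have "(LBINT y:exhausting_interval n. \<phi> y) = \<Phi> (real n + 1) - \<Phi> (1 / (real n + 1))" for n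
  proof -
    have "1 / (real n + 1) \<le> real n + 1" by (simp add: field_simps add_increasing)
    then show ?thesis unfolding exhausting_interval_def by (simp add: ftc)
  qed
  moreover have "(\<lambda>n. \<Phi> (real n + 1) - \<Phi> (1 / (real n + 1))) \<longlonglongrightarrow> l1 - l0"
  proof (intro tendsto_diff)
    show "(\<lambda>n. \<Phi> (real n + 1)) \<longlonglongrightarrow> l1"
      by (rule filterlim_compose[OF 1]) real_asymp
    show "(\<lambda>n. \<Phi> (1 / (real n + 1))) \<longlonglongrightarrow> l0"
      by (rule filterlim_compose[OF 0]) real_asymp
  qed
  ultimately have "(LBINT y:{0<..}. \<phi> y) = l1 - l0" by (simp add: LIMSEQ_unique)
  with 0 1 show ?thesis using that by blast
qed

lemma convex_combination_same: "(1 - t) * x + t * x = (x::real)"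
  by (simp add: algebra_simps)

lemma convex_combination_diff: "(1 - t) * (x + d) + t * x - x = (1 - t) * (d::real)"
  by (simp add: algebra_simps)

lemma vertical_derivative:
  assumes "(G has_field_derivative D) (at (Complex x y))"
  shows "((\<lambda>y. G (Complex x y)) has_vector_derivative (\<i> * D)) (at y)"
proof -
  have "((\<lambda>y. of_real x + of_real y * \<i>) has_vector_derivative \<i>) (at y)"
    by (auto intro!: derivative_eq_intros)
  moreover have "(\<lambda>y. of_real x + of_real y * \<i>) = Complex x" by (auto simp: complex_eq_iff)
  ultimately have "(Complex x has_vector_derivative \<i>) (at y)" by simp
  from field_vector_diff_chain_at[OF this assms] show ?thesis by (simp add: o_def)
qed

context cusp_form_setting
begin

text \<open>The exponent in \<open>\<Lambda>\<close> is \<open>s - 1\<close>, so the moment of order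
  \<open>n\<close> sits at \<open>s = n + 1\<close>.\<close>

lemma \<Lambda>_power_integrable:
  assumes "Some r \<in> cusps \<Gamma>"
  shows "set_integrable lborel {0<..} (\<lambda>y. f (Complex r y) * of_real y ^ n)"
    and "(LBINT y:{0<..}. f (Complex r y) * of_real y ^ n) = \<Lambda> r (of_nat (Suc n))"
proof -
  have *: "complex_of_real y powr (of_nat (Suc n) - 1) = of_real y ^ n" if "y \<in> {0<..}" for y
    using that powr_complexpow[of "of_real y" n] by simp
  have "set_integrable lborel {0<..} (\<lambda>y. f (Complex r y) * of_real y powr (of_nat (Suc n) - 1))"
    by (rule \<Lambda>_integrable[OF assms])
  then show "set_integrable lborel {0<..} (\<lambda>y. f (Complex r y) * of_real y ^ n)"
    by (rule set_integrable_cong[THEN iffD1, rotated 3]) (auto simp: * simp del: of_nat_Suc)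
  show "(LBINT y:{0<..}. f (Complex r y) * of_real y ^ n) = \<Lambda> r (of_nat (Suc n))"
    unfolding \<Lambda>_def by (rule set_lebesgue_integral_cong) (auto simp: * simp del: of_nat_Suc)
qed

lemma \<Lambda>_combination:
  assumes r: "Some r \<in> cusps \<Gamma>" and A: "finite A"
  shows "set_integrable lborel {0<..} (\<lambda>y. \<Sum>j\<in>A. c j * (f (Complex r y) * of_real y ^ n j))"
    and "(LBINT y:{0<..}. (\<Sum>j\<in>A. c j * (f (Complex r y) * of_real y ^ n j))) = (\<Sum>j\<in>A. c j * \<Lambda> r (of_nat (Suc (n j))))"
proof -
  have i: "set_integrable lborel {0<..} (\<lambda>y. c j * (f (Complex r y) * of_real y ^ n j))" for j
    by (intro set_integrable_mult_right \<Lambda>_power_integrable r)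
  show "set_integrable lborel {0<..} (\<lambda>y. \<Sum>j\<in>A. c j * (f (Complex r y) * of_real y ^ n j))"
    using i unfolding set_integrable_def by (simp add: scaleR_sum_right)
  have "(LBINT y:{0<..}. (\<Sum>j\<in>A. c j * (f (Complex r y) * of_real y ^ n j)))
    = (\<Sum>j\<in>A. LBINT y:{0<..}. c j * (f (Complex r y) * of_real y ^ n j))"
    using i unfolding set_integrable_def set_lebesgue_integral_def
    by (simp add: scaleR_sum_right Bochner_Integration.integral_sum)
  also have "\<dots> = (\<Sum>j\<in>A. c j * \<Lambda> r (of_nat (Suc (n j))))"
    by (simp add: \<Lambda>_power_integrable(2)[OF r])
  finally show "(LBINT y:{0<..}. (\<Sum>j\<in>A. c j * (f (Complex r y) * of_real y ^ n j))) = (\<Sum>j\<in>A. c j * \<Lambda> r (of_nat (Suc (n j))))" .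
qed

text \<open>Exponential decay of \<open>f\<close> beats the polynomial factor along a horizontal
  segment. The linear form \<open>\<alpha> * z + \<beta>\<close> is kept general so that the
  statement covers both the form itself and its pullback.\<close>

lemma horizontal_difference_tendsto_0:
  assumes der: "\<And>z. Im z > 0 \<Longrightarrow> (G has_field_derivative f z * ((z - u) ^ m * (\<alpha> * z + \<beta>) ^ m)) (at z)"
  shows "((\<lambda>y. G (Complex x1 y) - G (Complex x2 y)) \<longlongrightarrow> 0) at_top"
proof -
  obtain C c where C: "C \<ge> 0" "c > 0" "\<And>z. Im z \<ge> 1 \<Longrightarrow> cmod (f z) \<le> C * exp (- c * Im z)"
    using f_decay_at_infinity[of 1] by auto
  define X where "X = \<bar>x1\<bar> + \<bar>x2\<bar>"
  define K where "K = (X + 1 + cmod u) * (cmod \<alpha> * (X + 1) + cmod \<beta>)"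
  have X: "X \<ge> 0" by (simp add: X_def)
  \<comment> \<open>A bound for \<open>y^(2m+1) * exp (- c * y)\<close>: one power more than the
    polynomial needs, which leaves the factor \<open>1/y\<close>.\<close>
  define M where "M = (real (2 * m + 1) / c) ^ (2 * m + 1)"
  have bd: "cmod (f z * ((z - u) ^ m * (\<alpha> * z + \<beta>) ^ m)) \<le> C * K ^ m * M / y"
    if z: "z \<in> closed_segment (Complex x1 y) (Complex x2 y)" and y: "y \<ge> 1" for y z
  proof -
    obtain t where t: "0 \<le> t" "t \<le> 1" "z = (1 - t) *\<^sub>R Complex x1 y + t *\<^sub>R Complex x2 y"
      using z by (auto simp: closed_segment_def)
    have Iz: "Im z = y" by (simp add: t algebra_simps)
    have "\<bar>Re z\<bar> \<le> \<bar>(1 - t) * x1\<bar> + \<bar>t * x2\<bar>" by (simp add: t)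
    also have "\<dots> \<le> 1 * \<bar>x1\<bar> + 1 * \<bar>x2\<bar>" unfolding abs_mult using t by (intro add_mono mult_mono) auto
    finally have Rz: "\<bar>Re z\<bar> \<le> X" by (simp add: X_def)
    have "cmod z \<le> X + y" using cmod_le[of z] Rz Iz y by simp
    also have "\<dots> \<le> (X + 1) * y" using X y by (simp add: algebra_simps mult_le_cancel_left1)
    finally have nz: "cmod z \<le> (X + 1) * y" .
    have "cmod (z - u) \<le> (X + 1) * y + cmod u * y"
      using norm_triangle_ineq4[of z u] nz mult_left_mono[OF y, of "cmod u"] by simp
    then have 1: "cmod (z - u) \<le> (X + 1 + cmod u) * y" by (simp add: algebra_simps)
    have "cmod (\<alpha> * z + \<beta>) \<le> cmod \<alpha> * cmod z + cmod \<beta>"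
      using norm_triangle_ineq[of "\<alpha> * z" \<beta>] by (simp add: norm_mult)
    also have "\<dots> \<le> cmod \<alpha> * ((X + 1) * y) + cmod \<beta> * y"
      using nz mult_left_mono[OF y, of "cmod \<beta>"] by (intro add_mono mult_left_mono) auto
    finally have 2: "cmod (\<alpha> * z + \<beta>) \<le> (cmod \<alpha> * (X + 1) + cmod \<beta>) * y" by (simp add: algebra_simps)
    have "cmod ((z - u) * (\<alpha> * z + \<beta>)) \<le> ((X + 1 + cmod u) * y) * ((cmod \<alpha> * (X + 1) + cmod \<beta>) * y)"
      unfolding norm_mult using 1 2 X y by (intro mult_mono) auto
    also have "\<dots> = K * y\<^sup>2" by (simp add: K_def power2_eq_square)
    finally have P: "cmod ((z - u) ^ m * (\<alpha> * z + \<beta>) ^ m) \<le> (K * y\<^sup>2) ^ m"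
      unfolding power_mult_distrib[symmetric] norm_power by (intro power_mono) auto
    have "cmod (f z * ((z - u) ^ m * (\<alpha> * z + \<beta>) ^ m)) \<le> (C * exp (- c * y)) * (K * y\<^sup>2) ^ m"
      unfolding norm_mult[of "f z"] using P C(3)[of z] Iz y C(1) by (intro mult_mono) auto
    also have "\<dots> = C * K ^ m * (y ^ (2 * m + 1) * exp (- c * y)) / y"
      using y by (simp add: power_mult_distrib flip: power_mult)
    also have "\<dots> \<le> C * K ^ m * M / y"
      using power_exp_bound[OF C(2), of y "2 * m + 1"] y C(1) X
      by (intro divide_right_mono mult_left_mono) (auto simp: M_def K_def)
    finally show ?thesis .
  qed
  have le: "cmod (G (Complex x1 y) - G (Complex x2 y)) \<le> C * K ^ m * M * \<bar>x1 - x2\<bar> / y" if y: "y \<ge> 1" for y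
  proof -
    have pos: "Im z > 0" if z: "z \<in> closed_segment (Complex x1 y) (Complex x2 y)" for z
    proof -
      obtain t where "z = (1 - t) *\<^sub>R Complex x1 y + t *\<^sub>R Complex x2 y"
        using z by (auto simp: closed_segment_def)
      then have "Im z = (1 - t) * y + t * y" by simp
      then have "Im z = y" by (simp only: convex_combination_same)
      then show ?thesis using y by simp
    qed
    have "cmod (G (Complex x1 y) - G (Complex x2 y)) \<le> C * K ^ m * M / y * cmod (Complex x1 y - Complex x2 y)"
      by (rule field_differentiable_bound[of "closed_segment (Complex x1 y) (Complex x2 y)" G
            "\<lambda>z. f z * ((z - u) ^ m * (\<alpha> * z + \<beta>) ^ m)"])
         (use bd y pos der in \<open>auto intro: has_field_derivative_at_within\<close>)
    also have "Complex x1 y - Complex x2 y = of_real (x1 - x2)" by (simp add: complex_eq_iff)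
    finally show ?thesis by (simp only: norm_of_real) simp
  qed
  have "\<forall>\<^sub>F y in at_top. cmod (G (Complex x1 y) - G (Complex x2 y)) \<le> C * K ^ m * M * \<bar>x1 - x2\<bar> / y"
    using eventually_ge_at_top[of "1::real"] by eventually_elim (rule le)
  moreover have "((\<lambda>y. C * K ^ m * M * \<bar>x1 - x2\<bar> / y) \<longlongrightarrow> 0) at_top" by real_asymp
  ultimately show ?thesis by (rule Lim_null_comparison)
qed

text \<open>Conjugating a parabolic element by \<open>g\<close> moves its fixed point by
  \<open>g\<close>; the normal form with \<open>translation\<close> carries the argument through,
  also for infinity.\<close>

lemma cusp_image:
  assumes g: "g \<in> \<Gamma>" and r: "Some r \<in> cusps \<Gamma>"
  shows "moebius_P1 g (Some r) \<in> cusps \<Gamma>" and "moebius_P1 g None \<in> cusps \<Gamma>"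
proof -
  obtain g0 where g0: "g0 \<in> \<Gamma>" "parabolic g0" "moebius_P1 g0 (Some r) = Some r"
    using r by (auto simp: cusps_def)
  have dg: "det g = 1" using g det_1 by blast
  have conj: "(g ** g0 ** adj2 g) ** (g ** \<sigma>) = (g ** \<sigma>) ** t" if "g0 ** \<sigma> = \<sigma> ** t" for g0 \<sigma> t
  proof -
    have "(g ** g0 ** adj2 g) ** (g ** \<sigma>) = g ** g0 ** (adj2 g ** g) ** \<sigma>" by (simp add: matrix_mul_assoc)
    also have "\<dots> = g ** (g0 ** \<sigma>)" using dg by (simp add: adj2_mult matrix_mul_assoc)
    finally show ?thesis by (simp add: that matrix_mul_assoc)
  qed
  define \<sigma> where "\<sigma> = sl2 r (-1) 1 0"
  have d\<sigma>: "det \<sigma> = 1" by (simp add: \<sigma>_def det_2)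
  obtain s h where sh: "s = 1 \<or> s = -1" "h \<noteq> 0" "g0 ** \<sigma> = \<sigma> ** translation s h"
    unfolding \<sigma>_def by (rule parabolic_conj[OF g0])
  have "moebius_P1 (g ** \<sigma>) None \<in> cusps \<Gamma>"
    by (rule cusp_mem[OF _ _ sh(1,2) conj[OF sh(3)]]) (use g g0 dg d\<sigma> in \<open>auto simp: det_mul intro: mult_mem adj2_mem\<close>)
  moreover have "moebius_P1 \<sigma> None = Some r" by (simp add: \<sigma>_def moebius_P1_def)
  ultimately show "moebius_P1 g (Some r) \<in> cusps \<Gamma>"
    using moebius_P1_mult_None[OF dg d\<sigma>] by simp
  obtain s where s: "s = 1 \<or> s = -1" "translation s s \<in> \<Gamma>" by (rule translation_mem)
  have "moebius_P1 (g ** mat 1) None \<in> cusps \<Gamma>"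
    by (rule cusp_mem[OF _ _ s(1) _ conj[of "translation s s" "mat 1" "translation s s"]])
       (use g s dg in \<open>auto intro: mult_mem adj2_mem\<close>)
  then show "moebius_P1 g None \<in> cusps \<Gamma>" by simp
qed

text \<open>Cauchy's theorem on the ideal triangle with vertices \<open>\<gamma>r\<close>, \<open>\<gamma>\<infinity>\<close> and \<open>\<infinity>\<close>, for the form
  \<open>f(z) (z - \<gamma>r)\<^sup>m dz\<close>; the side from \<open>\<gamma>r\<close> to \<open>\<gamma>\<infinity>\<close> is pulled back by \<open>\<gamma>\<close>.\<close>

theorem period_relation:
  fixes m :: nat and r r' p :: real
  assumes g: "g \<in> \<Gamma>" and k: "k = 2 * (m + 1)" and r: "Some r \<in> cusps \<Gamma>"
    and r': "moebius_P1 g (Some r) = Some r'" and p: "moebius_P1 g None = Some p"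
  defines "c \<equiv> complex_of_real (entry g 2 1)" and "J \<equiv> aut_j g (of_real r)"
  shows "\<Lambda> r' (of_nat (m + 1)) =
     (\<Sum>j\<le>m. of_nat (m choose j) * (\<i> * (c / J)) ^ j * \<Lambda> r (of_nat (m + 1 + j)))
   + (\<Sum>j\<le>m. of_nat (m choose j) * (- \<i> / (c * J)) ^ j * \<Lambda> p (of_nat (m + 1 - j)))"
proof -
  define c0 d0 where "c0 = entry g 2 1" and "d0 = entry g 2 2"
  define J0 where "J0 = c0 * r + d0"
  have dg: "det g = 1" using g det_1 by blast
  have J: "J = of_real J0" by (simp add: J_def J0_def aut_j_def c0_def d0_def)
  have c: "c = of_real c0" by (simp add: c_def c0_def)
  have c0: "c0 \<noteq> 0" and p': "p = entry g 1 1 / c0"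
    using p by (auto simp: moebius_P1_def c0_def split: if_splits)
  have J0: "J0 \<noteq> 0" and r'': "r' = (entry g 1 1 * r + entry g 1 2) / J0"
    using r' by (auto simp: moebius_P1_def J0_def c0_def d0_def split: if_splits)
  have nz: "c \<noteq> 0" "J \<noteq> 0" using c c0 J J0 by auto
  have ad: "entry g 1 1 * d0 - entry g 1 2 * c0 = 1"
    using dg by (simp add: det_2 c0_def d0_def)
  have cr': "Some r' \<in> cusps \<Gamma>" and cp: "Some p \<in> cusps \<Gamma>"
    using cusp_image[OF g r] r' p by auto
  have mr: "moebius g (of_real r) = of_real r'"
    unfolding moebius_def J_def[symmetric] J r'' by simp
  have pr': "p - r' = 1 / (c0 * J0)"
  proof -
    have "p - r' = (entry g 1 1 * J0 - (entry g 1 1 * r + entry g 1 2) * c0) / (c0 * J0)"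
      using c0 J0 by (simp add: p' r'' field_simps)
    also have "entry g 1 1 * J0 - (entry g 1 1 * r + entry g 1 2) * c0 = 1"
      using ad by (simp add: J0_def algebra_simps)
    finally show ?thesis .
  qed
  define F where "F z = f z * (z - of_real r') ^ m" for z
  have "F holomorphic_on upper_half_plane"
    unfolding F_def by (intro holomorphic_intros f_holomorphic)
  moreover have "convex upper_half_plane" "open upper_half_plane"
    unfolding upper_half_plane_def by (auto intro: convex_halfspace_Im_gt open_halfspace_Im_gt)
  ultimately obtain G where "\<And>z. z \<in> upper_half_plane \<Longrightarrow> (G has_field_derivative F z) (at z)"
    using holomorphic_convex_primitive' by (metis at_within_open)
  then have G: "(G has_field_derivative F z) (at z)" if "Im z > 0" for z
    using that by (simp add: upper_half_plane_def)
  \<comment> \<open>A primitive of the pulled-back form. The weight contributes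
    \<open>j^(2m+2)\<close>, the difference to \<open>r'\<close> contributes
    \<open>(j * J)^(-m)\<close> and the derivative \<open>j^(-2)\<close>, so that
    \<open>(j / J)^m\<close> remains.\<close>
  define GG where "GG w = G (moebius g w)" for w
  have GG: "(GG has_field_derivative f w * ((w - of_real r) ^ m * (c / J * w + of_real d0 / J) ^ m)) (at w)"
    if w: "Im w > 0" for w
  proof -
    have jw: "aut_j g w \<noteq> 0" using aut_j_nonzero[OF dg w] .
    have "(GG has_field_derivative F (moebius g w) * (1 / (aut_j g w)\<^sup>2)) (at w)"
      unfolding GG_def using DERIV_chain2[OF G[OF Im_moebius_pos[OF dg w]] moebius_has_field_derivative[OF dg jw]] .
    moreover have "F (moebius g w) * (1 / (aut_j g w)\<^sup>2) = f w * ((w - of_real r) ^ m * (c / J * w + of_real d0 / J) ^ m)"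
    proof -
      have "moebius g w - of_real r' = (w - of_real r) / (aut_j g w * J)"
        using moebius_diff[OF dg jw, of "of_real r"] nz by (simp add: mr J_def)
      then have "F (moebius g w) * (1 / (aut_j g w)\<^sup>2)
          = aut_j g w ^ (2 * (m + 1)) * f w * ((w - of_real r) / (aut_j g w * J)) ^ m * (1 / (aut_j g w)\<^sup>2)"
        by (simp add: F_def f_moebius[OF g w] k)
      also have "\<dots> = f w * ((w - of_real r) ^ m * (aut_j g w / J) ^ m)"
        using jw nz by (simp add: power_divide power_mult_distrib power_add power2_eq_square mult_2 field_simps)
           (auto simp: mult_2_right simp flip: power_add)
      also have "aut_j g w / J = c / J * w + of_real d0 / J"
        by (simp add: aut_j_def c_def d0_def add_divide_distrib)
      finally show ?thesis .
    qed
    ultimately show ?thesis by simp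
  qed
  \<comment> \<open>Derivatives of the primitives along the vertical lines above \<open>r'\<close>,
    \<open>r\<close> and \<open>p\<close>; only the second belongs to the pullback. The shift
    \<open>1 / (c * J)\<close> in the third is \<open>p - r'\<close>.\<close>
  define \<phi>1 where "\<phi>1 y = \<i> * (f (Complex r' y) * (\<i> * of_real y) ^ m)" for y :: real
  define \<phi>2 where "\<phi>2 y = \<i> * (f (Complex r y) * ((\<i> * of_real y) ^ m * (1 + c * (\<i> * of_real y) / J) ^ m))" for y :: real
  define \<phi>3 where "\<phi>3 y = \<i> * (f (Complex p y) * (1 / (c * J) + \<i> * of_real y) ^ m)" for y :: real
  have der1: "((\<lambda>y. G (Complex r' y)) has_vector_derivative \<phi>1 y) (at y)" if "y > 0" for y
  proof -
    have "Complex r' y - of_real r' = \<i> * of_real y" by (simp add: complex_eq_iff)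
    then show ?thesis using vertical_derivative[OF G[of "Complex r' y"]] that by (simp add: \<phi>1_def F_def)
  qed
  have der3: "((\<lambda>y. G (Complex p y)) has_vector_derivative \<phi>3 y) (at y)" if "y > 0" for y
  proof -
    have "1 / (c * J) = of_real (p - r')" by (simp add: pr' c J)
    then have "Complex p y - of_real r' = 1 / (c * J) + \<i> * of_real y" by (simp add: complex_eq_iff)
    then show ?thesis using vertical_derivative[OF G[of "Complex p y"]] that by (simp add: \<phi>3_def F_def)
  qed
  have der2: "((\<lambda>y. GG (Complex r y)) has_vector_derivative \<phi>2 y) (at y)" if "y > 0" for y
  proof -
    have "Complex r y - of_real r = \<i> * of_real y" by (simp add: complex_eq_iff)
    moreover have "c / J * Complex r y + of_real d0 / J = 1 + c * (\<i> * of_real y) / J"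
    proof -
      have "c * Complex r y + of_real d0 = J + c * (\<i> * of_real y)"
        by (simp add: complex_eq_iff c J J0_def)
      then have "(c * Complex r y + of_real d0) / J = (J + c * (\<i> * of_real y)) / J" by simp
      then show ?thesis using nz by (simp add: add_divide_distrib)
    qed
    ultimately show ?thesis
      using vertical_derivative[OF GG[of "Complex r y"]] that by (simp only: \<phi>2_def) simp
  qed
  have e1: "\<phi>1 y = (\<Sum>j\<in>{0::nat}. \<i> ^ (m + 1) * (f (Complex r' y) * of_real y ^ m))" for y
    by (simp add: \<phi>1_def power_mult_distrib mult_ac)
  have e2: "\<phi>2 y = (\<Sum>j\<le>m. (\<i> ^ (m + 1) * (of_nat (m choose j) * (\<i> * (c / J)) ^ j)) * (f (Complex r y) * of_real y ^ (m + j)))" for y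
  proof -
    have "(1 + c * (\<i> * of_real y) / J) ^ m = (\<Sum>j\<le>m. of_nat (m choose j) * (c * (\<i> * of_real y) / J) ^ j)"
      using binomial_ring[of "c * (\<i> * of_real y) / J" 1 m] by (simp add: add.commute)
    also have "\<dots> = (\<Sum>j\<le>m. of_nat (m choose j) * (\<i> * (c / J)) ^ j * of_real y ^ j)"
      by (intro sum.cong refl) (simp add: power_mult_distrib power_divide mult_ac)
    finally show ?thesis
      by (simp add: \<phi>2_def power_mult_distrib power_add sum_distrib_left mult_ac)
  qed
  have e3: "\<phi>3 y = (\<Sum>j\<le>m. (\<i> ^ (m + 1) * (of_nat (m choose j) * (- \<i> / (c * J)) ^ j)) * (f (Complex p y) * of_real y ^ (m - j)))" for y
  proof -
    have ii: "\<i> * \<i> ^ (m - j) = \<i> ^ (m + 1) * (- \<i>) ^ j" if "j \<le> m" for j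
    proof -
      have "\<i> ^ (m + 1) * (- \<i>) ^ j = \<i> * \<i> ^ (m - j) * (\<i> ^ j * (- \<i>) ^ j)"
        using that by (simp flip: power_add)
      also have "\<i> ^ j * (- \<i>) ^ j = 1" by (simp flip: power_mult_distrib)
      finally show ?thesis by simp
    qed
    have "(1 / (c * J) + \<i> * of_real y) ^ m = (\<Sum>j\<le>m. of_nat (m choose j) * (1 / (c * J)) ^ j * (\<i> * of_real y) ^ (m - j))"
      by (rule binomial_ring)
    then have "\<phi>3 y = (\<Sum>j\<le>m. (\<i> * \<i> ^ (m - j)) * (of_nat (m choose j) * (1 / (c * J)) ^ j) * (f (Complex p y) * of_real y ^ (m - j)))"
      by (simp add: \<phi>3_def power_mult_distrib sum_distrib_left mult_ac)
    also have "\<dots> = (\<Sum>j\<le>m. (\<i> ^ (m + 1) * (of_nat (m choose j) * (- \<i> / (c * J)) ^ j)) * (f (Complex p y) * of_real y ^ (m - j)))"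
    proof (intro sum.cong refl)
      fix j assume "j \<in> {..m}"
      then have j: "j \<le> m" by simp
      have "(- \<i> / (c * J)) ^ j = (- \<i>) ^ j * (1 / (c * J)) ^ j"
        by (simp only: power_divide power_one mult_1_right times_divide_eq_right)
      then show "(\<i> * \<i> ^ (m - j)) * (of_nat (m choose j) * (1 / (c * J)) ^ j) * (f (Complex p y) * of_real y ^ (m - j))
        = (\<i> ^ (m + 1) * (of_nat (m choose j) * (- \<i> / (c * J)) ^ j)) * (f (Complex p y) * of_real y ^ (m - j))"
        unfolding ii[OF j] by (simp only: mult_ac)
    qed
    finally show ?thesis .
  qed
  have i1: "set_integrable lborel {0<..} \<phi>1" and v1: "(LBINT y:{0<..}. \<phi>1 y) = \<i> ^ (m + 1) * \<Lambda> r' (of_nat (Suc m))"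
    unfolding e1[abs_def] using \<Lambda>_combination[OF cr', of "{0::nat}" "\<lambda>_. \<i> ^ (m + 1)" "\<lambda>_. m"] by simp_all
  have i2: "set_integrable lborel {0<..} \<phi>2" and v2: "(LBINT y:{0<..}. \<phi>2 y) =
      (\<Sum>j\<le>m. (\<i> ^ (m + 1) * (of_nat (m choose j) * (\<i> * (c / J)) ^ j)) * \<Lambda> r (of_nat (Suc (m + j))))"
    unfolding e2[abs_def] by (rule \<Lambda>_combination[OF r]; simp)+
  have i3: "set_integrable lborel {0<..} \<phi>3" and v3: "(LBINT y:{0<..}. \<phi>3 y) =
      (\<Sum>j\<le>m. (\<i> ^ (m + 1) * (of_nat (m choose j) * (- \<i> / (c * J)) ^ j)) * \<Lambda> p (of_nat (Suc (m - j))))"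
    unfolding e3[abs_def] by (rule \<Lambda>_combination[OF cp]; simp)+
  obtain l10 l11 where l1: "((\<lambda>y. G (Complex r' y)) \<longlongrightarrow> l10) (at_right 0)" "((\<lambda>y. G (Complex r' y)) \<longlongrightarrow> l11) at_top"
      "(LBINT y:{0<..}. \<phi>1 y) = l11 - l10"
    using half_line_FTC[OF der1 i1] by blast
  obtain l20 l21 where l2: "((\<lambda>y. GG (Complex r y)) \<longlongrightarrow> l20) (at_right 0)" "((\<lambda>y. GG (Complex r y)) \<longlongrightarrow> l21) at_top"
      "(LBINT y:{0<..}. \<phi>2 y) = l21 - l20"
    using half_line_FTC[OF der2 i2] by blast
  obtain l30 l31 where l3: "((\<lambda>y. G (Complex p y)) \<longlongrightarrow> l30) (at_right 0)" "((\<lambda>y. G (Complex p y)) \<longlongrightarrow> l31) at_top"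
      "(LBINT y:{0<..}. \<phi>3 y) = l31 - l30"
    using half_line_FTC[OF der3 i3] by blast
  \<comment> \<open>The vertex at infinity: the lines above \<open>r'\<close> and \<open>p\<close>
    have the same limit upwards.\<close>
  have "((\<lambda>y. G (Complex r' y) - G (Complex p y)) \<longlongrightarrow> 0) at_top"
    by (rule horizontal_difference_tendsto_0[where u = "of_real r'" and m = m and \<alpha> = 0 and \<beta> = 1])
       (use G in \<open>simp add: F_def\<close>)
  moreover have "((\<lambda>y. G (Complex r' y) - G (Complex p y)) \<longlongrightarrow> l11 - l31) at_top"
    by (intro tendsto_diff l1 l3)
  ultimately have eq1: "l11 = l31" using tendsto_unique trivial_limit_at_top_linorder by fastforce
  \<comment> \<open>The vertex \<open>p\<close>. Upwards, the line above \<open>r\<close> may be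
    exchanged for the one above \<open>- d0 / c0\<close>, the pole of the map, which is carried to
    the vertical line above \<open>p\<close> traversed downwards.\<close>
  have eq2: "l21 = l30"
  proof -
    have "((\<lambda>y. GG (Complex r y) - GG (Complex (- d0 / c0) y)) \<longlongrightarrow> 0) at_top"
      by (rule horizontal_difference_tendsto_0[OF GG])
    from tendsto_diff[OF l2(2) this]
    have A: "((\<lambda>y. GG (Complex (- d0 / c0) y)) \<longlongrightarrow> l21) at_top" by simp
    have mo: "moebius g (Complex (- d0 / c0) y) = Complex p (1 / (c0\<^sup>2 * y))" if "y > 0" for y
    proof -
      have j: "aut_j g (Complex (- d0 / c0) y) = of_real c0 * \<i> * of_real y"
        using c0 by (simp add: aut_j_def complex_eq_iff flip: c0_def d0_def)
      have "of_real (entry g 1 1) * Complex (- d0 / c0) y + of_real (entry g 1 2)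
          = Complex p (1 / (c0\<^sup>2 * y)) * (of_real c0 * \<i> * of_real y)"
        using c0 ad that by (simp add: complex_eq_iff p' power2_eq_square field_simps)
      then show ?thesis using c0 that unfolding moebius_def j by simp
    qed
    have "filterlim (\<lambda>y. 1 / (c0\<^sup>2 * y)) (at_right 0) at_top" using c0 by real_asymp
    from filterlim_compose[OF l3(1) this]
    have "((\<lambda>y. G (Complex p (1 / (c0\<^sup>2 * y)))) \<longlongrightarrow> l30) at_top" .
    moreover have "\<forall>\<^sub>F y in at_top. G (Complex p (1 / (c0\<^sup>2 * y))) = GG (Complex (- d0 / c0) y)"
      using eventually_gt_at_top[of 0] by eventually_elim (simp only: GG_def mo)
    ultimately have "((\<lambda>y. GG (Complex (- d0 / c0) y)) \<longlongrightarrow> l30) at_top"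
      by (rule Lim_transform_eventually)
    with A show ?thesis using tendsto_unique trivial_limit_at_top_linorder by blast
  qed
  \<comment> \<open>The vertex \<open>r'\<close>. The image of the line above \<open>r\<close> has
    height \<open>\<eta> y\<close> and horizontal offset \<open>\<kappa> * y * \<eta> y\<close> from
    \<open>r'\<close>. On the segment across, \<open>f\<close> is at most of order
    \<open>\<eta>^(-m-1)\<close> by boundedness of \<open>phi\<close>, and the zero at
    \<open>r'\<close> gains \<open>\<eta>^m\<close>; the difference of primitives is therefore of
    order \<open>y\<close>.\<close>
  have eq3: "l10 = l20"
  proof -
    define \<eta> where "\<eta> y = y / (J0\<^sup>2 + c0\<^sup>2 * y\<^sup>2)" for y
    define \<kappa> where "\<kappa> = c0 / J0"
    have den: "J0\<^sup>2 + c0\<^sup>2 * y\<^sup>2 > 0" for y using J0 by (intro add_pos_nonneg) auto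
    have \<eta>: "\<eta> y > 0" if "y > 0" for y using that den by (simp add: \<eta>_def)
    have mo: "moebius g (Complex r y) = Complex (r' + \<kappa> * y * \<eta> y) (\<eta> y)" if "y > 0" for y
    proof -
      have j: "aut_j g (Complex r y) = Complex J0 (c0 * y)"
        by (simp add: aut_j_def complex_eq_iff J0_def c0_def d0_def)
      have jnz: "aut_j g (Complex r y) \<noteq> 0" using aut_j_nonzero[OF dg] that by simp
      have "moebius g (Complex r y) - of_real r' = (\<i> * of_real y) / (Complex J0 (c0 * y) * of_real J0)"
      proof -
        have Ci: "Complex r y - of_real r = \<i> * of_real y" by (simp add: complex_eq_iff)
        show ?thesis
          using moebius_diff[OF dg jnz, of "of_real r"] nz unfolding mr J_def[symmetric] j Ci J by simp
      qed
      also have "\<dots> = Complex (\<kappa> * y * \<eta> y) (\<eta> y)"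
      proof -
        have e: "\<eta> y * (J0\<^sup>2 + c0\<^sup>2 * y\<^sup>2) = y" using den[of y] by (simp add: \<eta>_def)
        have "Complex (\<kappa> * y * \<eta> y) (\<eta> y) * (Complex J0 (c0 * y) * of_real J0)
          = Complex 0 (\<eta> y * (J0\<^sup>2 + c0\<^sup>2 * y\<^sup>2))"
          using J0 by (simp add: complex_eq_iff \<kappa>_def power2_eq_square algebra_simps)
        also have "\<dots> = \<i> * of_real y" unfolding e by (simp add: complex_eq_iff)
        finally show ?thesis using jnz J0 unfolding j by (simp add: field_simps)
      qed
      finally show ?thesis by (simp add: complex_eq_iff)
    qed
    obtain B where B: "B > 0" "\<And>z. Im z > 0 \<Longrightarrow> (cmod (f z))\<^sup>2 * Im z ^ k \<le> B"
      using phi_bounded by blast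
    have fb: "cmod (f z) \<le> sqrt B / Im z ^ (m + 1)" if z: "Im z > 0" for z
    proof -
      have "(cmod (f z) * Im z ^ (m + 1))\<^sup>2 = (cmod (f z))\<^sup>2 * Im z ^ k"
        unfolding k power_mult_distrib power_mult[symmetric] mult.commute[of "m + 1" 2] ..
      then have "(cmod (f z) * Im z ^ (m + 1))\<^sup>2 \<le> B"
        using B(2)[OF z] by simp
      then have "cmod (f z) * Im z ^ (m + 1) \<le> sqrt B" by (rule real_le_rsqrt)
      then show ?thesis using z by (simp add: pos_le_divide_eq)
    qed
    define D where "D = sqrt B * (\<bar>\<kappa>\<bar> + 1) ^ m * \<bar>\<kappa>\<bar>"
    have diff: "cmod (GG (Complex r y) - G (Complex r' (\<eta> y))) \<le> D * y" if y: "y > 0" "y \<le> 1" for y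
    proof -
      define S where "S = closed_segment (Complex (r' + \<kappa> * y * \<eta> y) (\<eta> y)) (Complex r' (\<eta> y))"
      have e0: "\<eta> y > 0" using \<eta> y by blast
      have S: "Im z = \<eta> y \<and> cmod (z - of_real r') \<le> (\<bar>\<kappa>\<bar> + 1) * \<eta> y" if zS: "z \<in> S" for z
      proof -
        obtain t where t: "0 \<le> t" "t \<le> 1" "z = (1 - t) *\<^sub>R Complex (r' + \<kappa> * y * \<eta> y) (\<eta> y) + t *\<^sub>R Complex r' (\<eta> y)"
          using zS unfolding S_def in_segment(1) by blast
        have "Im z = (1 - t) * \<eta> y + t * \<eta> y" unfolding t(3) by simp
        then have Im: "Im z = \<eta> y" by (simp only: convex_combination_same)
        have "Re z = (1 - t) * (r' + \<kappa> * y * \<eta> y) + t * r'" unfolding t(3) by simp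
        then have "Re z - r' = (1 - t) * (\<kappa> * y * \<eta> y)" by (simp only: convex_combination_diff)
        then have "\<bar>Re z - r'\<bar> = (1 - t) * y * (\<bar>\<kappa>\<bar> * \<eta> y)"
          using t(1,2) y e0 by (simp add: abs_mult)
        also have "\<dots> \<le> 1 * (\<bar>\<kappa>\<bar> * \<eta> y)"
          using t(1,2) y e0 by (intro mult_right_mono mult_le_one) auto
        finally have "cmod (z - of_real r') \<le> \<bar>\<kappa>\<bar> * \<eta> y + \<eta> y"
          using cmod_le[of "z - of_real r'"] Im e0 by simp
        then show ?thesis using Im by (simp add: algebra_simps)
      qed
      have "cmod (G (Complex (r' + \<kappa> * y * \<eta> y) (\<eta> y)) - G (Complex r' (\<eta> y)))
        \<le> sqrt B * (\<bar>\<kappa>\<bar> + 1) ^ m / \<eta> y * cmod (Complex (r' + \<kappa> * y * \<eta> y) (\<eta> y) - Complex r' (\<eta> y))"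
      proof (rule field_differentiable_bound[of S G F])
        fix z assume z: "z \<in> S"
        then have Iz: "Im z > 0" using S e0 by simp
        show "(G has_field_derivative F z) (at z within S)"
          using G[OF Iz] by (rule has_field_derivative_at_within)
        have "cmod (F z) \<le> (sqrt B / Im z ^ (m + 1)) * ((\<bar>\<kappa>\<bar> + 1) * \<eta> y) ^ m"
          unfolding F_def norm_mult norm_power using fb[OF Iz] S[OF z] Iz B(1)
          by (intro mult_mono power_mono) auto
        also have "\<dots> = sqrt B * (\<bar>\<kappa>\<bar> + 1) ^ m / \<eta> y"
          using S[OF z] e0 unfolding power_mult_distrib by simp
        finally show "cmod (F z) \<le> sqrt B * (\<bar>\<kappa>\<bar> + 1) ^ m / \<eta> y" .
      qed (auto simp: S_def)
      also have "Complex (r' + \<kappa> * y * \<eta> y) (\<eta> y) - Complex r' (\<eta> y) = of_real (\<kappa> * y * \<eta> y)"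
        by (simp add: complex_eq_iff)
      also have "sqrt B * (\<bar>\<kappa>\<bar> + 1) ^ m / \<eta> y * cmod (of_real (\<kappa> * y * \<eta> y)) = D * y"
        unfolding norm_of_real abs_mult D_def using e0 y by simp
      finally show ?thesis using y by (simp add: GG_def mo)
    qed
    have "\<forall>\<^sub>F y in at_right 0. cmod (GG (Complex r y) - G (Complex r' (\<eta> y))) \<le> D * y"
      by (rule eventually_at_rightI[of 0 1]) (auto intro: diff)
    moreover have "((\<lambda>y. D * y) \<longlongrightarrow> 0) (at_right 0)" by (auto intro!: tendsto_eq_intros)
    ultimately have "((\<lambda>y. GG (Complex r y) - G (Complex r' (\<eta> y))) \<longlongrightarrow> 0) (at_right 0)"
      by (rule Lim_null_comparison)
    from tendsto_diff[OF l2(1) this]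
    have A: "((\<lambda>y. G (Complex r' (\<eta> y))) \<longlongrightarrow> l20) (at_right 0)" by simp
    have "filterlim \<eta> (at_right 0) (at_right 0)"
      unfolding filterlim_at
    proof
      show "\<forall>\<^sub>F y in at_right 0. \<eta> y \<in> {0<..} \<and> \<eta> y \<noteq> 0"
        by (rule eventually_at_rightI[of 0 1]) (use \<eta> in force)+
      show "(\<eta> \<longlongrightarrow> 0) (at_right 0)"
        unfolding \<eta>_def using J0 by (auto intro!: tendsto_eq_intros)
    qed
    from filterlim_compose[OF l1(1) this]
    have "((\<lambda>y. G (Complex r' (\<eta> y))) \<longlongrightarrow> l10) (at_right 0)" .
    with A show ?thesis using tendsto_unique trivial_limit_at_right_real by blast
  qed
  \<comment> \<open>By the three vertex identities the endpoint differences telescope: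
    \<open>l11 - l10 = (l21 - l20) + (l31 - l30)\<close>.\<close>
  have "\<i> ^ (m + 1) * \<Lambda> r' (of_nat (Suc m)) =
      (\<Sum>j\<le>m. (\<i> ^ (m + 1) * (of_nat (m choose j) * (\<i> * (c / J)) ^ j)) * \<Lambda> r (of_nat (Suc (m + j))))
    + (\<Sum>j\<le>m. (\<i> ^ (m + 1) * (of_nat (m choose j) * (- \<i> / (c * J)) ^ j)) * \<Lambda> p (of_nat (Suc (m - j))))"
    unfolding v1[symmetric] v2[symmetric] v3[symmetric] l1(3) l2(3) l3(3) eq1 eq2 eq3 by simp
  also have "\<dots> = \<i> ^ (m + 1) * ((\<Sum>j\<le>m. of_nat (m choose j) * (\<i> * (c / J)) ^ j * \<Lambda> r (of_nat (Suc (m + j))))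
    + (\<Sum>j\<le>m. of_nat (m choose j) * (- \<i> / (c * J)) ^ j * \<Lambda> p (of_nat (Suc (m - j)))))"
    by (simp only: sum_distrib_left distrib_left mult.assoc)
  finally have "\<Lambda> r' (of_nat (Suc m)) = (\<Sum>j\<le>m. of_nat (m choose j) * (\<i> * (c / J)) ^ j * \<Lambda> r (of_nat (Suc (m + j))))
    + (\<Sum>j\<le>m. of_nat (m choose j) * (- \<i> / (c * J)) ^ j * \<Lambda> p (of_nat (Suc (m - j))))"
    by (simp only: mult_cancel_left) simp
  moreover have "(\<Sum>j\<le>m. of_nat (m choose j) * (- \<i> / (c * J)) ^ j * \<Lambda> p (of_nat (Suc (m - j))))
      = (\<Sum>j\<le>m. of_nat (m choose j) * (- \<i> / (c * J)) ^ j * \<Lambda> p (of_nat (m + 1 - j)))"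
    by (intro sum.cong refl) (simp add: Suc_diff_le)
  moreover have "Suc m = m + 1" "\<And>j. Suc (m + j) = m + 1 + j" by simp_all
  ultimately show ?thesis by (simp only:)
qed

end

section \<open>Quantum modularity\<close>

text \<open>Away from infinity the one-point compactification carries the usual topology, so
  continuity can be tested on the real line.\<close>

lemma continuous_map_P1_finite_part:
  fixes g :: "real option \<Rightarrow> complex"
  assumes U: "open U" and cont: "continuous_on U (\<lambda>r. g (Some r))"
  shows "continuous_map (subtopology P1_real (Some ` U)) euclidean g"
  unfolding continuous_map_def
proof (intro conjI allI impI)
  fix V :: "complex set" assume "openin euclidean V"
  then have V: "open V" by simp
  define W where "W = {r \<in> U. g (Some r) \<in> V}"
  have "W = U \<inter> (\<lambda>r. g (Some r)) -` V" by (auto simp: W_def)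
  then have "open W" using continuous_open_preimage[OF cont U V] by simp
  then have "openin P1_real (Some ` W)" by (simp add: P1_real_def)
  moreover have "{x \<in> topspace (subtopology P1_real (Some ` U)). g x \<in> V} = Some ` W \<inter> Some ` U"
    by (auto simp: P1_real_def W_def)
  ultimately show "openin (subtopology P1_real (Some ` U)) {x \<in> topspace (subtopology P1_real (Some ` U)). g x \<in> V}"
    unfolding openin_subtopology by blast
qed simp

text \<open>Matches one summand of the formula with one of \<open>period_relation\<close>, for
  \<open>w = 2 * pi\<close>: since \<open>(-i)^(-j) = i^j\<close>, the powers of
  \<open>- i w\<close> and \<open>w\<close> combine to \<open>i^j * w^n\<close>, and the two Gamma
  factors cancel.\<close>

lemma twist_term_plus:
  fixes b c J w x :: complex
  assumes "w \<noteq> 0" "G * G' = 1"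
  shows "b / (inverse c * J) ^ j * ((- \<i> * w) powi (- int j) * G / H) * (w ^ (n + j) * G' * x)
    = w ^ n * inverse H * (b * (\<i> * (c / J)) ^ j * x)"
proof -
  have "(- \<i> * w) ^ j * (\<i> ^ j * w ^ n) = (- \<i> * w * \<i>) ^ j * w ^ n"
    by (simp only: power_mult_distrib mult_ac)
  also have "- \<i> * w * \<i> = w" by (simp add: complex_eq_iff)
  finally have "(- \<i> * w) ^ j * (\<i> ^ j * w ^ n) = w ^ (n + j)"
    by (simp only: power_add mult_ac)
  moreover have "(- \<i> * w) ^ j \<noteq> 0" using assms(1) by simp
  ultimately have P: "inverse ((- \<i> * w) ^ j) * w ^ (n + j) = \<i> ^ j * w ^ n"
    by (metis (no_types, lifting) left_inverse mult.assoc mult_1)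
  have Q: "inverse ((inverse c * J) ^ j) = (c / J) ^ j"
    by (simp add: power_inverse[symmetric] divide_inverse)
  have "b / (inverse c * J) ^ j * ((- \<i> * w) powi (- int j) * G / H) * (w ^ (n + j) * G' * x)
    = (b * x * inverse H) * inverse ((inverse c * J) ^ j) * (inverse ((- \<i> * w) ^ j) * w ^ (n + j)) * (G * G')"
    by (simp only: divide_inverse power_int_minus power_int_of_nat mult_ac)
  also have "\<dots> = w ^ n * inverse H * (b * (\<i> * (c / J)) ^ j * x)"
    unfolding P Q assms(2) by (simp only: power_mult_distrib mult_ac mult_1_left)
  finally show ?thesis .
qed

lemma twist_term_minus:
  fixes b c J w x :: complex
  assumes "G * G' = 1"
  shows "b / (c * J) ^ j * ((- \<i> * w) powi int j * G / H) * (w ^ n * G' * x)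
    = w ^ (n + j) * inverse H * (b * (- \<i> / (c * J)) ^ j * x)"
proof -
  have "b / (c * J) ^ j * ((- \<i> * w) powi int j * G / H) * (w ^ n * G' * x)
    = (b * x * inverse H) * inverse ((c * J) ^ j) * ((- \<i>) ^ j * w ^ j * w ^ n) * (G * G')"
    by (simp only: divide_inverse power_int_of_nat power_mult_distrib mult_ac)
  also have "\<dots> = w ^ (n + j) * inverse H * (b * (- \<i> / (c * J)) ^ j * x)"
    unfolding assms power_divide power_add by (simp only: divide_inverse mult_ac mult_1_left)
  finally show ?thesis .
qed

context cusp_form_setting
begin

lemma additive_twist_L_of_nat:
  assumes "Some r \<in> cusps \<Gamma>"
  shows "additive_twist_L f k r (of_nat n) = (2 * of_real pi) ^ n * rGamma (of_nat n) * \<Lambda> r (of_nat n)"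
  using powr_complexpow[of "2 * of_real pi" n] by (simp add: additive_twist_L_eq[OF assms])

text \<open>\<open>period_relation\<close> multiplied by
  \<open>(2 * pi)^(k/2) / Gamma (k/2)\<close>. In weight 0 the truncated subtraction gives
  \<open>m = 0\<close>, so both sums are empty.\<close>

lemma additive_twist_L_reciprocity:
  fixes r r' p :: real
  assumes g: "g \<in> \<Gamma>" and r: "Some r \<in> cusps \<Gamma>"
    and r': "moebius_P1 g (Some r) = Some r'" and p: "moebius_P1 g None = Some p"
  shows "(let L = additive_twist_L f k; c = complex_of_real (entry g 2 1); J = aut_j g (of_real r);
             m = k div 2 - 1; h = (of_nat k / 2 :: complex)
         in L r' h - L r h =
              L p h
              + (\<Sum>j=1..m. of_nat (m choose j) / (inverse c * J) ^ j
                   * ((- 2 * of_real pi * \<i>) powi (- int j) * Gamma (h + of_nat j) / Gamma h)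
                   * L r (h + of_nat j))
              + (\<Sum>j=1..m. of_nat (m choose j) / (c * J) ^ j
                   * ((- 2 * of_real pi * \<i>) powi (int j) * Gamma (h - of_nat j) / Gamma h)
                   * L p (h - of_nat j)))"
proof -
  have cr': "Some r' \<in> cusps \<Gamma>" and cp: "Some p \<in> cusps \<Gamma>"
    using cusp_image[OF g r] r' p by auto
  show ?thesis
  proof (cases "k = 0")
    case True
    \<comment> \<open>All central values vanish because of the zero of \<open>1 / Gamma\<close> at \<open>0\<close>.\<close>
    have z: "additive_twist_L f k x 0 = 0" if "Some x \<in> cusps \<Gamma>" for x
      by (simp add: additive_twist_L_eq[OF that])
    show ?thesis unfolding Let_def using True z[OF r] z[OF cr'] z[OF cp] by simp
  next
    case False
    then obtain n where n: "k = 2 * n" "n > 0" using even_k by (auto elim!: evenE)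
    then obtain m where m: "n = m + 1" by (metis Suc_eq_plus1 gr0_implies_Suc)
    have k: "k = 2 * (m + 1)" using n m by simp
    have km: "k div 2 - 1 = m" and kh: "(of_nat k / 2 :: complex) = of_nat (m + 1)" using k by simp_all
    define c where "c = complex_of_real (entry g 2 1)"
    define J where "J = aut_j g (of_real r)"
    define w where "w = 2 * complex_of_real pi"
    define C where "C = w ^ (m + 1) * rGamma (of_nat (m + 1))"
    define L where "L = additive_twist_L f k"
    have w0: "w \<noteq> 0" by (simp add: w_def)
    have wi: "- 2 * of_real pi * \<i> = - \<i> * w" by (simp add: w_def)
    have L: "L x (of_nat n) = w ^ n * rGamma (of_nat n) * \<Lambda> x (of_nat n)" if "Some x \<in> cusps \<Gamma>" for x n
      using additive_twist_L_of_nat[OF that] by (simp add: L_def w_def)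
    have G: "Gamma (of_nat n) * rGamma (of_nat n) = (1 :: complex)" if "n > 0" for n
    proof -
      have "Gamma (of_nat n :: complex) \<noteq> 0"
        using that by (simp add: Gamma_eq_zero_iff of_nat_in_nonpos_Ints_iff)
      then show ?thesis by (simp add: rGamma_inverse_Gamma)
    qed
    have T1: "of_nat (m choose j) / (inverse c * J) ^ j
         * ((- 2 * of_real pi * \<i>) powi (- int j) * Gamma (of_nat (m + 1) + of_nat j) / Gamma (of_nat (m + 1)))
         * L r (of_nat (m + 1) + of_nat j)
       = C * (of_nat (m choose j) * (\<i> * (c / J)) ^ j * \<Lambda> r (of_nat (m + 1 + j)))" for j
      unfolding wi of_nat_add[symmetric] L[OF r] C_def rGamma_inverse_Gamma[of "of_nat (m + 1)"]
      by (rule twist_term_plus[OF w0 G]) simp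
    have T2: "of_nat (m choose j) / (c * J) ^ j
         * ((- 2 * of_real pi * \<i>) powi (int j) * Gamma (of_nat (m + 1) - of_nat j) / Gamma (of_nat (m + 1)))
         * L p (of_nat (m + 1) - of_nat j)
       = C * (of_nat (m choose j) * (- \<i> / (c * J)) ^ j * \<Lambda> p (of_nat (m + 1 - j)))" if "j \<in> {1..m}" for j
    proof -
      have j: "j \<le> m" using that by simp
      have e: "(of_nat (m + 1) - of_nat j :: complex) = of_nat (m + 1 - j)" using j by (simp only: of_nat_diff)
      have n: "m + 1 - j + j = m + 1" using j by simp
      show ?thesis
        unfolding wi e L[OF cp] C_def rGamma_inverse_Gamma[of "of_nat (m + 1)"]
        by (rule twist_term_minus[OF G, where n = "m + 1 - j" and j = j, unfolded n]) (use j in simp)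
    qed
    have "L r' (of_nat (m + 1)) = C * \<Lambda> r' (of_nat (m + 1))"
      by (simp only: L[OF cr'] C_def)
    also have "\<dots> = (\<Sum>j\<le>m. C * (of_nat (m choose j) * (\<i> * (c / J)) ^ j * \<Lambda> r (of_nat (m + 1 + j))))
      + (\<Sum>j\<le>m. C * (of_nat (m choose j) * (- \<i> / (c * J)) ^ j * \<Lambda> p (of_nat (m + 1 - j))))"
      unfolding period_relation[OF g k r r' p, folded c_def J_def] by (simp only: sum_distrib_left distrib_left)
    \<comment> \<open>The two terms with \<open>j = 0\<close> are the central values at
      \<open>r\<close> and at \<open>p\<close>.\<close>
    also have "{..m} = insert 0 {1..m}" by auto
    finally have "L r' (of_nat (m + 1)) - L r (of_nat (m + 1)) = L p (of_nat (m + 1))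
      + (\<Sum>j=1..m. C * (of_nat (m choose j) * (\<i> * (c / J)) ^ j * \<Lambda> r (of_nat (m + 1 + j))))
      + (\<Sum>j=1..m. C * (of_nat (m choose j) * (- \<i> / (c * J)) ^ j * \<Lambda> p (of_nat (m + 1 - j))))"
      using L[OF r, of "m + 1"] L[OF cp, of "m + 1"] by (simp add: C_def)
    then show ?thesis
      unfolding Let_def km kh L_def[symmetric] c_def[symmetric] J_def[symmetric]
      by (simp only: T1 T2 cong: sum.cong)
  qed
qed

text \<open>The defining condition involves \<open>r\<close> only through \<open>e2pi (n r)\<close>,
  so the two definite descriptions are literally the same, also where no entire extension is
  known.\<close>

lemma additive_twist_L_periodic: "additive_twist_L f k (r + of_int n) = additive_twist_L f k r"
proof -
  have "e2pi (of_nat l * of_real (r + of_int n)) = e2pi (of_nat l * of_real r)" for l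
  proof -
    have "of_nat l * complex_of_real (r + of_int n) = of_nat l * of_real r + of_int (int l * n)"
      by (simp add: algebra_simps)
    then show ?thesis by (simp only: e2pi_add e2pi_of_int mult_1_right)
  qed
  then show ?thesis unfolding additive_twist_L_def by (simp only:)
qed

text \<open>If \<open>\<gamma>\<close> fixes infinity it acts as an integer translation and the
  difference is 0. Otherwise the right-hand side of the reciprocity formula is the continuous
  extension.\<close>

lemma additive_twist_L_quantum:
  "quantum_modular_form \<Gamma> 0 {None} (\<lambda>x. additive_twist_L f k (the x) (of_nat k / 2))"
  unfolding quantum_modular_form_def
proof (intro conjI ballI)
  fix \<gamma> assume \<gamma>: "\<gamma> \<in> \<Gamma>"
  define S where "S = {None} \<union> moebius_P1 \<gamma> -` {None}"
  have "\<exists>g. continuous_map (subtopology P1_real (- S)) euclidean g \<and>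
        (\<forall>r. Some r \<in> cusps \<Gamma> - S \<longrightarrow>
           g (Some r) = additive_twist_L f k (the (moebius_P1 \<gamma> (Some r))) (of_nat k / 2)
                        - aut_j \<gamma> (of_real r) powi 0 * additive_twist_L f k (the (Some r)) (of_nat k / 2))"
  proof (cases "entry \<gamma> 2 1 = 0")
    case True
    then have "moebius_P1 \<gamma> None = None" by (simp add: moebius_P1_def)
    then obtain n :: int where "\<gamma> = translation 1 (of_int n) \<or> \<gamma> = - translation 1 (of_int n)"
      using stabiliser_infinity \<gamma> by blast
    then have "moebius_P1 \<gamma> (Some r) = Some (r + of_int n)" for r
      by (auto simp: moebius_P1_def translation_def)
    then show ?thesis
      by (intro exI[of _ "\<lambda>_. 0"]) (simp add: additive_twist_L_periodic)
  next
    case c: False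
    define p where "p = entry \<gamma> 1 1 / entry \<gamma> 2 1"
    have p: "moebius_P1 \<gamma> None = Some p" using c by (simp add: moebius_P1_def p_def)
    define m where "m = k div 2 - 1"
    define h where "h = (of_nat k / 2 :: complex)"
    define D where "D r s = (\<Sum>n. a n * e2pi (of_nat n * of_real r) * of_nat n powr (- s))" for r :: real and s
    \<comment> \<open>The right-hand side with the Dirichlet series \<open>D\<close> in place of the
      continued values at \<open>r\<close>, so that it is defined for every real \<open>r\<close>,
      cusp or not.\<close>
    define R where "R r = additive_twist_L f k p h
        + (\<Sum>j=1..m. of_nat (m choose j) / (inverse (of_real (entry \<gamma> 2 1)) * aut_j \<gamma> (of_real r)) ^ j
             * ((- 2 * of_real pi * \<i>) powi (- int j) * Gamma (h + of_nat j) / Gamma h)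
             * D r (h + of_nat j))
        + (\<Sum>j=1..m. of_nat (m choose j) / (of_real (entry \<gamma> 2 1) * aut_j \<gamma> (of_real r)) ^ j
             * ((- 2 * of_real pi * \<i>) powi (int j) * Gamma (h - of_nat j) / Gamma h)
             * additive_twist_L f k p (h - of_nat j))" for r :: real
    define U where "U = {r. entry \<gamma> 2 1 * r + entry \<gamma> 2 2 \<noteq> 0}"
    \<comment> \<open>Infinity and the pole of \<open>\<gamma>\<close> are both removed, so the
      domain is an open part of the real line on which the denominators do not vanish.\<close>
    have S: "- S = Some ` U"
    proof (intro equalityI subsetI)
      fix x assume x: "x \<in> - S"
      then obtain r where "x = Some r" by (cases x) (auto simp: S_def)
      then show "x \<in> Some ` U" using x by (auto simp: S_def U_def moebius_P1_def)
    qed (auto simp: S_def U_def moebius_P1_def)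
    have U: "open U" unfolding U_def by (intro open_Collect_neq continuous_intros)
    have jU: "aut_j \<gamma> (of_real r) \<noteq> 0" if "r \<in> U" for r
      using that unfolding U_def aut_j_def by (simp flip: of_real_mult of_real_add)
    \<comment> \<open>Since \<open>j\<close> starts at 1, the real part is at least
      \<open>k/2 + 1\<close>.\<close>
    have hj: "Re (h + of_nat j) > (real k + 1) / 2" if "j \<in> {1..m}" for j
      using that by (simp add: h_def)
    have Dc: "continuous_on U (\<lambda>r. D r (h + of_nat j))" if "j \<in> {1..m}" for j
      unfolding D_def by (rule continuous_on_subset[OF dirichlet_continuous[OF hj[OF that]]]) simp
    have jc: "continuous_on U (\<lambda>r. aut_j \<gamma> (of_real r))" unfolding aut_j_def by (intro continuous_intros)
    have "continuous_on U R"
      unfolding R_def[abs_def] by (intro continuous_intros Dc jc) (use jU c in auto)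
    then have "continuous_map (subtopology P1_real (- S)) euclidean (\<lambda>x. R (the x))"
      unfolding S by (intro continuous_map_P1_finite_part U) simp
    moreover have "R r = additive_twist_L f k (the (moebius_P1 \<gamma> (Some r))) (of_nat k / 2)
                        - aut_j \<gamma> (of_real r) powi 0 * additive_twist_L f k (the (Some r)) (of_nat k / 2)"
      if r: "Some r \<in> cusps \<Gamma> - S" for r
    proof -
      obtain r' where r': "moebius_P1 \<gamma> (Some r) = Some r'" using r by (auto simp: S_def)
      have cr: "Some r \<in> cusps \<Gamma>" using r by simp
      have e: "additive_twist_L f k r (h + of_nat j) = D r (h + of_nat j)" if "j \<in> {1..m}" for j
        unfolding D_def by (rule additive_twist_L_dirichlet[OF cr hj[OF that]])
      have "additive_twist_L f k r' h - additive_twist_L f k r h = R r"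
        using additive_twist_L_reciprocity[OF \<gamma> cr r' p]
        unfolding Let_def m_def[symmetric] h_def[symmetric] R_def by (simp only: e cong: sum.cong)
      then show ?thesis by (simp add: r' h_def)
    qed
    ultimately show ?thesis by (intro exI[of _ "\<lambda>x. R (the x)"]) simp
  qed
  then show "\<exists>g. continuous_map (subtopology P1_real (- ({None} \<union> moebius_P1 \<gamma> -` {None}))) euclidean g \<and>
        (\<forall>r. Some r \<in> cusps \<Gamma> - ({None} \<union> moebius_P1 \<gamma> -` {None}) \<longrightarrow>
           g (Some r) = additive_twist_L f k (the (moebius_P1 \<gamma> (Some r))) (of_nat k / 2)
                        - aut_j \<gamma> (of_real r) powi 0 * additive_twist_L f k (the (Some r)) (of_nat k / 2))"
    unfolding S_def .
qed simp

end

theorem theorem4p4: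
  fixes \<Gamma> :: "(real^2^2) set" and k :: nat and f :: "complex \<Rightarrow> complex"
  assumes "subgroup \<Gamma> SL2R" and "discrete \<Gamma>" and "finite_covolume \<Gamma>"
    and "cusp_at_infinity_of_width \<Gamma> 1"
    and "even k" and "cusp_form \<Gamma> k f"
  shows "quantum_modular_form \<Gamma> 0 {None} (\<lambda>x. additive_twist_L f k (the x) (of_nat k / 2))
    \<and> (\<forall>\<gamma>\<in>\<Gamma>. \<forall>r r' p :: real.
        Some r \<in> cusps \<Gamma> \<longrightarrow> moebius_P1 \<gamma> (Some r) = Some r' \<longrightarrow> moebius_P1 \<gamma> None = Some p \<longrightarrow>
        (let L = additive_twist_L f k; c = complex_of_real (entry \<gamma> 2 1); J = aut_j \<gamma> (of_real r);
             m = k div 2 - 1; h = (of_nat k / 2 :: complex)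
         in L r' h - L r h =
              L p h
              + (\<Sum>j=1..m. of_nat (m choose j) / (inverse c * J) ^ j
                   * ((- 2 * of_real pi * \<i>) powi (- int j) * Gamma (h + of_nat j) / Gamma h)
                   * L r (h + of_nat j))
              + (\<Sum>j=1..m. of_nat (m choose j) / (c * J) ^ j
                   * ((- 2 * of_real pi * \<i>) powi (int j) * Gamma (h - of_nat j) / Gamma h)
                   * L p (h - of_nat j))))"
proof -
  interpret cusp_form_setting \<Gamma> k f
    by (intro cusp_form_setting.intro fuchsian.intro cusp_form_setting_axioms.intro assms)
  show ?thesis
    using additive_twist_L_quantum additive_twist_L_reciprocity by blast
qed

end
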